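(* Let $n,k,\ell,m$ be integers with $n\ge 2$, $1\le \ell\le k\le n-1$ and $1\le m\le 2\ell-1$. If $m$ is even, then $\omega_{k,\ell}^{(m)}(\mathfrak{sl}_n)=0$. If $m$ is odd, then $$\omega_{k,\ell}^{(m)}(\mathfrak{sl}_n)=\mathcal{Q}_{k,\ell}^{(m)}\times\mathcal{R}_{k,\ell}^{(m)},$$ where $$\mathcal{Q}_{k,\ell}^{(m)}=2\,(-1)^{k+\ell+n-1}(2k+2\ell-2m+1)\,\frac{(k!)^2(\ell!)^2\,(n-k-\ell+m-1)!}{m!\,(n+k+\ell-m)!},$$ $$\mathcal{R}_{k,\ell}^{(m)}=\sum_{q\in\mathbb{Z}}(-1)^q\binom{q+1}{2k+2\ell-m+1}\binom{m}{q-k-\ell+m-n+1}\binom{2k-m}{q-\ell-n+1}\binom{2\ell-m}{q-k-n+1},$$ with the convention that $\binom{s}{t}=0$ unless $0\le t\le s$, and the convention that the product $\mathcal{Q}_{k,\ell}^{(m)}\mathcal{R}_{k,\ell}^{(m)}$ is read as $0$ when $k+\ell-m\ge n$ (where $\mathcal{R}_{k,\ell}^{(m)}$ is an empty sum).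
   Context: All Lie algebras are over $\mathbb{C}$. Let $(E,H,F)$ be a principal $\mathfrak{sl}_2$-triple in $\mathfrak{sl}_n=\mathfrak{sl}_n(\mathbb{C})$ (traceless $n\times n$ matrices): $[H,E]=2E$, $[H,F]=-2F$, $[E,F]=H$, and $E$ is principal nilpotent (a nilpotent matrix with a single Jordan block of size $n$). For $1\le i\le n-1$ and $-i\le j\le i$ put $G_{i,j}=\mathrm{ad}_F^{\,i-j}(E^i)$, where $E^i$ is the matrix power; these form a basis of $\mathfrak{sl}_n$. Put $V_i=\mathrm{Span}(G_{i,j}\mid -i\le j\le i)$, let $\mathcal{H}_{2i}=\mathbb{C}_{2i}[x,y]$ be the space of homogeneous polynomials of degree $2i$, set $m_{i,j}=y^{i-j}\frac{x^{i+j}}{(i+j)!}$, and let $\Phi_i:V_i\to\mathcal{H}_{2i}$ be the linear isomorphism with $\Phi_i(G_{i,j})=m_{i,j}$. For homogeneous $P,Q\in\mathbb{C}[x,y]$ the $m$-th transvectant (Cayley $\Omega$-process, without normalizing factor) is $$(P,Q)_m=\sum_{s=0}^m(-1)^s\binom{m}{s}\frac{\partial^mP}{\partial x^{m-s}\partial y^s}\,\frac{\partial^mQ}{\partial x^s\partial y^{m-s}}.$$ The structure constants $\omega_{k,\ell}^{(m)}=\omega_{k,\ell}^{(m)}(\mathfrak{sl}_n)$, $1\le\ell\le k\le n-1$, $1\le m\le 2\ell-1$, are the unique complex numbers with $\omega_{k,\ell}^{(m)}=0$ when $k+\ell-m\ge n$ and such that for all $-k\le i\le k$, $-\ell\le j\le\ell$,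 $$[G_{k,i},G_{\ell,j}]=\sum_{m=1}^{2\ell-1}\omega_{k,\ell}^{(m)}\,\Phi_{k+\ell-m}^{-1}\big((m_{k,i},m_{\ell,j})_m\big)$$ (terms with $k+\ell-m\ge n$ omitted). Equivalently, $[E^k,F^\ell]=\sum_{m}\frac{(-1)^\ell\omega_{k,\ell}^{(m)}}{(2\ell-m)!}G_{k+\ell-m,k-\ell}$. *)

theory Defs
  imports
    Complex_Main
    "HOL-Library.Groups_Big_Fun"
    "HOL-Computational_Algebra.Polynomial"
    "Jordan_Normal_Form.Jordan_Normal_Form"
begin

section \<open>Principal triples in \<open>sl\<^sub>n\<close>\<close>

definition mat_trace :: "complex mat \<Rightarrow> complex" where
  "mat_trace A = (\<Sum>a<dim_row A. A $$ (a, a))"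

definition sl_carrier :: "nat \<Rightarrow> complex mat set" where
  "sl_carrier n = {A \<in> carrier_mat n n. mat_trace A = 0}"

definition lie_bracket :: "complex mat \<Rightarrow> complex mat \<Rightarrow> complex mat" where
  "lie_bracket A B = A * B - B * A"

definition principal_sl2_triple ::
  "nat \<Rightarrow> complex mat \<Rightarrow> complex mat \<Rightarrow> complex mat \<Rightarrow> bool" where
  "principal_sl2_triple n E H F \<longleftrightarrow>
     E \<in> sl_carrier n \<and> H \<in> sl_carrier n \<and> F \<in> sl_carrier n \<and>
     lie_bracket H E = 2 \<cdot>\<^sub>m E \<and>
     lie_bracket H F = (- 2) \<cdot>\<^sub>m F \<and>
     lie_bracket E F = H \<and>
     similar_mat E (jordan_block n 0)"

text \<open>Finite sums in the space of \<open>n \<times> n\<close> matrices; the matrix type is not an additive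
  monoid, so \<^const>\<open>sum\<close> is not available.\<close>

abbreviation mat_sum :: "nat \<Rightarrow> ('i \<Rightarrow> complex mat) \<Rightarrow> 'i set \<Rightarrow> complex mat" where
  "mat_sum n \<equiv> finsum (module_mat TYPE(complex) n n)"

text \<open>\<open>G\<^sub>i\<^sub>,\<^sub>j = ad\<^sub>F\<^sup>i\<^sup>-\<^sup>j(E\<^sup>i)\<close>, meant for \<open>-i \<le> j \<le> i\<close>.\<close>

definition G_elt :: "complex mat \<Rightarrow> complex mat \<Rightarrow> nat \<Rightarrow> int \<Rightarrow> complex mat" where
  "G_elt E F i j = (lie_bracket F ^^ nat (int i - j)) (E ^\<^sub>m i)"

definition V_space :: "nat \<Rightarrow> complex mat \<Rightarrow> complex mat \<Rightarrow> nat \<Rightarrow> complex mat set" where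
  "V_space n E F i =
     {mat_sum n (\<lambda>j. c j \<cdot>\<^sub>m G_elt E F i j) {- int i..int i} | c :: int \<Rightarrow> complex. True}"

section \<open>Polynomials in two variables\<close>

text \<open>\<open>\<complex>[x,y]\<close> is represented as \<open>\<complex>[y][x]\<close>: the outer variable is \<open>x\<close>, the inner one \<open>y\<close>.\<close>

type_synonym bipoly = "complex poly poly"

definition var_x :: bipoly where "var_x = [:0, 1:]"
definition var_y :: bipoly where "var_y = [:[:0, 1:]:]"

definition scale_bipoly :: "complex \<Rightarrow> bipoly \<Rightarrow> bipoly" where
  "scale_bipoly c P = Polynomial.smult [:c:] P"

definition partial_x :: "bipoly \<Rightarrow> bipoly" where "partial_x P = pderiv P"
definition partial_y :: "bipoly \<Rightarrow> bipoly" where "partial_y P = map_poly pderiv P"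

definition transvectant :: "nat \<Rightarrow> bipoly \<Rightarrow> bipoly \<Rightarrow> bipoly" where
  "transvectant m P Q =
     (\<Sum>s\<le>m. (- 1) ^ s * of_nat (m choose s)
        * (partial_x ^^ (m - s)) ((partial_y ^^ s) P)
        * (partial_x ^^ s) ((partial_y ^^ (m - s)) Q))"

text \<open>\<open>m\<^sub>i\<^sub>,\<^sub>j = y\<^sup>i\<^sup>-\<^sup>j x\<^sup>i\<^sup>+\<^sup>j / (i+j)!\<close>, meant for \<open>-i \<le> j \<le> i\<close>.\<close>

definition m_elt :: "nat \<Rightarrow> int \<Rightarrow> bipoly" where
  "m_elt i j = scale_bipoly (1 / fact (nat (int i + j)))
     (var_y ^ nat (int i - j) * var_x ^ nat (int i + j))"

section \<open>The isomorphisms \<open>\<Phi>\<^sub>i\<close> and the structure constants\<close>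

text \<open>The linear extension of \<open>G\<^sub>i\<^sub>,\<^sub>j \<mapsto> m\<^sub>i\<^sub>,\<^sub>j\<close>. It is well defined on
  \<^term>\<open>V_space n E F i\<close> for \<open>1 \<le> i \<le> n - 1\<close> because the \<open>G\<^sub>i\<^sub>,\<^sub>j\<close> are then linearly independent.\<close>

definition Phi :: "nat \<Rightarrow> complex mat \<Rightarrow> complex mat \<Rightarrow> nat \<Rightarrow> complex mat \<Rightarrow> bipoly" where
  "Phi n E F i A = (THE P. \<exists>c :: int \<Rightarrow> complex.
     A = mat_sum n (\<lambda>j. c j \<cdot>\<^sub>m G_elt E F i j) {- int i..int i} \<and>
     P = (\<Sum>j\<in>{- int i..int i}. scale_bipoly (c j) (m_elt i j)))"

definition Phi_inv :: "nat \<Rightarrow> complex mat \<Rightarrow> complex mat \<Rightarrow> nat \<Rightarrow> bipoly \<Rightarrow> complex mat" where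
  "Phi_inv n E F i = inv_into (V_space n E F i) (Phi n E F i)"

text \<open>The constants with upper index \<open>m\<close> outside \<open>1 \<le> m \<le> 2 \<ell> - 1\<close> are set to 0, so that the
  whole family \<open>w\<close> is unique. In the sum \<open>m < k + \<ell>\<close>, so the subtraction does not truncate.\<close>

definition is_structure_constants ::
  "nat \<Rightarrow> complex mat \<Rightarrow> complex mat \<Rightarrow> nat \<Rightarrow> nat \<Rightarrow> (nat \<Rightarrow> complex) \<Rightarrow> bool" where
  "is_structure_constants n E F k l w \<longleftrightarrow>
     (\<forall>m. m \<notin> {1..2 * l - 1} \<or> k + l - m \<ge> n \<longrightarrow> w m = 0) \<and>
     (\<forall>i\<in>{- int k..int k}. \<forall>j\<in>{- int l..int l}.
        lie_bracket (G_elt E F k i) (G_elt E F l j) =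
        mat_sum n
          (\<lambda>m. w m \<cdot>\<^sub>m Phi_inv n E F (k + l - m) (transvectant m (m_elt k i) (m_elt l j)))
          {m \<in> {1..2 * l - 1}. k + l - m < n})"

definition structure_constant ::
  "nat \<Rightarrow> complex mat \<Rightarrow> complex mat \<Rightarrow> nat \<Rightarrow> nat \<Rightarrow> nat \<Rightarrow> complex" where
  "structure_constant n E F k l m = (THE w. is_structure_constants n E F k l w) m"

section \<open>The explicit formula\<close>

definition zbinom :: "int \<Rightarrow> int \<Rightarrow> complex" where
  "zbinom s t = (if 0 \<le> t \<and> t \<le> s then of_nat (nat s choose nat t) else 0)"

text \<open>Meant for \<open>m \<le> k + \<ell> < n + m\<close>, when no natural subtraction truncates.\<close>

definition Q_coeff :: "nat \<Rightarrow> nat \<Rightarrow> nat \<Rightarrow> nat \<Rightarrow> complex" where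
  "Q_coeff n k l m =
     2 * (- 1) ^ (k + l + n - 1) * of_nat (2 * k + 2 * l - 2 * m + 1)
     * ((fact k)\<^sup>2 * (fact l)\<^sup>2 * fact (n + m - (k + l + 1)))
     / (fact m * fact (n + k + l - m))"

text \<open>\<^const>\<open>Sum_any\<close> sums over all integers \<open>q\<close>; the second binomial coefficient restricts \<open>q\<close>
  to an interval of length \<open>m\<close>, so the support is finite.\<close>

definition R_coeff :: "nat \<Rightarrow> nat \<Rightarrow> nat \<Rightarrow> nat \<Rightarrow> complex" where
  "R_coeff n k l m = Sum_any (\<lambda>q :: int. (- 1) powi q
     * zbinom (q + 1) (2 * int k + 2 * int l - int m + 1)
     * zbinom (int m) (q - int k - int l + int m - int n + 1)
     * zbinom (2 * int k - int m) (q - int l - int n + 1)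
     * zbinom (2 * int l - int m) (q - int k - int n + 1))"

end

theory Submission
  imports Defs "HOL-Computational_Algebra.Formal_Power_Series"
begin

text \<open>
  Pairing \<open>[E\<^sup>k, ad\<^sub>F\<^sup>m(E\<^sup>l)]\<close> with \<open>F\<^sup>p\<close>, \<open>p = k + l - m\<close>, under the trace form kills every component
  of the transvectant expansion except the one in \<open>V\<^sub>p\<close>, so the structure constant is a quotient of
  traces. Since \<open>ad\<^sub>F\<close> is skew for the trace form and commutes with multiplication by \<open>F\<^sup>p\<close>, the
  numerator is \<open>T(k, l) - (-1)\<^sup>m T(l, k)\<close> with \<open>T(k, l) = tr(E\<^sup>k ad\<^sub>F\<^sup>m(E\<^sup>l) F\<^sup>p)\<close>. In the realization
  \<open>E = x \<partial>\<^sub>y\<close>, \<open>F = y \<partial>\<^sub>x\<close> on binary forms of degree \<open>n - 1\<close> the trace \<open>T(k, l)\<close> is a double sum of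
  binomial coefficients, which Nanjundiah's and Vandermonde's identities reduce to Racah's single sum.
  That sum is symmetric in \<open>k\<close> and \<open>l\<close>, whence the factor \<open>1 - (-1)\<^sup>m\<close>.

  The expansion itself holds by equivariance: it propagates from \<open>E\<^sup>k\<close> to all of \<open>V\<^sub>k\<close> by \<open>ad\<^sub>F\<close>, and for
  \<open>E\<^sup>k\<close> the difference of both sides is, inductively, a highest weight vector, that is a multiple of a
  power of \<open>E\<close>, on which the trace form with the powers of \<open>F\<close> is nondegenerate.
\<close>

text \<open>The pairing isolates one component because \<open>F\<close> commutes with
  \<open>F ^\<^sub>m p\<close>: by skewness every image of \<open>ad_F\<close> is orthogonal to the
  powers of \<open>F\<close>, so a component can contribute only through its highest weight vector,
  and \<open>H\<close> separates the highest weight vectors of different components. The hypothesis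
  gives the Jordan form of \<open>E\<close> alone, while the realization on binary forms needs one
  change of basis that carries both \<open>E\<close> and \<open>F\<close> to the standard pair; tr H
  = 0 supplies it by forcing the weight n - 1 on the kernel vector of \<open>E\<close>. The
  expansion has no terms m = 0 and m = 2l, although transvectants of these orders exist: both orders
  are even, so the factor 1 - (-1)^m removes them from the commutator. The vectors
  \<open>g p z\<close> are rescaled by (2p - z)! to \<open>gh p z\<close>. This replaces the
  normalized monomials by plain ones, whose transvectant coefficients are polynomials in the
  exponents, so that their identities need no range conditions.\<close>

section \<open>Binomial identities\<close>

text \<open>Count the (u+v+1)-subsets of an (n+c)-set by the position b + c of the element with
  exactly v chosen elements below it; \<open>c \<le> v\<close> excludes the positions below c. The
  formal proof is Pascal's rule in the first factor.\<close>

lemma sum_choose_mult_choose: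
  fixes n u v c :: nat
  assumes "c \<le> v"
  shows "(\<Sum>b<n. (n - 1 - b choose u) * (b + c choose v)) = (n + c) choose (u + v + 1)"
proof (induction u arbitrary: n)
  case 0
  show ?case
  proof (induction n)
    case 0
    show ?case using assms by simp
  next
    case (Suc n)
    then show ?case by simp
  qed
next
  case (Suc u)
  note IHu = Suc.IH
  show ?case
  proof (induction n)
    case 0
    show ?case using assms by simp
  next
    case (Suc n)
    have "(\<Sum>b<Suc n. (Suc n - 1 - b choose Suc u) * (b + c choose v)) =
        (\<Sum>b<n. (Suc (n - 1 - b) choose Suc u) * (b + c choose v))"
      by (simp, intro sum.cong) (auto simp flip: Suc_diff_Suc)
    also have "\<dots> = (\<Sum>b<n. (n - 1 - b choose u) * (b + c choose v)) +
        (\<Sum>b<n. (n - 1 - b choose Suc u) * (b + c choose v))"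
      by (simp add: sum.distrib algebra_simps)
    also have "\<dots> = (Suc n + c) choose (Suc u + v + 1)"
      unfolding IHu Suc.IH by simp
    finally show ?case .
  qed
qed

text \<open>Turns a product of two binomials in b into a combination of single ones, so that
  \<open>sum_choose_mult_choose\<close> can carry out a sum over b. Expanding the last factor by
  Vandermonde and regrouping C(p,j) C(j,i) leaves two more Vandermonde sums, over j and then over
  i.\<close>

lemma nanjundiah:
  fixes b k p d :: nat
  assumes "p \<le> d + k"
  shows "(b + k choose k) * (b + p choose d) =
    (\<Sum>j\<le>d. (p choose j) * (d + k - p choose (d - j)) * (b + k + j choose (k + d)))"
proof -
  \<comment> \<open>The \<open>of_bool\<close> guards a truncated subtraction: for j < i the factor
    \<open>p - i choose (j - i)\<close> would be 1 instead of 0.\<close>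
  have step: "(p choose j) * (b + k + j choose (k + d)) =
      (\<Sum>i\<le>d. (p choose i) * (p - i choose (j - i)) * of_bool (i \<le> j) * (b + k choose (k + d - i)))"
    if "j \<le> d" for j
  proof -
    have "(b + k + j choose (k + d)) = (\<Sum>i\<le>k + d. (j choose i) * (b + k choose (k + d - i)))"
      by (subst vandermonde) (simp add: add.commute)
    also have "\<dots> = (\<Sum>i\<le>d. (j choose i) * (b + k choose (k + d - i)))"
      using that by (intro sum.mono_neutral_right) auto
    finally have "(p choose j) * (b + k + j choose (k + d)) =
        (\<Sum>i\<le>d. (p choose j) * (j choose i) * (b + k choose (k + d - i)))"
      by (simp add: sum_distrib_left mult.assoc)
    moreover have "(p choose j) * (j choose i) = (p choose i) * (p - i choose (j - i)) * of_bool (i \<le> j)" for i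
    proof (cases "i \<le> j \<and> j \<le> p")
      case True
      then show ?thesis by (simp add: choose_mult)
    next
      case False
      then show ?thesis by (cases "i \<le> j"; cases "p < i") (auto simp: not_le binomial_eq_0)
    qed
    ultimately show ?thesis by (simp only:)
  qed
  have "(\<Sum>j\<le>d. (p choose j) * (d + k - p choose (d - j)) * (b + k + j choose (k + d))) =
      (\<Sum>j\<le>d. (d + k - p choose (d - j)) * ((p choose j) * (b + k + j choose (k + d))))"
    by (simp add: mult_ac)
  also have "\<dots> = (\<Sum>j\<le>d. \<Sum>i\<le>d. (d + k - p choose (d - j)) *
      ((p choose i) * (p - i choose (j - i)) * of_bool (i \<le> j) * (b + k choose (k + d - i))))"
    by (intro sum.cong refl) (simp add: step sum_distrib_left)
  also have "\<dots> = (\<Sum>i\<le>d. \<Sum>j\<le>d. (d + k - p choose (d - j)) *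
      ((p choose i) * (p - i choose (j - i)) * of_bool (i \<le> j) * (b + k choose (k + d - i))))"
    by (rule sum.swap)
  also have "\<dots> = (\<Sum>i\<le>d. (b + k choose k) * ((p choose i) * (b choose (d - i))))"
  proof (intro sum.cong refl)
    fix i assume "i \<in> {..d}"
    then have i: "i \<le> d" by simp
    have "(\<Sum>j\<le>d. (d + k - p choose (d - j)) *
        ((p choose i) * (p - i choose (j - i)) * of_bool (i \<le> j) * (b + k choose (k + d - i)))) =
      (\<Sum>j\<in>{i..d}. (d + k - p choose (d - j)) *
        ((p choose i) * (p - i choose (j - i)) * (b + k choose (k + d - i))))"
      by (rule sum.mono_neutral_cong_right) auto
    also have "\<dots> = (\<Sum>j\<le>d - i. (d + k - p choose (d - i - j)) *
        ((p choose i) * (p - i choose j) * (b + k choose (k + d - i))))"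
      by (rule sum.reindex_bij_witness[where i = "\<lambda>j. j + i" and j = "\<lambda>j. j - i"]) (use i in auto)
    also have "\<dots> = (p choose i) * (b + k choose (k + d - i)) *
        (\<Sum>j\<le>d - i. (p - i choose j) * (d + k - p choose (d - i - j)))"
      by (simp add: sum_distrib_left mult_ac)
    also have "(\<Sum>j\<le>d - i. (p - i choose j) * (d + k - p choose (d - i - j))) =
        (p - i + (d + k - p) choose (d - i))"
      by (rule vandermonde)
    also have "(p choose i) * (b + k choose (k + d - i)) * (p - i + (d + k - p) choose (d - i)) =
        (b + k choose k) * ((p choose i) * (b choose (d - i)))"
    proof (cases "i \<le> p")
      case True
      have "p - i + (d + k - p) = k + d - i" using True i assms by simp
      moreover have "(b + k choose (k + d - i)) * (k + d - i choose k) = (b + k choose k) * (b choose (d - i))"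
      proof (cases "d - i \<le> b")
        case True
        then show ?thesis using i by (subst choose_mult) auto
      next
        case False
        then show ?thesis using i by (simp add: binomial_eq_0)
      qed
      moreover have "(k + d - i choose (d - i)) = (k + d - i choose k)"
        using i by (subst binomial_symmetric) auto
      ultimately show ?thesis by simp
    qed simp
    finally show "(\<Sum>j\<le>d. (d + k - p choose (d - j)) *
        ((p choose i) * (p - i choose (j - i)) * of_bool (i \<le> j) * (b + k choose (k + d - i)))) =
        (b + k choose k) * ((p choose i) * (b choose (d - i)))" .
  qed
  also have "\<dots> = (b + k choose k) * (b + p choose d)"
    by (simp flip: sum_distrib_left add: vandermonde add.commute)
  finally show ?thesis by simp
qed

text \<open>Coefficient of t^r in (1+t)^(-p-1) (1+t)^q. Upper negation absorbs the signs into a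
  negative top, Vandermonde adds the tops to r - k - 1, and a second upper negation returns to
  k.\<close>

lemma alternating_vandermonde:
  fixes p q r k :: nat
  assumes "q + k = p + r"
  shows "(\<Sum>s\<le>r. (- 1) ^ s * of_nat (p + s choose s) * of_nat (q choose (r - s))) =
    ((- 1) ^ r * of_nat (k choose r) :: complex)"
proof -
  have "(- 1) ^ s * of_nat (p + s choose s) = ((- (of_nat p + 1)) gchoose s :: complex)" for s
    by (subst gbinomial_minus) (simp add: binomial_gbinomial algebra_simps)
  then have "(\<Sum>s\<le>r. (- 1) ^ s * of_nat (p + s choose s) * of_nat (q choose (r - s))) =
      (\<Sum>s\<le>r. ((- (of_nat p + 1)) gchoose s) * (of_nat q gchoose (r - s)) :: complex)"
    by (simp add: binomial_gbinomial)
  also have "\<dots> = (- (of_nat p + 1) + of_nat q) gchoose r"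
    unfolding gbinomial_Vandermonde[symmetric] by (simp add: atLeast0AtMost)
  also have "- (of_nat p + 1) + of_nat q = (- (of_nat k + 1 - of_nat r) :: complex)"
    using arg_cong[OF assms, of "of_nat :: nat \<Rightarrow> complex"] by (simp add: algebra_simps)
  also have "(- (of_nat k + 1 - of_nat r) gchoose r :: complex) = (- 1) ^ r * of_nat (k choose r)"
    by (subst gbinomial_minus) (simp add: binomial_gbinomial algebra_simps)
  finally show ?thesis .
qed

text \<open>The sum of \<open>R_coeff\<close> in the variable r = k + l + n - 1 - q, without the
  sign (-1)^(k+l+n-1). In this variable the symmetry in k and l is visible and all arguments are
  natural numbers.\<close>

definition racah_sum :: "nat \<Rightarrow> nat \<Rightarrow> nat \<Rightarrow> nat \<Rightarrow> complex" where
  "racah_sum n k l m = (\<Sum>r\<le>min m (min k l). (- 1) ^ r * of_nat ((m choose r) *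
     (2 * k - m choose (k - r)) * (2 * l - m choose (l - r)) *
     (n + k + l - r choose (2 * k + 2 * l - m + 1))))"

lemma racah_sum_commute: "racah_sum n k l m = racah_sum n l k m"
  by (simp add: racah_sum_def min.commute mult_ac add_ac)

text \<open>Up to the factor \<open>l! m!\<close>, the coefficient by which \<open>ad\<^sub>F\<^sup>m(E\<^sup>l)\<close> acts on \<open>x\<^sup>a y\<^sup>b\<close>
  when \<open>E = x \<partial>\<^sub>y\<close> and \<open>F = y \<partial>\<^sub>x\<close>.\<close>

definition ad_coeff :: "nat \<Rightarrow> nat \<Rightarrow> nat \<Rightarrow> nat \<Rightarrow> complex" where
  "ad_coeff l m a b = (\<Sum>s\<le>l. (- 1) ^ s * of_nat (if s \<le> m then l choose (m - s) else 0) *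
     of_nat ((a choose s) * (b choose (l - s))))"

lemma binomial_absorb_real:
  "(of_nat a :: complex) * of_nat (a - 1 choose s) = (of_nat a - of_nat s) * of_nat (a choose s)"
proof (cases "s \<le> a")
  case True
  have "(of_nat a - of_nat s) * of_nat (a choose s) = (of_nat ((a - s) * (a choose s)) :: complex)"
    using True by (simp add: of_nat_diff)
  also have "(a - s) * (a choose s) = a * (a - 1 choose s)"
    by (rule binomial_absorb_comp)
  finally show ?thesis by simp
qed (simp add: binomial_eq_0)

lemma binomial_step:
  "(of_nat a - of_nat s) * of_nat (a choose s) = (of_nat (Suc s) * of_nat (a choose Suc s) :: complex)"
proof -
  have "of_nat (Suc s) * of_nat (a choose Suc s) = (of_nat (Suc s * (a choose Suc s)) :: complex)"
    by (simp only: of_nat_mult)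
  also have "Suc s * (a choose Suc s) = a * (a - 1 choose s)"
    using binomial_absorption[of s a] by simp
  finally show ?thesis by (simp only: of_nat_mult binomial_absorb_real)
qed

text \<open>One more application of \<open>ad_F\<close> to X = ad_F^m(E^l), read off on x^a y^b: in
  F X the derivative meets the exponent a + l - m of the image, in X F it meets a, and X then acts
  on x^(a-1) y^(b+1). The factor m + 1 is due to the normalization by m!.\<close>

lemma ad_coeff_Suc:
  "of_nat (Suc m) * ad_coeff l (Suc m) a b =
    (of_nat a + of_nat l - of_nat m) * ad_coeff l m a b - of_nat a * ad_coeff l m (a - 1) (Suc b)"
proof -
  define e where "e = (\<lambda>m s. of_nat (if s \<le> m then l choose (m - s) else 0) :: complex)"
  define f where "f = (\<lambda>s. (of_nat s :: complex) * (- 1) ^ s * e (Suc m) s * of_nat (a choose s) * of_nat (b choose (l - s)))"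
  have ac: "ad_coeff l m a b = (\<Sum>s\<le>l. (- 1) ^ s * e m s * of_nat ((a choose s) * (b choose (l - s))))" for m a b
    by (simp add: ad_coeff_def e_def)
  have es: "e (Suc m) (Suc s) = e m s" for s by (simp add: e_def)
  \<comment> \<open>The difference of a + l - m and a - s is the factor on the left. Passing from m
    to m + 1 turns it into m + 1 - s, and the factor s inside \<open>f\<close> completes this to m +
    1 for every s.\<close>
  have ee: "(of_nat l - of_nat m + of_nat s) * e m s = (of_nat (Suc m) - of_nat s) * e (Suc m) s" for s
  proof -
    consider "s \<le> m" | "s = Suc m" | "s > Suc m" by linarith
    then show ?thesis
    proof cases
      case 1
      then show ?thesis
        using binomial_step[of l "m - s"] by (simp add: e_def of_nat_diff Suc_diff_le algebra_simps)
    qed (auto simp: e_def)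
  qed
  have d: "of_nat a * of_nat (a - 1 choose s) * of_nat (Suc b choose (l - s)) =
      (of_nat a - of_nat s) * of_nat (a choose s) * of_nat (b choose (l - s)) +
      (if s < l then of_nat (Suc s) * of_nat (a choose Suc s) * of_nat (b choose (l - Suc s)) else (0 :: complex))"
    if "s \<le> l" for s
  proof (cases "s < l")
    case True
    then obtain t where t: "l - s = Suc t" "l - Suc s = t"
      by (metis Suc_diff_Suc)
    show ?thesis using True
      by (simp only: t binomial_absorb_real binomial_Suc_Suc of_nat_add distrib_left if_True
          binomial_step[symmetric] add.commute)
  next
    case False
    then show ?thesis using that by (simp add: binomial_absorb_real[unfolded One_nat_def])
  qed
  \<comment> \<open>The second term of Pascal's rule for C(b + 1, l - s) is
    \<open>f (Suc s)\<close>; shifting the index back loses nothing because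
    \<open>f 0 = 0\<close>.\<close>
  have shift: "(\<Sum>s\<le>l. if s < l then f (Suc s) else 0) = (\<Sum>s\<le>l. f s)"
  proof -
    have "(\<Sum>s\<le>l. if s < l then f (Suc s) else 0) = (\<Sum>s<l. f (Suc s))"
      by (rule sum.mono_neutral_cong_right) auto
    also have "\<dots> = (\<Sum>s\<le>l. f s) - f 0"
      by (simp only: sum.atMost_shift) simp
    finally show ?thesis by (simp add: f_def)
  qed
  have "of_nat a * ad_coeff l m (a - 1) (Suc b) =
      (\<Sum>s\<le>l. (- 1) ^ s * e m s * (of_nat a * of_nat (a - 1 choose s) * of_nat (Suc b choose (l - s))))"
    by (simp add: ac sum_distrib_left mult_ac)
  also have "\<dots> = (\<Sum>s\<le>l. (- 1) ^ s * e m s * ((of_nat a - of_nat s) * of_nat (a choose s) * of_nat (b choose (l - s))) -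
      (if s < l then f (Suc s) else 0))"
    by (intro sum.cong refl, subst d) (auto simp: f_def es algebra_simps)
  also have "\<dots> = (\<Sum>s\<le>l. (- 1) ^ s * e m s * ((of_nat a - of_nat s) * of_nat (a choose s) * of_nat (b choose (l - s))))
      - (\<Sum>s\<le>l. f s)"
    by (simp only: sum_subtractf shift)
  finally have "of_nat a * ad_coeff l m (a - 1) (Suc b) = \<dots>" .
  then have "(of_nat a + of_nat l - of_nat m) * ad_coeff l m a b - of_nat a * ad_coeff l m (a - 1) (Suc b) =
      (\<Sum>s\<le>l. (- 1) ^ s * ((of_nat l - of_nat m + of_nat s) * e m s) * of_nat (a choose s) * of_nat (b choose (l - s)) + f s)"
    by (simp only: ac[of m a b] sum_distrib_left sum.distrib sum_subtractf)
      (simp add: sum_distrib_left sum.distrib sum_subtractf algebra_simps)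
  also have "\<dots> = (\<Sum>s\<le>l. of_nat (Suc m) * ((- 1) ^ s * e (Suc m) s * of_nat ((a choose s) * (b choose (l - s)))))"
    by (intro sum.cong refl, subst ee) (simp add: f_def algebra_simps)
  finally show ?thesis
    by (simp only: ac sum_distrib_left)
qed

text \<open>The image of x^a y^b is a multiple of x^(a+l-m) y^(b+m-l); these are the cases of a
  negative exponent. The vanishing takes care of the borders of the matrices below.\<close>

lemma ad_coeff_eq_0:
  assumes "b + m < l \<or> a + l < m"
  shows "ad_coeff l m a b = 0"
  unfolding ad_coeff_def
proof (intro sum.neutral ballI)
  fix s assume "s \<in> {..l}"
  then have "(if s \<le> m then l choose (m - s) else 0) * ((a choose s) * (b choose (l - s))) = 0"
    using assms by (auto simp: binomial_eq_0_iff)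
  then show "(- 1) ^ s * of_nat (if s \<le> m then l choose (m - s) else 0) *
     of_nat ((a choose s) * (b choose (l - s))) = (0 :: complex)"
    by (metis (no_types, lifting) mult.assoc mult_zero_right of_nat_0 of_nat_mult)
qed

text \<open>Trinomial revision: afterwards only one factor depends on s, and the sum over s has the
  shape of \<open>alternating_vandermonde\<close>.\<close>

lemma binomial_triple:
  assumes "s \<le> r" "r \<le> m"
  shows "(l choose (m - s)) * (m - s choose (r - s)) = (l choose (m - r)) * (l - (m - r) choose (r - s))"
proof (cases "m - s \<le> l")
  case True
  have "(m - s choose (r - s)) = (m - s choose (m - r))"
    using assms by (subst binomial_symmetric) auto
  then show ?thesis
    using True assms choose_mult[of "m - r" "m - s" l] by (simp add: Suc_diff_le)
next
  case False
  then show ?thesis using assms by (cases "m - r \<le> l") (auto simp: binomial_eq_0)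
qed

text \<open>For fixed s the sum over b is evaluated by trinomial revision and
  \<open>nanjundiah\<close>, at the price of a new index j. With r = l - j the factor containing n
  no longer involves s, so the sum over s can be done next and r alone survives.\<close>

lemma sum_ad_coeff:
  fixes n k l m p :: nat
  assumes mp: "m + p = k + l"
  shows "(\<Sum>b<n. of_nat ((b + k choose k) * (n - 1 - b choose p)) * ad_coeff l m (n - 1 - b - p) (b + p)) =
    (\<Sum>r\<le>min l m. (- 1) ^ r * of_nat ((p choose (l - r)) * (l choose (m - r)) * (k choose r) *
      (n + k + l - r choose (k + l + p + 1))))"
proof -
  define e where "e = (\<lambda>s. of_nat (if s \<le> m then l choose (m - s) else 0) :: complex)"
  have inner: "(\<Sum>b<n. (b + k choose k) * (n - 1 - b choose p) * ((n - 1 - b - p choose s) * (b + p choose (l - s)))) =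
      (\<Sum>j\<le>l - s. (p + s choose s) * (p choose j) * (m - s choose (l - s - j)) * (n + k + j choose (k + l + p + 1)))"
    if "s \<le> l" "s \<le> m" for s
  proof -
    have a: "(n - 1 - b choose p) * (n - 1 - b - p choose s) = (p + s choose s) * (n - 1 - b choose (p + s))" for b
    proof (cases "p + s \<le> n - 1 - b")
      case True
      then have "(n - 1 - b choose (p + s)) * (p + s choose p) = (n - 1 - b choose p) * (n - 1 - b - p choose s)"
        by (subst choose_mult) auto
      moreover have "(p + s choose p) = (p + s choose s)"
        by (subst binomial_symmetric) auto
      ultimately show ?thesis by (metis mult.commute)
    next
      case False
      then show ?thesis by (cases "n - 1 - b < p") (auto simp: binomial_eq_0)
    qed
    have nj: "(b + k choose k) * (b + p choose (l - s)) =
        (\<Sum>j\<le>l - s. (p choose j) * (m - s choose (l - s - j)) * (b + k + j choose (k + (l - s))))" for b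
    proof -
      have "l - s + k - p = m - s" using that mp by linarith
      then show ?thesis using nanjundiah[of p "l - s" k b] that mp by simp
    qed
    have "(\<Sum>b<n. (b + k choose k) * (n - 1 - b choose p) * ((n - 1 - b - p choose s) * (b + p choose (l - s)))) =
      (\<Sum>b<n. ((n - 1 - b choose p) * (n - 1 - b - p choose s)) * ((b + k choose k) * (b + p choose (l - s))))"
      by (simp add: mult_ac)
    also have "\<dots> = (\<Sum>b<n. \<Sum>j\<le>l - s. (p + s choose s) * (n - 1 - b choose (p + s)) *
        ((p choose j) * (m - s choose (l - s - j)) * (b + k + j choose (k + (l - s)))))"
      by (simp only: a nj sum_distrib_left)
    also have "\<dots> = (\<Sum>j\<le>l - s. \<Sum>b<n. (p + s choose s) * (n - 1 - b choose (p + s)) *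
        ((p choose j) * (m - s choose (l - s - j)) * (b + k + j choose (k + (l - s)))))"
      by (rule sum.swap)
    also have "\<dots> = (\<Sum>j\<le>l - s. (p + s choose s) * (p choose j) * (m - s choose (l - s - j)) *
        (\<Sum>b<n. (n - 1 - b choose (p + s)) * (b + (k + j) choose (k + (l - s)))))"
      by (simp add: sum_distrib_left mult_ac add_ac)
    also have "\<dots> = (\<Sum>j\<le>l - s. (p + s choose s) * (p choose j) * (m - s choose (l - s - j)) *
        (n + (k + j) choose (p + s + (k + (l - s)) + 1)))"
      by (intro sum.cong refl, subst sum_choose_mult_choose) auto
    finally show ?thesis using that by (simp add: add_ac)
  qed
  have "(\<Sum>b<n. of_nat ((b + k choose k) * (n - 1 - b choose p)) * ad_coeff l m (n - 1 - b - p) (b + p)) =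
      (\<Sum>s\<le>l. \<Sum>b<n. (- 1) ^ s * e s *
        of_nat ((b + k choose k) * (n - 1 - b choose p) * ((n - 1 - b - p choose s) * (b + p choose (l - s)))))"
    unfolding ad_coeff_def e_def sum_distrib_left by (subst sum.swap) (simp add: mult_ac)
  also have "\<dots> = (\<Sum>s\<le>l. (- 1) ^ s * e s *
        of_nat (\<Sum>b<n. (b + k choose k) * (n - 1 - b choose p) * ((n - 1 - b - p choose s) * (b + p choose (l - s)))))"
    by (simp add: sum_distrib_left)
  also have "\<dots> = (\<Sum>s\<le>l. (- 1) ^ s * e s *
        of_nat (\<Sum>j\<le>l - s. (p + s choose s) * (p choose j) * (m - s choose (l - s - j)) * (n + k + j choose (k + l + p + 1))))"
  proof (intro sum.cong refl)
    fix s assume "s \<in> {..l}"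
    then show "(- 1) ^ s * e s *
        of_nat (\<Sum>b<n. (b + k choose k) * (n - 1 - b choose p) * ((n - 1 - b - p choose s) * (b + p choose (l - s)))) =
      (- 1) ^ s * e s *
        of_nat (\<Sum>j\<le>l - s. (p + s choose s) * (p choose j) * (m - s choose (l - s - j)) * (n + k + j choose (k + l + p + 1)))"
      by (cases "s \<le> m") (simp only: inner atMost_iff, simp add: e_def)
  qed
  \<comment> \<open>Here r = l - j; the \<open>of_bool\<close> makes both ranges constant so that
    the two sums can be exchanged.\<close>
  also have "\<dots> = (\<Sum>s\<le>l. \<Sum>r\<le>l. of_bool (s \<le> r) * ((- 1) ^ s * e s *
        of_nat ((p + s choose s) * (p choose (l - r)) * (m - s choose (r - s)) * (n + k + l - r choose (k + l + p + 1)))))"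
  proof (intro sum.cong refl)
    fix s assume "s \<in> {..l}"
    then have s: "s \<le> l" by simp
    have "(\<Sum>j\<le>l - s. (p + s choose s) * (p choose j) * (m - s choose (l - s - j)) * (n + k + j choose (k + l + p + 1))) =
      (\<Sum>r\<in>{s..l}. (p + s choose s) * (p choose (l - r)) * (m - s choose (r - s)) * (n + k + l - r choose (k + l + p + 1)))"
      by (rule sum.reindex_bij_witness[where i = "\<lambda>r. l - r" and j = "\<lambda>j. l - j"])
        (use s in \<open>auto simp: add_ac\<close>)
    then show "(- 1) ^ s * e s *
        of_nat (\<Sum>j\<le>l - s. (p + s choose s) * (p choose j) * (m - s choose (l - s - j)) * (n + k + j choose (k + l + p + 1))) =
      (\<Sum>r\<le>l. of_bool (s \<le> r) * ((- 1) ^ s * e s *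
        of_nat ((p + s choose s) * (p choose (l - r)) * (m - s choose (r - s)) * (n + k + l - r choose (k + l + p + 1)))))"
      by (simp only: of_nat_sum sum_distrib_left) (rule sum.mono_neutral_cong_left, auto)
  qed
  also have "\<dots> = (\<Sum>r\<le>l. \<Sum>s\<le>l. of_bool (s \<le> r) * ((- 1) ^ s * e s *
        of_nat ((p + s choose s) * (p choose (l - r)) * (m - s choose (r - s)) * (n + k + l - r choose (k + l + p + 1)))))"
    by (rule sum.swap)
  also have "\<dots> = (\<Sum>r\<le>l. if r \<le> m then (- 1) ^ r * of_nat ((p choose (l - r)) * (l choose (m - r)) * (k choose r) *
      (n + k + l - r choose (k + l + p + 1))) else 0)"
  proof (intro sum.cong refl)
    fix r assume "r \<in> {..l}"
    then have r: "r \<le> l" by simp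
    let ?c = "of_nat ((p choose (l - r)) * (n + k + l - r choose (k + l + p + 1))) :: complex"
    show "(\<Sum>s\<le>l. of_bool (s \<le> r) * ((- 1) ^ s * e s *
        of_nat ((p + s choose s) * (p choose (l - r)) * (m - s choose (r - s)) * (n + k + l - r choose (k + l + p + 1))))) =
      (if r \<le> m then (- 1) ^ r * of_nat ((p choose (l - r)) * (l choose (m - r)) * (k choose r) *
      (n + k + l - r choose (k + l + p + 1))) else 0)"
    proof (cases "r \<le> m")
      case True
      have "(\<Sum>s\<le>l. of_bool (s \<le> r) * ((- 1) ^ s * e s *
        of_nat ((p + s choose s) * (p choose (l - r)) * (m - s choose (r - s)) * (n + k + l - r choose (k + l + p + 1))))) =
        (\<Sum>s\<le>r. ?c * ((- 1) ^ s * of_nat (p + s choose s) * of_nat ((l choose (m - s)) * (m - s choose (r - s)))))"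
        by (rule sum.mono_neutral_cong_right) (use r True in \<open>auto simp: e_def\<close>)
      also have "\<dots> = ?c * of_nat (l choose (m - r)) *
          (\<Sum>s\<le>r. (- 1) ^ s * of_nat (p + s choose s) * of_nat (l - (m - r) choose (r - s)))"
        unfolding sum_distrib_left by (intro sum.cong refl, subst binomial_triple) (use True in auto)
      also have "\<dots> = ?c * of_nat (l choose (m - r)) * ((- 1) ^ r * of_nat (k choose r))"
      proof (cases "m - r \<le> l")
        case le: True
        have "l - (m - r) + k = p + r" using le True mp by linarith
        then show ?thesis by (simp only: alternating_vandermonde)
      qed simp
      finally show ?thesis using True by (simp add: mult_ac)
    next
      case False
      then show ?thesis by (intro trans[OF sum.neutral]) (auto simp: e_def binomial_eq_0)
    qed
  qed
  also have "\<dots> = (\<Sum>r\<le>min l m. (- 1) ^ r * of_nat ((p choose (l - r)) * (l choose (m - r)) * (k choose r) *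
      (n + k + l - r choose (k + l + p + 1))))"
    by (rule sum.mono_neutral_cong_right) auto
  finally show ?thesis .
qed

text \<open>If l \<le> p + r and m \<le> l + r, both sides consist of the same factorials. If one of
  these fails, a binomial vanishes on each side, because l > p + r is equivalent to m > k +
  r.\<close>

lemma binomials_symmetric_form:
  assumes mp: "m + p = k + l" and m: "m \<le> 2 * k" "m \<le> 2 * l" and r: "r \<le> l" "r \<le> m" "r \<le> k"
  shows "((p choose (l - r)) * (l choose (m - r)) * (k choose r)) * (fact m * fact (2 * k - m) * fact (2 * l - m)) =
    (fact k * fact l * fact p * ((m choose r) * (2 * k - m choose (k - r)) * (2 * l - m choose (l - r))) :: nat)"
proof (cases "l \<le> p + r \<and> m \<le> l + r")
  case True
  have d: "p - (l - r) = k + r - m" "l - (m - r) = l + r - m"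
    "2 * k - m - (k - r) = k + r - m" "2 * l - m - (l - r) = l + r - m"
    using True assms by linarith+
  have le: "k - r \<le> 2 * k - m" "l - r \<le> 2 * l - m"
    using True assms by linarith+
  have b: "real (p choose (l - r)) = fact p / (fact (l - r) * fact (k + r - m))"
    "real (l choose (m - r)) = fact l / (fact (m - r) * fact (l + r - m))"
    "real (k choose r) = fact k / (fact r * fact (k - r))"
    "real (m choose r) = fact m / (fact r * fact (m - r))"
    "real (2 * k - m choose (k - r)) = fact (2 * k - m) / (fact (k - r) * fact (k + r - m))"
    "real (2 * l - m choose (l - r)) = fact (2 * l - m) / (fact (l - r) * fact (l + r - m))"
    using True assms d binomial_fact[OF le(1), where 'a = real] binomial_fact[OF le(2), where 'a = real]
    by (simp_all add: binomial_fact le_diff_conv)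
  have "real ((p choose (l - r)) * (l choose (m - r)) * (k choose r) * (fact m * fact (2 * k - m) * fact (2 * l - m))) =
    real (fact k * fact l * fact p * ((m choose r) * (2 * k - m choose (k - r)) * (2 * l - m choose (l - r))))"
    unfolding of_nat_mult of_nat_fact b by (simp add: mult_ac)
  then show ?thesis by (simp only: of_nat_eq_iff)
next
  case False
  then have "(p choose (l - r)) * (l choose (m - r)) * (k choose r) = 0"
    "(m choose r) * (2 * k - m choose (k - r)) * (2 * l - m choose (l - r)) = 0"
    using assms by (auto simp: binomial_eq_0_iff)
  then show ?thesis by (simp only: mult_zero_left mult_zero_right)
qed

lemma sum_ad_coeff_racah:
  fixes n k l m p :: nat
  assumes mp: "m + p = k + l" and m: "m \<le> 2 * k" "m \<le> 2 * l"
  shows "(\<Sum>b<n. of_nat ((b + k choose k) * (n - 1 - b choose p)) * ad_coeff l m (n - 1 - b - p) (b + p)) =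
    fact k * fact l * fact p / (fact m * fact (2 * k - m) * fact (2 * l - m)) * racah_sum n k l m"
proof -
  have K: "k + l + p + 1 = 2 * k + 2 * l - m + 1" using assms by linarith
  have eq: "complex_of_nat ((p choose (l - r)) * (l choose (m - r)) * (k choose r)) =
    fact k * fact l * fact p / (fact m * fact (2 * k - m) * fact (2 * l - m)) *
    of_nat ((m choose r) * (2 * k - m choose (k - r)) * (2 * l - m choose (l - r)))"
    if "r \<le> min m (min k l)" for r
  proof -
    have "complex_of_nat ((p choose (l - r)) * (l choose (m - r)) * (k choose r)) * (fact m * fact (2 * k - m) * fact (2 * l - m)) =
      fact k * fact l * fact p * of_nat ((m choose r) * (2 * k - m choose (k - r)) * (2 * l - m choose (l - r)))"
      using arg_cong[OF binomials_symmetric_form[OF assms, of r], of complex_of_nat] that by (simp add: of_nat_fact)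
    then show ?thesis by (simp add: field_simps)
  qed
  have "(\<Sum>r\<le>min l m. (- 1) ^ r * of_nat ((p choose (l - r)) * (l choose (m - r)) * (k choose r) *
      (n + k + l - r choose (k + l + p + 1)))) =
    (\<Sum>r\<le>min m (min k l). (- 1) ^ r * complex_of_nat ((p choose (l - r)) * (l choose (m - r)) * (k choose r)) *
      of_nat (n + k + l - r choose (2 * k + 2 * l - m + 1)))"
    unfolding K[symmetric] by (rule sum.mono_neutral_cong_right) (auto simp: binomial_eq_0)
  also have "\<dots> = fact k * fact l * fact p / (fact m * fact (2 * k - m) * fact (2 * l - m)) * racah_sum n k l m"
    unfolding racah_sum_def sum_distrib_left by (intro sum.cong refl, subst eq) (auto simp: mult_ac)
  finally show ?thesis unfolding sum_ad_coeff[OF mp] .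
qed

section \<open>Lie algebra of square matrices\<close>

lemma lie_bracket_carrier [simp, intro]:
  assumes "A \<in> carrier_mat n n" "B \<in> carrier_mat n n"
  shows "lie_bracket A B \<in> carrier_mat n n"
  unfolding lie_bracket_def by (intro minus_carrier_mat mult_carrier_mat[OF assms(2) assms(1)])

lemma dim_lie_bracket [simp]:
  "dim_row (lie_bracket A B) = dim_row B" "dim_col (lie_bracket A B) = dim_col A"
  by (simp_all add: lie_bracket_def)

lemma lie_bracket_iter_carrier [simp, intro]:
  assumes "A \<in> carrier_mat n n" "B \<in> carrier_mat n n"
  shows "(lie_bracket A ^^ r) B \<in> carrier_mat n n"
  by (induction r) (use assms in auto)

section \<open>Finite sums of square matrices\<close>

lemma mat_sum_carrier [simp, intro]:
  assumes "\<And>i. i \<in> S \<Longrightarrow> f i \<in> carrier_mat n n"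
  shows "mat_sum n f S \<in> carrier_mat n n"
proof -
  interpret abelian_group "module_mat TYPE(complex) n n" by (rule abelian_group_mat)
  show ?thesis using finsum_closed[of f S] assms by (auto simp: module_mat_simps)
qed

lemma mat_sum_insert:
  assumes "finite S" "x \<notin> S" "\<And>i. i \<in> insert x S \<Longrightarrow> f i \<in> carrier_mat n n"
  shows "mat_sum n f (insert x S) = f x + mat_sum n f S"
proof -
  interpret abelian_group "module_mat TYPE(complex) n n" by (rule abelian_group_mat)
  show ?thesis using finsum_insert[of S x f] assms by (auto simp: module_mat_simps)
qed

lemma mat_sum_empty [simp]: "mat_sum n f {} = 0\<^sub>m n n"
proof -
  interpret abelian_group "module_mat TYPE(complex) n n" by (rule abelian_group_mat)
  show ?thesis by (simp add: module_mat_simps)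
qed

lemma mat_sum_cong:
  assumes "S = T" "\<And>i. i \<in> T \<Longrightarrow> f i = g i" "\<And>i. i \<in> T \<Longrightarrow> g i \<in> carrier_mat n n"
  shows "mat_sum n f S = mat_sum n g T"
proof -
  interpret abelian_group "module_mat TYPE(complex) n n" by (rule abelian_group_mat)
  show ?thesis using assms by (intro finsum_cong') (auto simp: module_mat_simps)
qed

lemma index_mat_sum:
  assumes "finite S" "\<And>s. s \<in> S \<Longrightarrow> f s \<in> carrier_mat n n" "i < n" "j < n"
  shows "mat_sum n f S $$ (i, j) = (\<Sum>s\<in>S. f s $$ (i, j))"
  using assms
proof (induction S rule: finite_induct)
  case (insert x S)
  then have "mat_sum n f S \<in> carrier_mat n n" by auto
  then have d: "dim_row (mat_sum n f S) = n" "dim_col (mat_sum n f S) = n" by auto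
  have "mat_sum n f (insert x S) = f x + mat_sum n f S"
    by (rule mat_sum_insert[OF insert(1,2)]) (use insert in auto)
  with insert d show ?case by simp
qed simp

lemma index_mult_mat_sum:
  assumes "A \<in> carrier_mat n n" "B \<in> carrier_mat n n" "i < n" "j < n"
  shows "(A * B) $$ (i, j) = (\<Sum>k<n. A $$ (i, k) * B $$ (k, j))"
  using assms by (auto simp: scalar_prod_def atLeast0LessThan intro!: sum.cong)

section \<open>Bilinearity, Leibniz rule and Jacobi identity\<close>

lemma lie_bracket_smult_left:
  assumes "A \<in> carrier_mat n n" "B \<in> carrier_mat n n"
  shows "lie_bracket (c \<cdot>\<^sub>m A) B = c \<cdot>\<^sub>m lie_bracket A B"
  using assms unfolding lie_bracket_def
  by (intro eq_matI) (auto simp: algebra_simps)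

lemma lie_bracket_smult_right:
  assumes "A \<in> carrier_mat n n" "B \<in> carrier_mat n n"
  shows "lie_bracket A (c \<cdot>\<^sub>m B) = c \<cdot>\<^sub>m lie_bracket A B"
  using assms unfolding lie_bracket_def
  by (intro eq_matI) (auto simp: algebra_simps)

lemma lie_bracket_add_right:
  assumes "A \<in> carrier_mat n n" "B \<in> carrier_mat n n" "C \<in> carrier_mat n n"
  shows "lie_bracket A (B + C) = lie_bracket A B + lie_bracket A C"
  using assms unfolding lie_bracket_def
  by (intro eq_matI) (auto simp: mult_add_distrib_mat[of _ n n _ n] add_mult_distrib_mat[of _ n n _ _ n])

lemma lie_bracket_minus_right:
  assumes "A \<in> carrier_mat n n" "B \<in> carrier_mat n n" "C \<in> carrier_mat n n"
  shows "lie_bracket A (B - C) = lie_bracket A B - lie_bracket A C"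
  using assms unfolding lie_bracket_def
  by (intro eq_matI) (auto simp: mult_minus_distrib_mat[of _ n n _ n] minus_mult_distrib_mat[of _ n n _ _ n])

lemma lie_bracket_zero_right [simp]:
  assumes "A \<in> carrier_mat n n"
  shows "lie_bracket A (0\<^sub>m n n) = 0\<^sub>m n n"
  using assms unfolding lie_bracket_def by (intro eq_matI) auto

lemma lie_bracket_zero_left [simp]:
  assumes "A \<in> carrier_mat n n"
  shows "lie_bracket (0\<^sub>m n n) A = 0\<^sub>m n n"
  using assms unfolding lie_bracket_def by (intro eq_matI) auto

lemma lie_bracket_mat_sum_right:
  assumes "A \<in> carrier_mat n n" "finite S" "\<And>s. s \<in> S \<Longrightarrow> f s \<in> carrier_mat n n"
  shows "lie_bracket A (mat_sum n f S) = mat_sum n (\<lambda>s. lie_bracket A (f s)) S"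
  using assms(2,3)
proof (induction S rule: finite_induct)
  case (insert x S)
  then have c: "mat_sum n f S \<in> carrier_mat n n" "f x \<in> carrier_mat n n" by auto
  have "mat_sum n f (insert x S) = f x + mat_sum n f S"
    by (rule mat_sum_insert[OF insert(1,2)]) (use insert in auto)
  moreover have "mat_sum n (\<lambda>s. lie_bracket A (f s)) (insert x S) =
      lie_bracket A (f x) + mat_sum n (\<lambda>s. lie_bracket A (f s)) S"
    by (rule mat_sum_insert[OF insert(1,2)]) (use insert assms(1) in auto)
  ultimately show ?case
    using insert c assms(1) by (simp add: lie_bracket_add_right[of _ n])
qed (use assms in simp)

lemma lie_bracket_mult:
  assumes "A \<in> carrier_mat n n" "B \<in> carrier_mat n n" "C \<in> carrier_mat n n"
  shows "lie_bracket A (B * C) = lie_bracket A B * C + B * lie_bracket A C"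
proof -
  have 1: "lie_bracket A (B * C) = A * (B * C) - B * (C * A)"
    using assms unfolding lie_bracket_def by (simp add: assoc_mult_mat[of _ n n _ n _ n])
  have 2: "lie_bracket A B * C = A * (B * C) - B * (A * C)"
    using assms unfolding lie_bracket_def
    by (simp add: assoc_mult_mat[of _ n n _ n _ n] minus_mult_distrib_mat[of _ n n _ _ n])
  have 3: "B * lie_bracket A C = B * (A * C) - B * (C * A)"
    using assms unfolding lie_bracket_def
    by (simp add: mult_minus_distrib_mat[of _ n n _ n])
  show ?thesis unfolding 1 2 3 using assms by (intro eq_matI) auto
qed

lemma lie_bracket_jacobi:
  assumes "A \<in> carrier_mat n n" "B \<in> carrier_mat n n" "C \<in> carrier_mat n n"
  shows "lie_bracket A (lie_bracket B C) = lie_bracket (lie_bracket A B) C + lie_bracket B (lie_bracket A C)"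
proof -
  have BC: "B * C \<in> carrier_mat n n" "C * B \<in> carrier_mat n n" using assms by auto
  have L: "lie_bracket A B \<in> carrier_mat n n" "lie_bracket A C \<in> carrier_mat n n" using assms by auto
  have "lie_bracket A (lie_bracket B C) = lie_bracket A (B * C) - lie_bracket A (C * B)"
    unfolding lie_bracket_def[of B C] by (rule lie_bracket_minus_right[OF assms(1) BC])
  also have "\<dots> = (lie_bracket A B * C + B * lie_bracket A C) - (lie_bracket A C * B + C * lie_bracket A B)"
    using assms by (simp only: lie_bracket_mult[of _ n])
  also have "\<dots> = (lie_bracket A B * C - C * lie_bracket A B) + (B * lie_bracket A C - lie_bracket A C * B)"
    using assms L by (intro eq_matI) auto
  finally show ?thesis unfolding lie_bracket_def[of "lie_bracket A B"] lie_bracket_def[of B "lie_bracket A C"] .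
qed

section \<open>The trace form and its invariance\<close>

lemma mat_trace_sum: "A \<in> carrier_mat n n \<Longrightarrow> mat_trace A = (\<Sum>a<n. A $$ (a, a))"
  by (simp add: mat_trace_def)

lemma mat_trace_add:
  assumes "A \<in> carrier_mat n n" "B \<in> carrier_mat n n"
  shows "mat_trace (A + B) = mat_trace A + mat_trace B"
  using assms by (simp add: mat_trace_def sum.distrib)

lemma mat_trace_minus:
  assumes "A \<in> carrier_mat n n" "B \<in> carrier_mat n n"
  shows "mat_trace (A - B) = mat_trace A - mat_trace B"
  using assms by (simp add: mat_trace_def sum_subtractf)

lemma mat_trace_smult: "A \<in> carrier_mat n n \<Longrightarrow> mat_trace (c \<cdot>\<^sub>m A) = c * mat_trace A"
  by (simp add: mat_trace_def sum_distrib_left)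

lemma mat_trace_zero [simp]: "mat_trace (0\<^sub>m n n) = 0"
  by (simp add: mat_trace_def)

lemma mat_trace_mult_commute:
  assumes "A \<in> carrier_mat n n" "B \<in> carrier_mat n n"
  shows "mat_trace (A * B) = mat_trace (B * A)"
proof -
  have "mat_trace (A * B) = (\<Sum>a<n. \<Sum>k<n. A $$ (a, k) * B $$ (k, a))"
    using assms by (simp add: mat_trace_sum[of _ n] index_mult_mat_sum[of _ n] del: index_mult_mat)
  also have "\<dots> = (\<Sum>k<n. \<Sum>a<n. B $$ (k, a) * A $$ (a, k))"
    by (subst sum.swap) (simp add: mult.commute)
  also have "\<dots> = mat_trace (B * A)"
    using assms by (simp add: mat_trace_sum[of _ n] index_mult_mat_sum[of _ n] del: index_mult_mat)
  finally show ?thesis .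
qed

text \<open>The bracket with A is a derivation of the matrix product, and the trace of a commutator
  is 0.\<close>

lemma mat_trace_lie_bracket_mult:
  assumes "A \<in> carrier_mat n n" "B \<in> carrier_mat n n" "C \<in> carrier_mat n n"
  shows "mat_trace (lie_bracket A B * C) = - mat_trace (B * lie_bracket A C)"
proof -
  have c: "B * C \<in> carrier_mat n n" "lie_bracket A B * C \<in> carrier_mat n n" "B * lie_bracket A C \<in> carrier_mat n n"
    using assms by auto
  have "mat_trace (lie_bracket A B * C) + mat_trace (B * lie_bracket A C) = mat_trace (lie_bracket A (B * C))"
    using assms by (simp add: lie_bracket_mult[of _ n] mat_trace_add[OF c(2,3)])
  also have "\<dots> = 0"
    unfolding lie_bracket_def using assms(1) c(1) mat_trace_mult_commute[of A n "B * C"]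
    by (subst mat_trace_minus[of _ n]) auto
  finally show ?thesis by (simp add: eq_neg_iff_add_eq_0)
qed

lemma mat_trace_mat_sum_mult:
  assumes "finite S" "\<And>s. s \<in> S \<Longrightarrow> f s \<in> carrier_mat n n" "B \<in> carrier_mat n n"
  shows "mat_trace (mat_sum n f S * B) = (\<Sum>s\<in>S. mat_trace (f s * B))"
  using assms(1,2)
proof (induction S rule: finite_induct)
  case empty
  then show ?case using assms(3) by simp
next
  case (insert x S)
  then have c: "mat_sum n f S \<in> carrier_mat n n" "f x \<in> carrier_mat n n" by auto
  then have d: "f x * B \<in> carrier_mat n n" "mat_sum n f S * B \<in> carrier_mat n n" using assms(3) by auto
  have "mat_sum n f (insert x S) = f x + mat_sum n f S"
    by (rule mat_sum_insert[OF insert(1,2)]) (use insert in auto)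
  then show ?case using insert c assms(3)
    by (simp add: add_mult_distrib_mat[of _ n n _ _ n] mat_trace_add[OF d])
qed

text \<open>Invariance under \<open>H\<close> gives (a + b) tr(A B) = 0.\<close>

lemma mat_trace_weight_zero:
  assumes "H \<in> carrier_mat n n" "A \<in> carrier_mat n n" "B \<in> carrier_mat n n"
    and "lie_bracket H A = a \<cdot>\<^sub>m A" "lie_bracket H B = b \<cdot>\<^sub>m B" "a + b \<noteq> 0"
  shows "mat_trace (A * B) = 0"
proof -
  have c: "A * B \<in> carrier_mat n n" using assms by auto
  have "mat_trace (lie_bracket H A * B) = - mat_trace (A * lie_bracket H B)"
    using assms by (intro mat_trace_lie_bracket_mult)
  then have "a * mat_trace (A * B) = - (b * mat_trace (A * B))"
    using assms(2,3) c unfolding assms(4,5)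
    by (simp add: mult_smult_assoc_mat[of _ n n _ n] mult_smult_distrib[of _ n n _ n] mat_trace_smult[of _ n])
  then have "(a + b) * mat_trace (A * B) = 0" by (simp add: algebra_simps)
  then show ?thesis using assms(6) by simp
qed

section \<open>Brackets with powers\<close>

lemma lie_bracket_pow_commute:
  assumes "A \<in> carrier_mat n n"
  shows "lie_bracket A (A ^\<^sub>m k) = 0\<^sub>m n n"
proof (induction k)
  case 0
  then show ?case using assms unfolding lie_bracket_def by (intro eq_matI) auto
next
  case (Suc k)
  have "lie_bracket A A = 0\<^sub>m n n" using assms unfolding lie_bracket_def by (intro eq_matI) auto
  then show ?case using assms Suc pow_carrier_mat[OF assms, of k]
    by (simp add: lie_bracket_mult[of _ n])
qed

lemma lie_bracket_pow_weight:
  assumes "H \<in> carrier_mat n n" "A \<in> carrier_mat n n" "lie_bracket H A = c \<cdot>\<^sub>m A"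
  shows "lie_bracket H (A ^\<^sub>m k) = (of_nat k * c) \<cdot>\<^sub>m (A ^\<^sub>m k)"
proof (induction k)
  case 0
  then show ?case using assms unfolding lie_bracket_def by (intro eq_matI) auto
next
  case (Suc k)
  have p: "A ^\<^sub>m k \<in> carrier_mat n n" using assms by simp
  then have q: "A ^\<^sub>m k * A \<in> carrier_mat n n" using assms by auto
  have "lie_bracket H (A ^\<^sub>m Suc k) = (of_nat k * c) \<cdot>\<^sub>m (A ^\<^sub>m k * A) + c \<cdot>\<^sub>m (A ^\<^sub>m k * A)"
    using assms p Suc by (simp add: lie_bracket_mult[of _ n] mult_smult_assoc_mat[of _ n n _ n] mult_smult_distrib[of _ n n _ n])
  also have "\<dots> = (of_nat (Suc k) * c) \<cdot>\<^sub>m (A ^\<^sub>m Suc k)"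
    using q by (intro eq_matI) (auto simp del: index_mult_mat(1) simp: algebra_simps)
  finally show ?case .
qed

section \<open>The standard principal triple\<close>

text \<open>The basis vector with index \<open>b\<close> stands for \<open>x\<^sup>n\<^sup>-\<^sup>1\<^sup>-\<^sup>b y\<^sup>b\<close>, on which
  \<open>E\<close> and \<open>F\<close> act as \<open>x \<partial>\<^sub>y\<close> and \<open>y \<partial>\<^sub>x\<close>.\<close>

definition std_raise :: "nat \<Rightarrow> complex mat" where
  "std_raise n = mat n n (\<lambda>(i, j). if Suc i = j then of_nat j else 0)"

definition std_lower :: "nat \<Rightarrow> complex mat" where
  "std_lower n = mat n n (\<lambda>(i, j). if i = Suc j then of_nat (n - 1 - j) else 0)"

lemma std_carrier [simp]: "std_raise n \<in> carrier_mat n n" "std_lower n \<in> carrier_mat n n"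
  by (simp_all add: std_raise_def std_lower_def)

lemma std_dim [simp]: "dim_row (std_raise n) = n" "dim_col (std_raise n) = n"
    "dim_row (std_lower n) = n" "dim_col (std_lower n) = n"
  by (simp_all add: std_raise_def std_lower_def)

text \<open>The matrices below and their powers have at most one nonzero entry in each row and
  column, so each entry of a product with them is a sum of this kind.\<close>

lemma sum_lessThan_single:
  fixes a n :: nat
  assumes "\<And>k. k < n \<Longrightarrow> k \<noteq> a \<Longrightarrow> f k = (0 :: complex)"
  shows "(\<Sum>k<n. f k) = (if a < n then f a else 0)"
proof (cases "a < n")
  case True
  then have "(\<Sum>k<n. f k) = sum f {a}"
    using assms by (intro sum.mono_neutral_right) auto
  then show ?thesis using True by simp
next
  case False
  then show ?thesis using assms by (intro trans[OF sum.neutral]) auto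
qed

lemma index_mult_std_raise:
  assumes "A \<in> carrier_mat n n" "i < n" "j < n"
  shows "(A * std_raise n) $$ (i, j) = (if 0 < j then of_nat j * A $$ (i, j - 1) else 0)"
proof -
  have "(A * std_raise n) $$ (i, j) = (\<Sum>k<n. A $$ (i, k) * std_raise n $$ (k, j))"
    using assms by (intro index_mult_mat_sum) auto
  also have "\<dots> = (if j - 1 < n then A $$ (i, j - 1) * std_raise n $$ (j - 1, j) else 0)"
    using assms by (intro sum_lessThan_single) (auto simp: std_raise_def)
  finally show ?thesis using assms by (auto simp: std_raise_def)
qed

lemma index_std_raise_mult:
  assumes "A \<in> carrier_mat n n" "i < n" "j < n"
  shows "(std_raise n * A) $$ (i, j) = (if Suc i < n then of_nat (Suc i) * A $$ (Suc i, j) else 0)"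
proof -
  have "(std_raise n * A) $$ (i, j) = (\<Sum>k<n. std_raise n $$ (i, k) * A $$ (k, j))"
    using assms by (intro index_mult_mat_sum) auto
  also have "\<dots> = (if Suc i < n then std_raise n $$ (i, Suc i) * A $$ (Suc i, j) else 0)"
    using assms by (intro sum_lessThan_single) (auto simp: std_raise_def)
  finally show ?thesis using assms by (auto simp: std_raise_def)
qed

lemma index_mult_std_lower:
  assumes "A \<in> carrier_mat n n" "i < n" "j < n"
  shows "(A * std_lower n) $$ (i, j) = (if Suc j < n then of_nat (n - 1 - j) * A $$ (i, Suc j) else 0)"
proof -
  have "(A * std_lower n) $$ (i, j) = (\<Sum>k<n. A $$ (i, k) * std_lower n $$ (k, j))"
    using assms by (intro index_mult_mat_sum) auto
  also have "\<dots> = (if Suc j < n then A $$ (i, Suc j) * std_lower n $$ (Suc j, j) else 0)"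
    using assms by (intro sum_lessThan_single) (auto simp: std_lower_def)
  finally show ?thesis using assms by (auto simp: std_lower_def)
qed

lemma index_std_lower_mult:
  assumes "A \<in> carrier_mat n n" "i < n" "j < n"
  shows "(std_lower n * A) $$ (i, j) = (if 0 < i then of_nat (n - i) * A $$ (i - 1, j) else 0)"
proof -
  have "(std_lower n * A) $$ (i, j) = (\<Sum>k<n. std_lower n $$ (i, k) * A $$ (k, j))"
    using assms by (intro index_mult_mat_sum) auto
  also have "\<dots> = (if i - 1 < n then std_lower n $$ (i, i - 1) * A $$ (i - 1, j) else 0)"
    using assms by (intro sum_lessThan_single) (auto simp: std_lower_def)
  finally show ?thesis using assms by (auto simp: std_lower_def)
qed

lemma index_std_raise_pow:
  assumes "i < n" "j < n"
  shows "(std_raise n ^\<^sub>m k) $$ (i, j) = (if i + k = j then fact k * of_nat (j choose k) else 0)"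
  using assms
proof (induction k arbitrary: j)
  case (Suc k)
  show ?case
  proof (cases j)
    case 0
    then show ?thesis using Suc.prems
      by (simp add: index_mult_std_raise del: index_mult_mat)
  next
    case (Suc t)
    have "(of_nat (Suc t) :: complex) * of_nat (t choose k) = of_nat (Suc k) * of_nat (Suc t choose Suc k)"
      by (simp only: of_nat_mult[symmetric] Suc_times_binomial_eq[of t k, unfolded mult.commute[of _ "Suc k"]] mult.commute)
    then show ?thesis using Suc Suc.IH[of t] Suc.prems
      by (simp add: index_mult_std_raise algebra_simps del: index_mult_mat of_nat_Suc binomial_Suc_Suc)
  qed
qed simp

lemma index_std_lower_pow:
  assumes "i < n" "j < n"
  shows "(std_lower n ^\<^sub>m k) $$ (i, j) = (if i = j + k then fact k * of_nat (n - 1 - j choose k) else 0)"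
  using assms
proof (induction k arbitrary: j)
  case (Suc k)
  show ?case
  proof (cases "Suc j < n")
    case False
    then show ?thesis using Suc.prems
      by (simp add: index_mult_std_lower del: index_mult_mat)
  next
    case True
    then obtain t where t: "n - 1 - j = Suc t" "n - 1 - Suc j = t"
      by (metis Suc_diff_Suc diff_Suc_1 diff_commute less_diff_conv plus_1_eq_Suc zero_less_diff add.commute diff_diff_left Suc_lessD)
    have "(of_nat (Suc t) :: complex) * of_nat (t choose k) = of_nat (Suc k) * of_nat (Suc t choose Suc k)"
      by (simp only: of_nat_mult[symmetric] Suc_times_binomial_eq[of t k, unfolded mult.commute[of _ "Suc k"]] mult.commute)
    then show ?thesis using Suc.IH[of "Suc j"] Suc.prems True
      by (simp only: pow_mat.simps index_mult_std_lower pow_carrier_mat std_carrier t fact_Suc if_True)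
         (simp add: algebra_simps del: of_nat_Suc binomial_Suc_Suc)
  qed
qed simp

text \<open>Induction on m with \<open>ad_coeff_Suc\<close> as the step; column j stands for
  x^(n-1-j) y^j, whence the arguments n - 1 - j and j.\<close>

lemma index_std_ad:
  assumes "i < n" "j < n"
  shows "((lie_bracket (std_lower n) ^^ m) (std_raise n ^\<^sub>m l)) $$ (i, j) =
    (if i + l = j + m then fact l * fact m * ad_coeff l m (n - 1 - j) j else 0)"
  using assms
proof (induction m arbitrary: i j)
  case 0
  have "ad_coeff l 0 a b = of_nat (b choose l)" for a b
    unfolding ad_coeff_def by (subst sum.mono_neutral_right[of _ "{0}"]) auto
  then show ?case using 0 by (simp add: index_std_raise_pow)
next
  case (Suc m)
  define X where "X = (lie_bracket (std_lower n) ^^ m) (std_raise n ^\<^sub>m l)"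
  have X: "X \<in> carrier_mat n n" by (simp add: X_def)
  note IH = Suc.IH[folded X_def]
  have "lie_bracket (std_lower n) X $$ (i, j) = (std_lower n * X) $$ (i, j) - (X * std_lower n) $$ (i, j)"
    unfolding lie_bracket_def using X Suc.prems by simp
  also have "\<dots> = (if 0 < i then of_nat (n - i) * X $$ (i - 1, j) else 0) -
      (if Suc j < n then of_nat (n - 1 - j) * X $$ (i, Suc j) else 0)"
    using X Suc.prems by (simp only: index_mult_std_lower index_std_lower_mult)
  also have "\<dots> = (if i + l = j + Suc m then fact l * fact m *
      ((of_nat (n - 1 - j) + of_nat l - of_nat m) * ad_coeff l m (n - 1 - j) j
        - of_nat (n - 1 - j) * ad_coeff l m (n - 1 - j - 1) (Suc j)) else 0)"
  proof (cases "i + l = j + Suc m")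
    case True
    \<comment> \<open>Entry (i, j) of F X comes from row i - 1 of X, that is from a monomial with
      x-exponent n - i.\<close>
    have e1: "of_nat (n - i) = (of_nat (n - 1 - j) + of_nat l - of_nat m :: complex)"
    proof -
      have "of_nat (n - i + m) = (of_nat (n - 1 - j + l) :: complex)"
        using True Suc.prems by (intro arg_cong[of _ _ of_nat]) linarith
      then show ?thesis by (simp add: algebra_simps)
    qed
    \<comment> \<open>Row 0 of F X is 0; the formula agrees there because j + m < l makes
      \<open>ad_coeff\<close> vanish.\<close>
    have e2: "(if 0 < i then of_nat (n - i) * X $$ (i - 1, j) else 0) =
        of_nat (n - i) * (fact l * fact m * ad_coeff l m (n - 1 - j) j)"
    proof (cases "0 < i")
      case True
      then show ?thesis using IH[of "i - 1" j] Suc.prems \<open>i + l = j + Suc m\<close> by auto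
    next
      case False
      then show ?thesis using True by (simp add: ad_coeff_eq_0)
    qed
    have e3: "(if Suc j < n then of_nat (n - 1 - j) * X $$ (i, Suc j) else 0) =
        of_nat (n - 1 - j) * (fact l * fact m * ad_coeff l m (n - 1 - j - 1) (Suc j))"
      using IH[of i "Suc j"] Suc.prems True by (cases "Suc j < n") auto
    show ?thesis unfolding e2 e3 unfolding e1 using True by (simp add: algebra_simps)
  next
    case False
    then show ?thesis using IH Suc.prems by auto
  qed
  also have "\<dots> = (if i + l = j + Suc m then fact l * fact m * (of_nat (Suc m) * ad_coeff l (Suc m) (n - 1 - j) j) else 0)"
    by (simp only: ad_coeff_Suc)
  finally show ?case by (simp add: X_def[symmetric] mult_ac)
qed

text \<open>Read from the right, the word moves the basis index from b to b + p, then to b + k, and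
  back to b; the middle move is possible because m + p = k + l.\<close>

lemma trace_std_word:
  fixes n k l m p :: nat
  assumes mp: "m + p = k + l" and m: "m \<le> 2 * k" "m \<le> 2 * l"
  shows "mat_trace (std_raise n ^\<^sub>m k * ((lie_bracket (std_lower n) ^^ m) (std_raise n ^\<^sub>m l) * std_lower n ^\<^sub>m p)) =
    fact m * (fact k * fact l * fact p)\<^sup>2 / (fact m * fact (2 * k - m) * fact (2 * l - m)) * racah_sum n k l m"
proof -
  define X where "X = (lie_bracket (std_lower n) ^^ m) (std_raise n ^\<^sub>m l)"
  have X: "X \<in> carrier_mat n n" by (simp add: X_def)
  have XF: "(X * std_lower n ^\<^sub>m p) $$ (i, b) = (if b + p < n then X $$ (i, b + p) * (fact p * of_nat (n - 1 - b choose p)) else 0)"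
    if "i < n" "b < n" for i b
  proof -
    have "(X * std_lower n ^\<^sub>m p) $$ (i, b) = (\<Sum>j<n. X $$ (i, j) * (std_lower n ^\<^sub>m p) $$ (j, b))"
      using X that by (intro index_mult_mat_sum) auto
    also have "\<dots> = (if b + p < n then X $$ (i, b + p) * (std_lower n ^\<^sub>m p) $$ (b + p, b) else 0)"
      using that by (intro sum_lessThan_single) (auto simp: index_std_lower_pow)
    finally show ?thesis using that by (simp add: index_std_lower_pow)
  qed
  have diag: "(std_raise n ^\<^sub>m k * (X * std_lower n ^\<^sub>m p)) $$ (b, b) =
      fact m * fact k * fact l * fact p * (of_nat ((b + k choose k) * (n - 1 - b choose p)) * ad_coeff l m (n - 1 - b - p) (b + p))"
    if b: "b < n" for b
  proof -
    have "(std_raise n ^\<^sub>m k * (X * std_lower n ^\<^sub>m p)) $$ (b, b) =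
        (\<Sum>i<n. (std_raise n ^\<^sub>m k) $$ (b, i) * (X * std_lower n ^\<^sub>m p) $$ (i, b))"
      using X b by (intro index_mult_mat_sum) auto
    also have "\<dots> = (if b + k < n then (std_raise n ^\<^sub>m k) $$ (b, b + k) * (X * std_lower n ^\<^sub>m p) $$ (b + k, b) else 0)"
      using b by (intro sum_lessThan_single) (auto simp: index_std_raise_pow)
    also have "\<dots> = (if b + k < n \<and> b + p < n then
        fact m * fact k * fact l * fact p * (of_nat ((b + k choose k) * (n - 1 - b choose p)) * ad_coeff l m (n - 1 - b - p) (b + p)) else 0)"
    proof -
      have "X $$ (b + k, b + p) = fact l * fact m * ad_coeff l m (n - 1 - b - p) (b + p)"
        if "b + k < n" "b + p < n"
        using index_std_ad[OF that, of m l, folded X_def] mp by (simp add: add_ac)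
      then show ?thesis using b by (auto simp: XF index_std_raise_pow)
    qed
    also have "\<dots> = fact m * fact k * fact l * fact p * (of_nat ((b + k choose k) * (n - 1 - b choose p)) * ad_coeff l m (n - 1 - b - p) (b + p))"
    proof -
      have "(n - 1 - b choose p) = 0" if "\<not> b + p < n" using that b by (simp add: binomial_eq_0)
      moreover have "ad_coeff l m (n - 1 - b - p) (b + p) = 0" if "\<not> b + k < n" "b + p < n"
        using that mp by (intro ad_coeff_eq_0) linarith
      ultimately show ?thesis by auto
    qed
    finally show ?thesis .
  qed
  have "mat_trace (std_raise n ^\<^sub>m k * (X * std_lower n ^\<^sub>m p)) =
      (\<Sum>b<n. (std_raise n ^\<^sub>m k * (X * std_lower n ^\<^sub>m p)) $$ (b, b))"
    using X by (intro mat_trace_sum mult_carrier_mat[of _ n n _ n]) auto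
  also have "\<dots> = fact m * fact k * fact l * fact p *
      (\<Sum>b<n. of_nat ((b + k choose k) * (n - 1 - b choose p)) * ad_coeff l m (n - 1 - b - p) (b + p))"
    unfolding sum_distrib_left by (intro sum.cong refl) (simp only: diag lessThan_iff)
  also have "\<dots> = fact m * (fact k * fact l * fact p)\<^sup>2 / (fact m * fact (2 * k - m) * fact (2 * l - m)) * racah_sum n k l m"
    unfolding sum_ad_coeff_racah[OF assms] by (simp add: power2_eq_square)
  finally show ?thesis unfolding X_def .
qed

text \<open>The trace sees only the q-th superdiagonal of A, which is proportional to that of
  \<open>std_raise n ^\<^sub>m q\<close>; the remaining sum is
  \<open>sum_choose_mult_choose\<close>. It serves both the pairing of E^q with F^q and the
  centralizer of E.\<close>

lemma trace_mult_std_lower_pow: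
  assumes A: "A \<in> carrier_mat n n" and c: "\<And>j. j + q < n \<Longrightarrow> A $$ (j, j + q) = c * of_nat (j + q choose q)"
  shows "mat_trace (A * std_lower n ^\<^sub>m q) = c * fact q * of_nat (n + q choose (2 * q + 1))"
proof -
  have diag: "(A * std_lower n ^\<^sub>m q) $$ (b, b) = c * fact q * of_nat ((n - 1 - b choose q) * (b + q choose q))"
    if b: "b < n" for b
  proof -
    have "(A * std_lower n ^\<^sub>m q) $$ (b, b) = (\<Sum>j<n. A $$ (b, j) * (std_lower n ^\<^sub>m q) $$ (j, b))"
      using A b by (intro index_mult_mat_sum) auto
    also have "\<dots> = (if b + q < n then A $$ (b, b + q) * (std_lower n ^\<^sub>m q) $$ (b + q, b) else 0)"
      using b by (intro sum_lessThan_single) (auto simp: index_std_lower_pow)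
    also have "\<dots> = c * fact q * of_nat ((n - 1 - b choose q) * (b + q choose q))"
      using b c[of b] by (auto simp: index_std_lower_pow binomial_eq_0_iff)
    finally show ?thesis .
  qed
  have "mat_trace (A * std_lower n ^\<^sub>m q) = (\<Sum>b<n. (A * std_lower n ^\<^sub>m q) $$ (b, b))"
    using A by (intro mat_trace_sum mult_carrier_mat[of _ n n _ n]) auto
  also have "\<dots> = c * fact q * of_nat (\<Sum>b<n. (n - 1 - b choose q) * (b + q choose q))"
    unfolding of_nat_sum sum_distrib_left by (intro sum.cong refl) (simp only: diag lessThan_iff)
  also have "(\<Sum>b<n. (n - 1 - b choose q) * (b + q choose q)) = (n + q choose (2 * q + 1))"
    by (subst sum_choose_mult_choose) (simp_all add: mult_2)
  finally show ?thesis .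
qed

lemma trace_std_pow_pow:
  "mat_trace (std_raise n ^\<^sub>m q * std_lower n ^\<^sub>m q) = (fact q)\<^sup>2 * of_nat (n + q choose (2 * q + 1))"
  by (subst trace_mult_std_lower_pow[where c = "fact q"]) (auto simp: index_std_raise_pow power2_eq_square)

text \<open>A matrix commuting with \<open>E\<close> is a combination of powers of \<open>E\<close>, and the trace against
  \<open>F\<^sup>q\<close> isolates the coefficient of \<open>E\<^sup>q\<close>.\<close>

lemma std_centralizer_zero:
  assumes A: "A \<in> carrier_mat n n" and comm: "std_raise n * A = A * std_raise n"
    and tr: "\<And>q. q < n \<Longrightarrow> mat_trace (A * std_lower n ^\<^sub>m q) = 0"
  shows "A = 0\<^sub>m n n"
proof -
  have rec: "(if Suc i < n then of_nat (Suc i) * A $$ (Suc i, j) else 0) =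
      (if 0 < j then of_nat j * A $$ (i, j - 1) else 0)" if "i < n" "j < n" for i j
    using arg_cong[OF comm, of "\<lambda>M. M $$ (i, j)"] that A
    by (simp only: index_mult_std_raise index_std_raise_mult)
  \<comment> \<open>The relation for column 0 kills the entries below its top one, and each further
    column follows from the preceding one.\<close>
  have low: "A $$ (i, j) = 0" if "j < i" "i < n" for i j
    using that
  proof (induction j arbitrary: i)
    case 0
    then obtain t where "i = Suc t" by (cases i) auto
    with 0 rec[of t 0] show ?case by (simp del: of_nat_Suc)
  next
    case (Suc j)
    then obtain t where "i = Suc t" by (cases i) auto
    with Suc rec[of t "Suc j"] show ?case by (simp del: of_nat_Suc)
  qed
  \<comment> \<open>The recursion along a superdiagonal has the same ratios as the entries of a
    power of \<open>std_raise n\<close>, so the entry in row 0 determines all others.\<close>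
  have up: "A $$ (i, i + q) = A $$ (0, q) * of_nat (i + q choose q)" if "i + q < n" for i q
    using that
  proof (induction i)
    case (Suc i)
    have "of_nat (Suc i) * A $$ (Suc i, Suc i + q) = of_nat (Suc i + q) * A $$ (i, i + q)"
      using rec[of i "Suc i + q"] Suc.prems by simp
    also have "\<dots> = A $$ (0, q) * (of_nat (Suc (i + q)) * of_nat (i + q choose i))"
      using Suc binomial_symmetric[of q "i + q"] by (simp del: of_nat_Suc)
    also have "of_nat (Suc (i + q)) * of_nat (i + q choose i) = (of_nat (Suc (i + q) choose Suc i) * of_nat (Suc i) :: complex)"
      by (simp only: of_nat_mult[symmetric] Suc_times_binomial_eq)
    also have "(Suc (i + q) choose Suc i) = (Suc i + q choose q)"
      by (subst binomial_symmetric) auto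
    finally have "of_nat (Suc i) * A $$ (Suc i, Suc i + q) = of_nat (Suc i) * (A $$ (0, q) * of_nat (Suc i + q choose q))"
      by (simp only: mult_ac)
    then show ?case by (simp only: mult_cancel_left of_nat_eq_0_iff) simp
  qed simp
  have "A $$ (0, q) = 0" if "q < n" for q
  proof -
    have "A $$ (0, q) * fact q * of_nat (n + q choose (2 * q + 1)) = 0"
      using tr[OF that] by (subst (asm) trace_mult_std_lower_pow[OF A up]) auto
    moreover have "(n + q choose (2 * q + 1)) \<noteq> 0" using that by (simp add: binomial_eq_0_iff)
    ultimately show ?thesis by simp
  qed
  then have "A $$ (i, j) = 0" if "i < n" "j < n" for i j
    using that low[of j i] up[of i "j - i"] by (cases "j < i") auto
  then show ?thesis using A by (intro eq_matI) auto
qed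

section \<open>Reduction to the standard principal triple\<close>

text \<open>With the witness P, Q fixed, conjugation is a homomorphism, so words in E and F can be
  transported as a whole; \<open>similar_mat\<close> would allow a different change of basis for
  each matrix.\<close>

lemma similar_mat_wit_mult:
  assumes A: "similar_mat_wit A A' P Q" and B: "similar_mat_wit B B' P Q"
  shows "similar_mat_wit (A * B) (A' * B') P Q"
proof -
  define n where "n = dim_row A"
  note a = similar_mat_witD[OF n_def A]
  have "n = dim_row B" using a(6) similar_mat_witD(6)[OF refl B] by auto
  note b = similar_mat_witD[OF this B]
  have "B' * Q \<in> carrier_mat n n" using a(7) b(5) by auto
  then have QP: "Q * (P * (B' * Q)) = B' * Q"
    using assoc_mult_mat[of Q n n P n "B' * Q" n] a(2,6,7) left_mult_one_mat[of "B' * Q" n n] by simp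
  have "A * B = (P * A' * Q) * (P * B' * Q)"
    by (simp only: a(3)[symmetric] b(3)[symmetric])
  also have "\<dots> = P * (A' * (Q * (P * (B' * Q))))"
    using a(4-) b(4-) by (simp add: assoc_mult_mat[of _ n n _ n _ n])
  also have "\<dots> = P * (A' * B') * Q"
    unfolding QP using a(4-) b(4-) by (simp add: assoc_mult_mat[of _ n n _ n _ n])
  finally have "A * B = P * (A' * B') * Q" .
  then show ?thesis using a(4-) b(4-) a(1,2)
    by (intro similar_mat_witI[of _ _ n]) auto
qed

lemma similar_mat_wit_minus:
  fixes A B :: "complex mat"
  assumes A: "similar_mat_wit A A' P Q" and B: "similar_mat_wit B B' P Q"
  shows "similar_mat_wit (A - B) (A' - B') P Q"
proof -
  define n where "n = dim_row A"
  note a = similar_mat_witD[OF n_def A]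
  have "n = dim_row B" using a(6) similar_mat_witD(6)[OF refl B] by auto
  note b = similar_mat_witD[OF this B]
  have c: "P * A' \<in> carrier_mat n n" "P * B' \<in> carrier_mat n n" using a(5,6) b(5) by auto
  have "P * (A' - B') * Q = P * A' * Q - P * B' * Q"
    using mult_minus_distrib_mat[OF a(6,5) b(5)] minus_mult_distrib_mat[OF c a(7)] by simp
  then have "A - B = P * (A' - B') * Q"
    by (simp only: a(3)[symmetric] b(3)[symmetric])
  then show ?thesis using a(4-) b(4-) a(1,2)
    by (intro similar_mat_witI[of _ _ n]) auto
qed

lemma similar_mat_wit_lie_bracket:
  assumes "similar_mat_wit A A' P Q" and "similar_mat_wit B B' P Q"
  shows "similar_mat_wit (lie_bracket A B) (lie_bracket A' B') P Q"
  unfolding lie_bracket_def using assms by (intro similar_mat_wit_minus similar_mat_wit_mult)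

lemma similar_mat_wit_lie_bracket_iter:
  assumes "similar_mat_wit A A' P Q" and "similar_mat_wit B B' P Q"
  shows "similar_mat_wit ((lie_bracket A ^^ r) B) ((lie_bracket A' ^^ r) B') P Q"
  by (induction r) (use assms in \<open>auto intro: similar_mat_wit_lie_bracket\<close>)

lemma similar_mat_wit_trace:
  assumes A: "similar_mat_wit A A' P Q"
  shows "mat_trace A = mat_trace A'"
proof -
  define n where "n = dim_row A"
  note a = similar_mat_witD[OF n_def A]
  have "mat_trace A = mat_trace (Q * (P * A'))"
    unfolding a(3) by (rule mat_trace_mult_commute[of _ n]) (use a(4-) in auto)
  also have "Q * (P * A') = A'"
    using a(2,4-) by (simp flip: assoc_mult_mat[of Q n n P n A' n])
  finally show ?thesis .
qed

lemma lie_bracket_mult_vec: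
  assumes "A \<in> carrier_mat n n" "B \<in> carrier_mat n n" "v \<in> carrier_vec n"
  shows "A *\<^sub>v (B *\<^sub>v v) = B *\<^sub>v (A *\<^sub>v v) + lie_bracket A B *\<^sub>v v"
proof -
  have "A * B = B * A + lie_bracket A B"
    unfolding lie_bracket_def using assms by (intro eq_matI) auto
  then have "(A * B) *\<^sub>v v = (B * A) *\<^sub>v v + lie_bracket A B *\<^sub>v v"
    using assms by (simp add: add_mult_distrib_mat_vec[of _ n n])
  then show ?thesis using assms by (simp add: assoc_mult_mat_vec[of _ n n _ n])
qed

lemma index_jordan_block_mult_vec:
  assumes "v \<in> carrier_vec n" "i < n"
  shows "(jordan_block n 0 *\<^sub>v v) $ i = (if Suc i < n then v $ Suc i else (0 :: complex))"
proof -
  have "(jordan_block n 0 *\<^sub>v v) $ i = (\<Sum>k<n. jordan_block n 0 $$ (i, k) * v $ k)"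
    using assms by (auto simp: scalar_prod_def atLeast0LessThan intro!: sum.cong)
  also have "\<dots> = (if Suc i < n then jordan_block n 0 $$ (i, Suc i) * v $ Suc i else 0)"
    using assms by (intro sum_lessThan_single) auto
  finally show ?thesis using assms by auto
qed

text \<open>Since \<open>tr H = 0\<close>, the kernel vector of \<open>E\<close> has weight \<open>n - 1\<close>.\<close>

lemma weight_first_column:
  fixes H :: "complex mat"
  assumes H: "H \<in> carrier_mat n n" and n: "0 < n" and tr: "mat_trace H = 0"
    and HE: "lie_bracket H (jordan_block n 0) = 2 \<cdot>\<^sub>m jordan_block n 0"
  shows "i < n \<Longrightarrow> H $$ (i, 0) = (if i = 0 then of_nat (n - 1) else 0)"
proof -
  let ?J = "jordan_block n 0 :: complex mat"
  have HJ: "(H * ?J) $$ (i, j) = (if 0 < j then H $$ (i, j - 1) else 0)" if "i < n" "j < n" for i j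
  proof -
    have "(H * ?J) $$ (i, j) = (\<Sum>k<n. H $$ (i, k) * ?J $$ (k, j))"
      using H that by (intro index_mult_mat_sum) auto
    also have "\<dots> = (if j - 1 < n then H $$ (i, j - 1) * ?J $$ (j - 1, j) else 0)"
      using that by (intro sum_lessThan_single) auto
    finally show ?thesis using that by auto
  qed
  have JH: "(?J * H) $$ (i, j) = (if Suc i < n then H $$ (Suc i, j) else 0)" if "i < n" "j < n" for i j
  proof -
    have "(?J * H) $$ (i, j) = (\<Sum>k<n. ?J $$ (i, k) * H $$ (k, j))"
      using H that by (intro index_mult_mat_sum) auto
    also have "\<dots> = (if Suc i < n then ?J $$ (i, Suc i) * H $$ (Suc i, j) else 0)"
      using that by (intro sum_lessThan_single) auto
    finally show ?thesis using that by auto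
  qed
  have rel: "(if 0 < j then H $$ (i, j - 1) else 0) - (if Suc i < n then H $$ (Suc i, j) else 0) =
      (if Suc i = j then 2 else 0)" if "i < n" "j < n" for i j
  proof -
    have "lie_bracket H ?J $$ (i, j) = (H * ?J) $$ (i, j) - (?J * H) $$ (i, j)"
      unfolding lie_bracket_def using H that by simp
    then show ?thesis using that unfolding HE HJ[OF that] JH[OF that] by (simp split: if_splits)
  qed
  \<comment> \<open>Entry (i, i + 1) of the weight relation lowers the diagonal by 2 at each step;
    the zero trace then fixes the top entry as n - 1.\<close>
  have diag: "H $$ (i, i) = H $$ (0, 0) - 2 * of_nat i" if "i < n" for i
    using that
  proof (induction i)
    case (Suc i)
    then show ?case using rel[of i "Suc i"] by (simp add: algebra_simps)
  qed simp
  have "0 = (\<Sum>i<n. H $$ (i, i))"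
    using tr H by (simp add: mat_trace_sum[of _ n])
  also have "\<dots> = (\<Sum>i<n. H $$ (0, 0) - 2 * of_nat i)"
    by (intro sum.cong refl) (rule diag, simp)
  also have "\<dots> = of_nat n * (H $$ (0, 0) - of_nat (n - 1))"
  proof -
    have "2 * (\<Sum>i<n. of_nat i) = (of_nat n * of_nat (n - 1) :: complex)"
    proof (induction n)
      case (Suc n)
      then show ?case by (cases n) (auto simp: algebra_simps)
    qed simp
    moreover have "(\<Sum>i<n. H $$ (0, 0) - 2 * of_nat i) = of_nat n * H $$ (0, 0) - 2 * (\<Sum>i<n. of_nat i)"
      by (simp add: sum_subtractf sum_distrib_left)
    ultimately show ?thesis by (simp add: algebra_simps)
  qed
  finally have "H $$ (0, 0) = of_nat (n - 1)" using n by simp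
  moreover have "H $$ (i, 0) = 0" if "i < n" "0 < i"
    using rel[of "i - 1" 0] that by auto
  ultimately show "i < n \<Longrightarrow> H $$ (i, 0) = (if i = 0 then of_nat (n - 1) else 0)" by auto
qed

text \<open>The vectors F^b e_0 with b < n are weight vectors on which E acts by the usual sl_2
  formula. Because E is a Jordan block it shifts coordinates, and this formula makes the matrix of
  these vectors upper triangular with nonzero diagonal, hence invertible.\<close>

lemma jordan_triple_similar_std:
  fixes H F :: "complex mat"
  assumes H: "H \<in> carrier_mat n n" and F: "F \<in> carrier_mat n n" and n: "0 < n" and tr: "mat_trace H = 0"
    and HE: "lie_bracket H (jordan_block n 0) = 2 \<cdot>\<^sub>m jordan_block n 0"
    and HF: "lie_bracket H F = (- 2) \<cdot>\<^sub>m F"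
    and EF: "lie_bracket (jordan_block n 0) F = H"
  shows "\<exists>P Q. similar_mat_wit (jordan_block n 0) (std_raise n) P Q \<and> similar_mat_wit F (std_lower n) P Q"
proof -
  let ?J = "jordan_block n 0 :: complex mat"
  define v where "v = rec_nat (unit_vec n 0 :: complex vec) (\<lambda>_ u. F *\<^sub>v u)"
  have v0: "v 0 = unit_vec n 0" and vS: "v (Suc b) = F *\<^sub>v v b" for b
    by (simp_all add: v_def)
  have vc: "v b \<in> carrier_vec n" for b
    by (induction b) (use F in \<open>auto simp: v0 vS\<close>)
  have J: "?J \<in> carrier_mat n n" by simp
  have Hv: "H *\<^sub>v v b = (of_nat (n - 1) - 2 * of_nat b) \<cdot>\<^sub>v v b" for b
  proof (induction b)
    case 0
    have "H *\<^sub>v unit_vec n 0 = of_nat (n - 1) \<cdot>\<^sub>v unit_vec n 0"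
      using H n weight_first_column[OF H n tr HE]
      by (intro eq_vecI) (auto simp: row_carrier scalar_prod_right_unit)
    then show ?case by (simp add: v0)
  next
    case (Suc b)
    have "H *\<^sub>v v (Suc b) = F *\<^sub>v (H *\<^sub>v v b) + lie_bracket H F *\<^sub>v v b"
      unfolding vS by (rule lie_bracket_mult_vec[OF H F vc])
    also have "F *\<^sub>v (H *\<^sub>v v b) = (of_nat (n - 1) - 2 * of_nat b) \<cdot>\<^sub>v v (Suc b)"
      unfolding Suc.IH vS using F vc[of b] by (simp add: mult_mat_vec[of _ n n])
    also have "lie_bracket H F *\<^sub>v v b = (- 2) \<cdot>\<^sub>v v (Suc b)"
      unfolding HF vS using F vc[of b] by (intro eq_vecI) auto
    finally show ?case using vc[of "Suc b"]
      by (simp add: add_smult_distrib_vec[symmetric] algebra_simps)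
  qed
  have Ev0: "?J *\<^sub>v v 0 = 0\<^sub>v n"
    using index_jordan_block_mult_vec[OF vc[of 0]] by (intro eq_vecI) (auto simp: v0)
  have Ev: "?J *\<^sub>v v (Suc b) = (of_nat (Suc b) * (of_nat (n - 1) - of_nat b)) \<cdot>\<^sub>v v b" for b
  proof (induction b)
    case 0
    have "?J *\<^sub>v v (Suc 0) = F *\<^sub>v (?J *\<^sub>v v 0) + lie_bracket ?J F *\<^sub>v v 0"
      unfolding vS by (rule lie_bracket_mult_vec[OF J F vc])
    moreover have "F *\<^sub>v 0\<^sub>v n = 0\<^sub>v n"
      using F by (intro eq_vecI) auto
    ultimately show ?case using F Hv[of 0] vc[of 0] unfolding EF Ev0 by simp
  next
    case (Suc b)
    have "?J *\<^sub>v v (Suc (Suc b)) = F *\<^sub>v (?J *\<^sub>v v (Suc b)) + lie_bracket ?J F *\<^sub>v v (Suc b)"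
      unfolding vS[of "Suc b"] by (rule lie_bracket_mult_vec[OF J F vc])
    also have "F *\<^sub>v (?J *\<^sub>v v (Suc b)) = (of_nat (Suc b) * (of_nat (n - 1) - of_nat b)) \<cdot>\<^sub>v v (Suc b)"
      unfolding Suc.IH using F vc[of b] by (simp add: mult_mat_vec[of _ n n] vS)
    also have "lie_bracket ?J F *\<^sub>v v (Suc b) = (of_nat (n - 1) - 2 * of_nat (Suc b)) \<cdot>\<^sub>v v (Suc b)"
      unfolding EF Hv ..
    finally show ?case using vc[of "Suc b"]
      by (simp add: add_smult_distrib_vec[symmetric] algebra_simps)
  qed
  \<comment> \<open>Reading \<open>Ev\<close> in coordinates determines every coordinate of
    \<open>v (Suc b)\<close> except the 0-th from those of \<open>v b\<close>.\<close>
  have shift: "v (Suc b) $ Suc i = of_nat (Suc b) * (of_nat (n - 1) - of_nat b) * v b $ i" if "Suc i < n" for b i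
    using arg_cong[OF Ev[of b], of "\<lambda>u. u $ i"] index_jordan_block_mult_vec[OF vc[of "Suc b"], of i] that vc[of b]
    by auto
  have upper: "v b $ i = 0" if "b < i" "i < n" for b i
    using that
  proof (induction b arbitrary: i)
    case (Suc b)
    then obtain t where "i = Suc t" by (cases i) auto
    with Suc show ?case using shift[of t b] by auto
  qed (simp add: v0)
  have diag: "v b $ b \<noteq> 0" if "b < n" for b
    using that
  proof (induction b)
    case (Suc b)
    have e: "of_nat (n - 1) - of_nat b = (of_nat (n - 1 - b) :: complex)" using Suc.prems by (simp add: of_nat_diff)
    have "(of_nat (n - 1) :: complex) - of_nat b \<noteq> 0"
      unfolding e using Suc.prems by (simp only: of_nat_eq_0_iff)
    then show ?case using Suc.IH Suc.prems unfolding shift[OF Suc.prems] by (simp del: of_nat_Suc)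
  qed (simp add: v0)
  \<comment> \<open>For b = n - 1 the factor n - 1 - b in \<open>shift\<close> is 0, so
    \<open>v n\<close> is a multiple of e_0. Its weight is n - 1 - 2n while that of e_0 is n - 1, so
    it vanishes.\<close>
  have vn: "v n $ i = 0" if "i < n" for i
  proof (cases i)
    case (Suc t)
    then show ?thesis using shift[of t "n - 1"] that n by auto
  next
    case 0
    have z: "v n $ Suc t = 0" if "Suc t < n" for t
      using shift[of t "n - 1"] that n by auto
    have "(H *\<^sub>v v n) $ 0 = (\<Sum>k<n. H $$ (0, k) * v n $ k)"
      using H vc[of n] n by (auto simp: scalar_prod_def atLeast0LessThan intro!: sum.cong)
    also have "\<dots> = (if 0 < n then H $$ (0, 0) * v n $ 0 else 0)"
      by (rule sum_lessThan_single) (metis z mult_zero_right not0_implies_Suc)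
    also have "\<dots> = of_nat (n - 1) * v n $ 0"
      using n weight_first_column[OF H n tr HE, of 0] by simp
    finally have "(of_nat (n - 1) - 2 * of_nat n) * v n $ 0 = of_nat (n - 1) * v n $ 0"
      unfolding Hv using vc[of n] n by simp
    then show ?thesis using 0 n by (simp add: algebra_simps)
  qed
  \<comment> \<open>The vector (n - 1 - b)! F^b e_0 plays x^(n-1-b) y^b: differentiation in x
    produces the exponent n - 1 - b, which the factorials absorb.\<close>
  define P where "P = mat n n (\<lambda>(i, b). fact (n - 1 - b) * v b $ i)"
  have P: "P \<in> carrier_mat n n" by (simp add: P_def)
  have "det P = prod_list (diag_mat P)"
    by (rule det_upper_triangular[OF _ P]) (auto simp: P_def upper_triangular_def upper)
  also have "\<dots> \<noteq> 0"
    by (auto simp: diag_mat_def P_def diag prod_list_zero_iff)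
  finally have "P \<in> Units (ring_mat TYPE(complex) n ())" by (rule det_non_zero_imp_unit[OF P])
  then obtain Q where Q: "Q \<in> carrier_mat n n" "Q * P = 1\<^sub>m n" "P * Q = 1\<^sub>m n"
    unfolding Units_def ring_mat_def by auto
  have ent: "(A * P) $$ (i, b) = fact (n - 1 - b) * (A *\<^sub>v v b) $ i"
    if "A \<in> carrier_mat n n" "i < n" "b < n" for A i b
  proof -
    have "(A * P) $$ (i, b) = (\<Sum>k<n. A $$ (i, k) * P $$ (k, b))"
      using that P by (intro index_mult_mat_sum)
    also have "\<dots> = fact (n - 1 - b) * (\<Sum>k<n. A $$ (i, k) * v b $ k)"
      unfolding sum_distrib_left using that by (intro sum.cong) (auto simp: P_def)
    also have "(\<Sum>k<n. A $$ (i, k) * v b $ k) = (A *\<^sub>v v b) $ i"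
      using that vc[of b] by (auto simp: scalar_prod_def atLeast0LessThan intro!: sum.cong)
    finally show ?thesis .
  qed
  have JP: "?J * P = P * std_raise n"
  proof (rule eq_matI)
    fix i b assume "i < dim_row (P * std_raise n)" "b < dim_col (P * std_raise n)"
    then have ib: "i < n" "b < n" using P by auto
    show "(?J * P) $$ (i, b) = (P * std_raise n) $$ (i, b)"
    proof (cases b)
      case 0
      then show ?thesis using ib P ent[OF J ib] by (simp add: index_mult_std_raise Ev0 del: index_mult_mat)
    next
      case (Suc c)
      have "n - 1 - c = Suc (n - 1 - Suc c)" using Suc ib by simp
      then have f: "(fact (n - 1 - c) :: complex) = of_nat (n - 1 - c) * fact (n - 1 - Suc c)"
        by (metis fact_Suc)
      have g: "(of_nat (n - 1 - c) :: complex) = of_nat (n - 1) - of_nat c" using Suc ib by (simp add: of_nat_diff)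
      have "(?J * P) $$ (i, b) = fact (n - 1 - Suc c) * (of_nat (Suc c) * (of_nat (n - 1) - of_nat c) * v c $ i)"
        using ent[OF J ib] Suc ib vc[of c] by (simp add: Ev del: index_mult_mat)
      also have "\<dots> = of_nat (Suc c) * (fact (n - 1 - c) * v c $ i)"
        unfolding f g by (simp add: mult_ac)
      also have "\<dots> = (P * std_raise n) $$ (i, b)"
        using P ib Suc index_mult_std_raise[OF P ib] by (simp add: P_def)
      finally show ?thesis .
    qed
  qed (use P in auto)
  have FP: "F * P = P * std_lower n"
  proof (rule eq_matI)
    fix i b assume "i < dim_row (P * std_lower n)" "b < dim_col (P * std_lower n)"
    then have ib: "i < n" "b < n" using P by auto
    have e: "(F * P) $$ (i, b) = fact (n - 1 - b) * v (Suc b) $ i"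
      using ent[OF F ib] by (simp add: vS)
    show "(F * P) $$ (i, b) = (P * std_lower n) $$ (i, b)"
    proof (cases "Suc b < n")
      case True
      then have "n - 1 - b = Suc (n - 1 - Suc b)" by simp
      then have f: "(fact (n - 1 - b) :: complex) = of_nat (n - 1 - b) * fact (n - 1 - Suc b)"
        by (metis fact_Suc)
      show ?thesis unfolding e f index_mult_std_lower[OF P ib] using True ib by (simp add: P_def)
    next
      case False
      then have "Suc b = n" using ib by simp
      then show ?thesis unfolding e index_mult_std_lower[OF P ib] using vn ib by simp
    qed
  qed (use P F in auto)
  have conj: "A = P * B * Q" if "A * P = P * B" "A \<in> carrier_mat n n" "B \<in> carrier_mat n n" for A B
  proof -
    have "P * B * Q = A * (P * Q)"
      unfolding that(1)[symmetric] by (rule assoc_mult_mat[OF that(2) P Q(1)])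
    then show ?thesis using Q(3) that by simp
  qed
  have "similar_mat_wit ?J (std_raise n) P Q"
    by (rule similar_mat_witI[OF Q(3,2) conj[OF JP]]) (use P Q in auto)
  moreover have "similar_mat_wit F (std_lower n) P Q"
    by (rule similar_mat_witI[OF Q(3,2) conj[OF FP]]) (use P Q F in auto)
  ultimately show ?thesis by blast
qed

lemma principal_sl2_triple_similar_std:
  assumes triple: "principal_sl2_triple n E H F" and n: "0 < n"
  shows "\<exists>P Q. similar_mat_wit E (std_raise n) P Q \<and> similar_mat_wit F (std_lower n) P Q"
proof -
  let ?J = "jordan_block n 0 :: complex mat"
  have c: "E \<in> carrier_mat n n" "H \<in> carrier_mat n n" "F \<in> carrier_mat n n" "mat_trace H = 0"
    and r: "lie_bracket H E = 2 \<cdot>\<^sub>m E" "lie_bracket H F = (- 2) \<cdot>\<^sub>m F" "lie_bracket E F = H"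
    using triple unfolding principal_sl2_triple_def sl_carrier_def by blast+
  obtain P Q where EJ: "similar_mat_wit E ?J P Q"
    using triple unfolding principal_sl2_triple_def similar_mat_def by blast
  note w = similar_mat_witD2[OF c(1) EJ]
  have sw: "similar_mat_wit A (Q * A * P) P Q" if "A \<in> carrier_mat n n" for A
  proof -
    have "P * (Q * A * P) * Q = (P * Q) * A * (P * Q)"
      using that w(6,7) by (simp add: assoc_mult_mat[of _ n n _ n _ n])
    then show ?thesis using that w by (intro similar_mat_witI[of _ _ n]) auto
  qed
  \<comment> \<open>A matrix has only one conjugate under the fixed P and Q, so each relation of the
    triple passes to the conjugates by comparing two conjugates of the same matrix.\<close>
  have uniq: "B = B'" if "similar_mat_wit A B P Q" "similar_mat_wit A B' P Q" "A \<in> carrier_mat n n" for A B B'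
  proof -
    have "B = Q * A * P" if "similar_mat_wit A B P Q" for B
      using similar_mat_witD2[OF _ similar_mat_wit_sym[OF that], of n n] similar_mat_witD2(5)[OF \<open>A \<in> carrier_mat n n\<close> that] by auto
    then show ?thesis using that by metis
  qed
  have smult: "similar_mat_wit (a \<cdot>\<^sub>m A) (a \<cdot>\<^sub>m B) P Q" if "similar_mat_wit A B P Q" "A \<in> carrier_mat n n" for a A B
    using similar_mat_witD2[OF that(2,1)] by (intro similar_mat_witI[of _ _ n])
      (auto simp: mult_smult_assoc_mat[of _ n n _ n] mult_smult_distrib[of _ n n _ n])
  define H' where "H' = Q * H * P"
  define F' where "F' = Q * F * P"
  have HH: "similar_mat_wit H H' P Q" and FF: "similar_mat_wit F F' P Q"
    unfolding H'_def F'_def using sw c by auto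
  have "\<exists>P Q. similar_mat_wit ?J (std_raise n) P Q \<and> similar_mat_wit F' (std_lower n) P Q"
  proof (rule jordan_triple_similar_std)
    show "H' \<in> carrier_mat n n" "F' \<in> carrier_mat n n"
      using similar_mat_witD2[OF c(2) HH] similar_mat_witD2[OF c(3) FF] by auto
    show "mat_trace H' = 0" using similar_mat_wit_trace[OF HH] c by simp
    show "lie_bracket H' ?J = 2 \<cdot>\<^sub>m ?J"
      using similar_mat_wit_lie_bracket[OF HH EJ] smult[OF EJ c(1), of 2] c uniq unfolding r by auto
    show "lie_bracket H' F' = (- 2) \<cdot>\<^sub>m F'"
      using similar_mat_wit_lie_bracket[OF HH FF] smult[OF FF c(3), of "- 2"] c uniq[of "(- 2) \<cdot>\<^sub>m F"] unfolding r by auto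
    show "lie_bracket ?J F' = H'"
      using similar_mat_wit_lie_bracket[OF EJ FF] HH c uniq unfolding r by auto
  qed (rule n)
  then obtain P' Q' where "similar_mat_wit ?J (std_raise n) P' Q'" "similar_mat_wit F' (std_lower n) P' Q'" by blast
  then show ?thesis using similar_mat_wit_trans[OF EJ] similar_mat_wit_trans[OF FF] by blast
qed

section \<open>The irreducible components of the adjoint representation\<close>

lemma lie_bracket_weight:
  assumes c: "H \<in> carrier_mat n n" "A \<in> carrier_mat n n" "B \<in> carrier_mat n n"
    and w: "lie_bracket H A = a \<cdot>\<^sub>m A" "lie_bracket H B = b \<cdot>\<^sub>m B"
  shows "lie_bracket H (lie_bracket A B) = (a + b) \<cdot>\<^sub>m lie_bracket A B"
proof -
  have L: "lie_bracket A B \<in> carrier_mat n n" using c by simp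
  have "lie_bracket H (lie_bracket A B) = a \<cdot>\<^sub>m lie_bracket A B + b \<cdot>\<^sub>m lie_bracket A B"
    using c by (simp add: lie_bracket_jacobi[of H n] w lie_bracket_smult_left[of _ n] lie_bracket_smult_right[of _ n])
  then show ?thesis using L by (simp add: add_smult_distrib_right_mat[of _ n n])
qed

lemma mat_sum_smult:
  assumes "finite S" "\<And>s. s \<in> S \<Longrightarrow> f s \<in> carrier_mat n n"
  shows "mat_sum n (\<lambda>s. c \<cdot>\<^sub>m f s) S = c \<cdot>\<^sub>m mat_sum n f S"
proof (rule eq_matI)
  have C: "mat_sum n f S \<in> carrier_mat n n" "mat_sum n (\<lambda>s. c \<cdot>\<^sub>m f s) S \<in> carrier_mat n n"
    using assms by auto
  then show "dim_row (mat_sum n (\<lambda>s. c \<cdot>\<^sub>m f s) S) = dim_row (c \<cdot>\<^sub>m mat_sum n f S)"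
    "dim_col (mat_sum n (\<lambda>s. c \<cdot>\<^sub>m f s) S) = dim_col (c \<cdot>\<^sub>m mat_sum n f S)" by auto
  fix i j assume "i < dim_row (c \<cdot>\<^sub>m mat_sum n f S)" "j < dim_col (c \<cdot>\<^sub>m mat_sum n f S)"
  then have ij: "i < n" "j < n" using C by auto
  have "mat_sum n (\<lambda>s. c \<cdot>\<^sub>m f s) S $$ (i, j) = (\<Sum>s\<in>S. (c \<cdot>\<^sub>m f s) $$ (i, j))"
    using assms ij by (intro index_mat_sum) auto
  also have "\<dots> = (\<Sum>s\<in>S. c * f s $$ (i, j))"
    using assms ij by (intro sum.cong refl index_smult_mat) fastforce+
  also have "\<dots> = c * mat_sum n f S $$ (i, j)"
    using assms ij by (subst index_mat_sum) (auto simp: sum_distrib_left)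
  finally show "mat_sum n (\<lambda>s. c \<cdot>\<^sub>m f s) S $$ (i, j) = (c \<cdot>\<^sub>m mat_sum n f S) $$ (i, j)"
    using C ij by auto
qed

lemma trace_lie_bracket_iter:
  assumes "F \<in> carrier_mat n n" "A \<in> carrier_mat n n" "B \<in> carrier_mat n n"
  shows "mat_trace ((lie_bracket F ^^ m) A * B) = (- 1) ^ m * mat_trace (A * (lie_bracket F ^^ m) B)"
  using assms(3)
proof (induction m arbitrary: B)
  case (Suc m)
  have "mat_trace ((lie_bracket F ^^ Suc m) A * B) = - mat_trace ((lie_bracket F ^^ m) A * lie_bracket F B)"
    using mat_trace_lie_bracket_mult[OF assms(1) _ Suc.prems, of "(lie_bracket F ^^ m) A"] assms by simp
  also have "\<dots> = (- 1) ^ Suc m * mat_trace (A * (lie_bracket F ^^ m) (lie_bracket F B))"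
    using Suc.IH[of "lie_bracket F B"] Suc.prems assms(1) by simp
  finally show ?case by (simp add: funpow_swap1)
qed simp

lemma lie_bracket_iter_mult_pow:
  assumes "F \<in> carrier_mat n n" "A \<in> carrier_mat n n"
  shows "(lie_bracket F ^^ m) (A * F ^\<^sub>m p) = (lie_bracket F ^^ m) A * F ^\<^sub>m p"
proof (induction m)
  case (Suc m)
  have X: "(lie_bracket F ^^ m) A \<in> carrier_mat n n" "F ^\<^sub>m p \<in> carrier_mat n n" using assms by auto
  have Y: "lie_bracket F ((lie_bracket F ^^ m) A) * F ^\<^sub>m p \<in> carrier_mat n n"
    by (rule mult_carrier_mat[OF lie_bracket_carrier[OF assms(1) X(1)] X(2)])
  show ?case using assms X Y
    by (simp add: Suc lie_bracket_mult[of F n] lie_bracket_pow_commute[of F n] right_mult_zero_mat[OF X(1)])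
qed simp

locale principal_triple =
  fixes n :: nat and E H F :: "complex mat"
  assumes n_pos: "0 < n" and triple: "principal_sl2_triple n E H F"
begin

lemma carrier [simp]: "E \<in> carrier_mat n n" "H \<in> carrier_mat n n" "F \<in> carrier_mat n n"
  and HE: "lie_bracket H E = 2 \<cdot>\<^sub>m E" and HF: "lie_bracket H F = (- 2) \<cdot>\<^sub>m F"
  and EF: "lie_bracket E F = H"
  using triple unfolding principal_sl2_triple_def sl_carrier_def by blast+

text \<open>This is G_{k,k-r}: counting the applications of \<open>ad_F\<close> gives a natural
  index without range conditions, and the weight 2k - 2r.\<close>

definition g :: "nat \<Rightarrow> nat \<Rightarrow> complex mat" where
  "g k r = (lie_bracket F ^^ r) (E ^\<^sub>m k)"

lemma g_carrier [simp]: "g k r \<in> carrier_mat n n"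
  unfolding g_def by (intro lie_bracket_iter_carrier) auto

lemma g_dim [simp]: "dim_row (g k r) = n" "dim_col (g k r) = n"
  using carrier_matD[OF g_carrier] by auto

lemma g_0 [simp]: "g k 0 = E ^\<^sub>m k" and g_Suc: "g k (Suc r) = lie_bracket F (g k r)"
  by (simp_all add: g_def)

lemma g_add: "g k (r + s) = (lie_bracket F ^^ r) (g k s)"
  by (simp add: g_def funpow_add)

lemma H_pow_F: "lie_bracket H (F ^\<^sub>m p) = (- 2 * of_nat p) \<cdot>\<^sub>m F ^\<^sub>m p"
  using lie_bracket_pow_weight[OF carrier(2,3) HF, of p] by (simp add: mult.commute)

lemma H_g: "lie_bracket H (g k r) = (2 * of_nat k - 2 * of_nat r) \<cdot>\<^sub>m g k r"
proof (induction r)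
  case 0
  show ?case using lie_bracket_pow_weight[OF carrier(2,1) HE, of k] by (simp add: mult.commute)
next
  case (Suc r)
  show ?case using lie_bracket_weight[OF carrier(2,3) g_carrier HF Suc] by (simp add: g_Suc algebra_simps)
qed

text \<open>Moving E past each F contributes, through [E, F] = H, the weights 2k, 2k - 2, ..., 2k -
  2r, whose sum is (r + 1)(2k - r).\<close>

lemma E_g_Suc: "lie_bracket E (g k (Suc r)) = (of_nat (Suc r) * (2 * of_nat k - of_nat r)) \<cdot>\<^sub>m g k r"
proof (induction r)
  case 0
  have c: "g k 0 \<in> carrier_mat n n" by (rule g_carrier)
  have "lie_bracket E (lie_bracket F (g k 0)) = lie_bracket H (g k 0) + lie_bracket F (lie_bracket E (g k 0))"
    by (simp only: lie_bracket_jacobi[OF carrier(1,3) c] EF)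
  then show ?case using c H_g[of k 0] lie_bracket_pow_commute[OF carrier(1), of k] by (simp add: g_Suc)
next
  case (Suc r)
  have "lie_bracket E (lie_bracket F (g k (Suc r))) =
      lie_bracket H (g k (Suc r)) + lie_bracket F (lie_bracket E (g k (Suc r)))"
    by (simp only: lie_bracket_jacobi[OF carrier(1,3) g_carrier] EF)
  also have "lie_bracket F (lie_bracket E (g k (Suc r))) =
      (of_nat (Suc r) * (2 * of_nat k - of_nat r)) \<cdot>\<^sub>m g k (Suc r)"
    unfolding Suc by (simp add: lie_bracket_smult_right[of _ n] g_Suc)
  finally have "lie_bracket E (lie_bracket F (g k (Suc r))) =
      (2 * of_nat k - 2 * of_nat (Suc r) + of_nat (Suc r) * (2 * of_nat k - of_nat r)) \<cdot>\<^sub>m g k (Suc r)"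
    unfolding H_g using g_carrier[of k "Suc r"]
    by (simp add: add_smult_distrib_right_mat[of _ n n])
  then show ?case by (simp add: g_Suc algebra_simps)
qed

lemma trace_weight_F_pow:
  assumes "M \<in> carrier_mat n n" "lie_bracket H M = c \<cdot>\<^sub>m M" "c \<noteq> 2 * of_nat q"
  shows "mat_trace (M * F ^\<^sub>m q) = 0"
  using assms(3) by (intro mat_trace_weight_zero[OF carrier(2) assms(1) _ assms(2) H_pow_F]) auto

text \<open>In the standard realization M commutes with E, so \<open>std_centralizer_zero\<close>
  applies. Powers of F of a weight other than -c pair to 0 with M, which leaves only the q with c =
  2q to be tested.\<close>

lemma highest_weight_zero:
  assumes M: "M \<in> carrier_mat n n" and EM: "lie_bracket E M = 0\<^sub>m n n" and HM: "lie_bracket H M = c \<cdot>\<^sub>m M"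
    and tr: "\<And>q. q < n \<Longrightarrow> c = 2 * of_nat q \<Longrightarrow> mat_trace (M * F ^\<^sub>m q) = 0"
  shows "M = 0\<^sub>m n n"
proof -
  obtain P Q where E: "similar_mat_wit E (std_raise n) P Q" and F: "similar_mat_wit F (std_lower n) P Q"
    using principal_sl2_triple_similar_std[OF triple n_pos] by blast
  note w = similar_mat_witD2[OF carrier(1) E]
  define M' where "M' = Q * M * P"
  have M': "M' \<in> carrier_mat n n" unfolding M'_def using w M by auto
  have "P * M' * Q = (P * Q) * M * (P * Q)"
    unfolding M'_def using M w(6,7) by (simp add: assoc_mult_mat[of _ n n _ n _ n])
  then have MP: "M = P * M' * Q" using w(1) M by simp
  then have MM: "similar_mat_wit M M' P Q"
    using w M M' by (intro similar_mat_witI[of _ _ n]) auto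
  have "M' = 0\<^sub>m n n"
  proof (rule std_centralizer_zero[OF M'])
    have "similar_mat_wit (0\<^sub>m n n) (lie_bracket (std_raise n) M') P Q"
      using similar_mat_wit_lie_bracket[OF E MM] by (simp add: EM)
    then have "similar_mat_wit (lie_bracket (std_raise n) M') (0\<^sub>m n n) Q P" by (rule similar_mat_wit_sym)
    then have "lie_bracket (std_raise n) M' = Q * 0\<^sub>m n n * P"
      unfolding similar_mat_wit_def Let_def by blast
    also have "\<dots> = 0\<^sub>m n n" using w by simp
    finally have z: "std_raise n * M' - M' * std_raise n = 0\<^sub>m n n" by (simp add: lie_bracket_def)
    show "std_raise n * M' = M' * std_raise n"
    proof (rule eq_matI)
      fix i j assume "i < dim_row (M' * std_raise n)" "j < dim_col (M' * std_raise n)"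
      then show "(std_raise n * M') $$ (i, j) = (M' * std_raise n) $$ (i, j)"
        using arg_cong[OF z, of "\<lambda>A. A $$ (i, j)"] M' by simp
    qed (use M' in auto)
    fix q assume q: "q < n"
    have "mat_trace (M' * std_lower n ^\<^sub>m q) = mat_trace (M * F ^\<^sub>m q)"
      by (rule similar_mat_wit_trace[OF similar_mat_wit_mult[OF MM similar_mat_wit_pow[OF F]], symmetric])
    also have "\<dots> = 0"
      using tr[OF q] trace_weight_F_pow[OF M HM, of q] by blast
    finally show "mat_trace (M' * std_lower n ^\<^sub>m q) = 0" .
  qed
  then show ?thesis unfolding MP using w by simp
qed

text \<open>At r = 2k the factor in \<open>E_g_Suc\<close> is 0, so \<open>g k (Suc (2 * k))\<close>
  is a highest weight vector. Its weight -2 is not of the form 2q, and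
  \<open>highest_weight_zero\<close> has nothing to test.\<close>

lemma g_eq_0:
  assumes "2 * k < r"
  shows "g k r = 0\<^sub>m n n"
proof -
  have "2 * of_nat k - 2 * of_nat (Suc (2 * k)) = (2 * of_nat q :: complex) \<Longrightarrow> False" for q :: nat
  proof -
    assume "2 * of_nat k - 2 * of_nat (Suc (2 * k)) = (2 * of_nat q :: complex)"
    then have "of_nat (2 * (k + 1 + q)) = (0 :: complex)" by (simp add: algebra_simps)
    then have "2 * (k + 1 + q) = 0" by (simp only: of_nat_eq_0_iff)
    then show False by simp
  qed
  moreover have "lie_bracket E (g k (Suc (2 * k))) = 0\<^sub>m n n"
    unfolding E_g_Suc by (intro eq_matI) auto
  ultimately have "g k (Suc (2 * k)) = 0\<^sub>m n n"
    by (intro highest_weight_zero[OF g_carrier _ H_g]) blast+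
  moreover have "(lie_bracket F ^^ r) (0\<^sub>m n n) = 0\<^sub>m n n" for r
    by (induction r) auto
  ultimately have "g k (r - Suc (2 * k) + Suc (2 * k)) = 0\<^sub>m n n" by (simp only: g_add)
  then show ?thesis using assms by simp
qed

lemma trace_E_pow_F_pow: "mat_trace (E ^\<^sub>m q * F ^\<^sub>m q) = (fact q)\<^sup>2 * of_nat (n + q choose (2 * q + 1))"
proof -
  obtain P Q where "similar_mat_wit E (std_raise n) P Q" "similar_mat_wit F (std_lower n) P Q"
    using principal_sl2_triple_similar_std[OF triple n_pos] by blast
  then have "similar_mat_wit (E ^\<^sub>m q * F ^\<^sub>m q) (std_raise n ^\<^sub>m q * std_lower n ^\<^sub>m q) P Q"
    by (intro similar_mat_wit_mult similar_mat_wit_pow)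
  then show ?thesis using similar_mat_wit_trace trace_std_pow_pow by metis
qed

lemma trace_E_pow_F_pow_nonzero: "q < n \<Longrightarrow> mat_trace (E ^\<^sub>m q * F ^\<^sub>m q) \<noteq> 0"
  by (simp add: trace_E_pow_F_pow binomial_eq_0_iff)

lemma trace_word:
  assumes "m + p = k + l" "m \<le> 2 * k" "m \<le> 2 * l"
  shows "mat_trace (E ^\<^sub>m k * (g l m * F ^\<^sub>m p)) =
    fact m * (fact k * fact l * fact p)\<^sup>2 / (fact m * fact (2 * k - m) * fact (2 * l - m)) * racah_sum n k l m"
proof -
  obtain P Q where "similar_mat_wit E (std_raise n) P Q" "similar_mat_wit F (std_lower n) P Q"
    using principal_sl2_triple_similar_std[OF triple n_pos] by blast
  then have "similar_mat_wit (E ^\<^sub>m k * (g l m * F ^\<^sub>m p))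
      (std_raise n ^\<^sub>m k * ((lie_bracket (std_lower n) ^^ m) (std_raise n ^\<^sub>m l) * std_lower n ^\<^sub>m p)) P Q"
    unfolding g_def by (intro similar_mat_wit_mult similar_mat_wit_pow similar_mat_wit_lie_bracket_iter)
  then show ?thesis using similar_mat_wit_trace trace_std_word[OF assms] by metis
qed

lemma trace_commutator_word:
  assumes mp: "m + p = k + l" and m: "m \<le> 2 * k" "m \<le> 2 * l"
  shows "mat_trace (lie_bracket (E ^\<^sub>m k) (g l m) * F ^\<^sub>m p) =
    (1 - (- 1) ^ m) * ((fact k * fact l * fact p)\<^sup>2 / (fact (2 * k - m) * fact (2 * l - m)) * racah_sum n k l m)"
proof -
  define T where "T = mat_trace (E ^\<^sub>m k * (g l m * F ^\<^sub>m p))"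
  have c: "E ^\<^sub>m k \<in> carrier_mat n n" "F ^\<^sub>m p \<in> carrier_mat n n" by simp_all
  have "mat_trace (lie_bracket (E ^\<^sub>m k) (g l m) * F ^\<^sub>m p) =
      mat_trace (E ^\<^sub>m k * (g l m * F ^\<^sub>m p) - g l m * (E ^\<^sub>m k * F ^\<^sub>m p))"
    unfolding lie_bracket_def using c g_carrier[of l m] assoc_mult_mat[OF c(1) g_carrier[of l m] c(2)]
      assoc_mult_mat[OF g_carrier[of l m] c] minus_mult_distrib_mat[OF mult_carrier_mat[OF c(1) g_carrier[of l m]] mult_carrier_mat[OF g_carrier[of l m] c(1)] c(2)]
    by simp
  also have "\<dots> = mat_trace (E ^\<^sub>m k * (g l m * F ^\<^sub>m p)) - mat_trace (g l m * (E ^\<^sub>m k * F ^\<^sub>m p))"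
    using c g_carrier[of l m] by (intro mat_trace_minus[of _ n] mult_carrier_mat[of _ n n _ n]) auto
  also have "mat_trace (g l m * (E ^\<^sub>m k * F ^\<^sub>m p)) = (- 1) ^ m * mat_trace (E ^\<^sub>m l * (g k m * F ^\<^sub>m p))"
    using trace_lie_bracket_iter[OF carrier(3), of "E ^\<^sub>m l" "E ^\<^sub>m k * F ^\<^sub>m p" m] mult_carrier_mat[OF c]
    by (simp add: lie_bracket_iter_mult_pow[OF carrier(3) c(1)] g_def)
  also have "mat_trace (E ^\<^sub>m l * (g k m * F ^\<^sub>m p)) = mat_trace (E ^\<^sub>m k * (g l m * F ^\<^sub>m p))"
    using assms by (simp add: trace_word add.commute mult_ac racah_sum_commute[of n l k])
  finally have "mat_trace (lie_bracket (E ^\<^sub>m k) (g l m) * F ^\<^sub>m p) = (1 - (- 1) ^ m) * T"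
    unfolding T_def by (simp only: left_diff_distrib mult_1)
  then show ?thesis unfolding T_def trace_word[OF assms] by simp
qed

end

section \<open>Transvectants of monomials\<close>

text \<open>The base is complex because \<open>omega_sum_lower\<close> shifts it to a - 1, where
  natural subtraction would stop at 0.\<close>

definition falling :: "complex \<Rightarrow> nat \<Rightarrow> complex" where
  "falling a s = (\<Prod>i<s. a - of_nat i)"

lemma falling_0 [simp]: "falling a 0 = 1"
  by (simp add: falling_def)

lemma falling_Suc: "falling a (Suc s) = falling a s * (a - of_nat s)"
  by (simp add: falling_def)

lemma falling_Suc_shift: "falling a (Suc s) = a * falling (a - 1) s"
proof (induction s)
  case (Suc s)
  have "falling a (Suc (Suc s)) = a * falling (a - 1) s * (a - of_nat (Suc s))"
    by (simp only: falling_Suc[of a "Suc s"] Suc)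
  then show ?case by (simp add: falling_Suc algebra_simps)
qed (simp add: falling_Suc)

lemma falling_plus_1: "falling (a + 1) s = falling a s + of_nat s * falling a (s - 1)"
proof (cases s)
  case (Suc t)
  show ?thesis unfolding Suc falling_Suc_shift[of "a + 1"] by (simp add: falling_Suc algebra_simps)
qed simp

lemma falling_of_nat: "falling (of_nat a) s = (if s \<le> a then fact a / fact (a - s) else 0)"
proof (induction s)
  case (Suc s)
  show ?case
  proof (cases "Suc s \<le> a")
    case True
    then have "a - s = Suc (a - Suc s)" by simp
    then have e1: "(fact (a - s) :: complex) = of_nat (a - s) * fact (a - Suc s)" by (metis fact_Suc)
    have e2: "(of_nat a - of_nat s :: complex) = of_nat (a - s)" using True by (simp add: of_nat_diff)
    have "(of_nat (a - s) :: complex) \<noteq> 0" using True by (simp only: of_nat_eq_0_iff)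
    then have "fact a / (of_nat (a - s) * fact (a - Suc s)) * of_nat (a - s) = (fact a / fact (a - Suc s) :: complex)"
      by (simp del: of_nat_diff)
    then have "falling (of_nat a) s * (of_nat a - of_nat s) = fact a / fact (a - Suc s)"
      using Suc.IH True unfolding e1 e2 by simp
    then show ?thesis using True by (simp only: falling_Suc if_True)
  next
    case False
    then show ?thesis using Suc.IH by (cases "s = a") (simp_all add: falling_Suc)
  qed
qed simp

text \<open>The coefficient of the m-th transvectant of x^a y^b and x^c y^d, by
  \<open>transvectant_bimonom\<close>.\<close>

definition omega_sum :: "nat \<Rightarrow> complex \<Rightarrow> complex \<Rightarrow> complex \<Rightarrow> complex \<Rightarrow> complex" where
  "omega_sum m a b c d = (\<Sum>s\<le>m. (- 1) ^ s * of_nat (m choose s) *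
     (falling a (m - s) * falling b s * falling c s * falling d (m - s)))"

text \<open>The transvectant commutes with \<open>y \<partial>\<^sub>x\<close>, read off on monomials.\<close>

lemma omega_sum_lower:
  "a * omega_sum m (a - 1) (b + 1) c d + c * omega_sum m a b (c - 1) (d + 1) =
    (a + c - of_nat m) * omega_sum m a b c d"
proof -
  define u where "u = (\<lambda>s. (- 1) ^ s * of_nat (m choose s) :: complex)"
  define t where "t = (\<lambda>s. falling a (m - s) * falling b s * falling c s * falling d (m - s))"
  \<comment> \<open>Raising b by 1 in the term s leaves the correction \<open>h s\<close>. Raising d
    by 1 in the same term leaves \<open>- h (Suc s)\<close>, because \<open>us\<close> relates
    consecutive signed binomials.\<close>
  define h where "h = (\<lambda>s. u s * of_nat s * (falling a (Suc m - s) * falling b (s - 1) * falling c s * falling d (m - s)))"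
  have us: "u (Suc s) * of_nat (Suc s) = - (u s * of_nat (m - s))" if "s \<le> m" for s
  proof -
    have "of_nat (Suc s) * of_nat (m choose Suc s) = (of_nat (m - s) * of_nat (m choose s) :: complex)"
      using binomial_step[of m s] that by (simp add: of_nat_diff)
    then show ?thesis by (simp add: u_def mult_ac)
  qed
  have 1: "a * (falling (a - 1) (m - s) * falling (b + 1) s * falling c s * falling d (m - s)) * u s =
      (a - of_nat (m - s)) * u s * t s + h s" if "s \<le> m" for s
  proof -
    have e1: "a * falling (a - 1) (m - s) = falling a (Suc m - s)"
      using that by (simp add: falling_Suc_shift Suc_diff_le)
    have e2: "falling a (Suc m - s) = (a - of_nat (m - s)) * falling a (m - s)"
      using that by (simp add: falling_Suc Suc_diff_le)
    have "a * (falling (a - 1) (m - s) * falling (b + 1) s * falling c s * falling d (m - s)) * u s =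
        a * falling (a - 1) (m - s) * (falling (b + 1) s * falling c s * falling d (m - s) * u s)"
      by (simp add: mult_ac)
    also have "\<dots> = falling a (Suc m - s) * (falling b s * falling c s * falling d (m - s) * u s) + h s"
      unfolding e1 falling_plus_1 h_def by (simp add: algebra_simps)
    also have "\<dots> = (a - of_nat (m - s)) * u s * t s + h s"
      unfolding e2 t_def by (simp add: mult_ac)
    finally show ?thesis .
  qed
  have 2: "c * (falling a (m - s) * falling b s * falling (c - 1) s * falling (d + 1) (m - s)) * u s =
      (c - of_nat s) * u s * t s - h (Suc s)" if "s \<le> m" for s
  proof -
    have e1: "c * falling (c - 1) s = falling c (Suc s)" by (simp add: falling_Suc_shift)
    have e2: "falling c (Suc s) = (c - of_nat s) * falling c s" by (simp add: falling_Suc)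
    have e3: "h (Suc s) = - (u s * of_nat (m - s) * (falling a (m - s) * falling b s * falling c (Suc s) * falling d (m - s - 1)))"
      unfolding h_def us[OF that] by simp
    have "c * (falling a (m - s) * falling b s * falling (c - 1) s * falling (d + 1) (m - s)) * u s =
        c * falling (c - 1) s * (falling a (m - s) * falling b s * falling (d + 1) (m - s) * u s)"
      by (simp add: mult_ac)
    also have "\<dots> = falling c (Suc s) * (falling a (m - s) * falling b s * falling d (m - s) * u s) - h (Suc s)"
      unfolding e1 e3 falling_plus_1 by (simp add: algebra_simps)
    also have "\<dots> = (c - of_nat s) * u s * t s - h (Suc s)"
      unfolding e2 t_def by (simp add: mult_ac)
    finally show ?thesis .
  qed
  \<comment> \<open>Both ends are 0: \<open>h 0\<close> has the factor 0 and
    \<open>h (Suc m)\<close> the binomial C(m, m + 1).\<close>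
  have tele: "(\<Sum>s\<le>m. h s - h (Suc s)) = 0"
    by (subst sum_telescope) (simp add: h_def u_def)
  have "a * omega_sum m (a - 1) (b + 1) c d + c * omega_sum m a b (c - 1) (d + 1) =
      (\<Sum>s\<le>m. a * (falling (a - 1) (m - s) * falling (b + 1) s * falling c s * falling d (m - s)) * u s +
        c * (falling a (m - s) * falling b s * falling (c - 1) s * falling (d + 1) (m - s)) * u s)"
    by (simp add: omega_sum_def u_def sum_distrib_left sum.distrib mult_ac)
  also have "\<dots> = (\<Sum>s\<le>m. (a + c - of_nat m) * (u s * t s) + (h s - h (Suc s)))"
  proof (intro sum.cong refl)
    fix s assume "s \<in> {..m}"
    then have s: "s \<le> m" by simp
    have m: "of_nat m = (of_nat (m - s) + of_nat s :: complex)" using s by (simp add: of_nat_diff)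
    show "a * (falling (a - 1) (m - s) * falling (b + 1) s * falling c s * falling d (m - s)) * u s +
        c * (falling a (m - s) * falling b s * falling (c - 1) s * falling (d + 1) (m - s)) * u s =
        (a + c - of_nat m) * (u s * t s) + (h s - h (Suc s))"
      unfolding 1[OF s] 2[OF s] m by (simp add: algebra_simps)
  qed
  also have "\<dots> = (a + c - of_nat m) * omega_sum m a b c d"
    unfolding sum.distrib tele by (simp add: omega_sum_def u_def t_def sum_distrib_left)
  finally show ?thesis .
qed

lemma omega_sum_highest: "omega_sum m a 0 c d = falling a m * falling d m"
proof -
  have "falling 0 s = 0" if "0 < s" for s
    using that by (cases s) (auto simp: falling_Suc_shift)
  then have "omega_sum m a 0 c d = (\<Sum>s\<in>{0}. (- 1) ^ s * of_nat (m choose s) *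
     (falling a (m - s) * falling 0 s * falling c s * falling d (m - s)))"
    unfolding omega_sum_def by (intro sum.mono_neutral_right) auto
  then show ?thesis by simp
qed

text \<open>The transvectant would have a negative exponent of x. This and the counterpart for y
  make the truncated exponents harmless.\<close>

lemma omega_sum_eq_0_x:
  assumes "a + c < m"
  shows "omega_sum m (of_nat a) b (of_nat c) d = 0"
  unfolding omega_sum_def
proof (intro sum.neutral ballI)
  fix s assume "s \<in> {..m}"
  then have "a < m - s \<or> c < s" using assms by auto
  then show "(- 1) ^ s * of_nat (m choose s) * (falling (of_nat a) (m - s) * falling b s *
      falling (of_nat c) s * falling d (m - s)) = 0"
    by (auto simp: falling_of_nat)
qed

lemma omega_sum_eq_0_y:
  assumes "b + d < m"
  shows "omega_sum m a (of_nat b) c (of_nat d) = 0"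
  unfolding omega_sum_def
proof (intro sum.neutral ballI)
  fix s assume "s \<in> {..m}"
  then have "b < s \<or> d < m - s" using assms by auto
  then show "(- 1) ^ s * of_nat (m choose s) * (falling a (m - s) * falling (of_nat b) s *
      falling c s * falling (of_nat d) (m - s)) = 0"
    by (auto simp: falling_of_nat)
qed

section \<open>Monomials in two variables and their transvectants\<close>

definition bimonom :: "complex \<Rightarrow> nat \<Rightarrow> nat \<Rightarrow> bipoly" where
  "bimonom c a b = Polynomial.monom (Polynomial.monom c b) a"

lemma bimonom_0 [simp]: "bimonom 0 a b = 0"
  by (simp add: bimonom_def)

lemma coeff_bimonom: "poly.coeff (poly.coeff (bimonom c a b) i) j = (if i = a \<and> j = b then c else 0)"
  by (auto simp: bimonom_def)

lemma bimonom_mult: "bimonom c a b * bimonom c' a' b' = bimonom (c * c') (a + a') (b + b')"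
  by (simp add: bimonom_def mult_monom)

lemma bimonom_sum: "(\<Sum>s\<in>S. bimonom (f s) a b) = bimonom (sum f S) a b"
  by (induction S rule: infinite_finite_induct) (auto simp: bimonom_def add_monom)

lemma of_nat_mult_bimonom: "of_nat r * bimonom c a b = bimonom (of_nat r * c) a b"
  by (simp add: bimonom_def of_nat_poly smult_monom)

lemma sign_mult_bimonom: "(- 1) ^ s * bimonom c a b = bimonom ((- 1) ^ s * c) a b"
  by (cases "even s") (auto simp: bimonom_def minus_monom)

lemma scale_bimonom: "scale_bipoly e (bimonom c a b) = bimonom (e * c) a b"
  by (simp add: scale_bipoly_def bimonom_def smult_monom)

lemma m_elt_bimonom: "m_elt i j = bimonom (1 / fact (nat (int i + j))) (nat (int i + j)) (nat (int i - j))"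
proof -
  have x: "var_x = bimonom 1 1 0" and y: "var_y = bimonom 1 0 1"
    by (simp_all add: var_x_def var_y_def bimonom_def monom_Suc monom_0)
  have "var_y ^ b * var_x ^ a = bimonom 1 a b" for a b
    unfolding x y by (simp add: bimonom_def monom_power mult_monom)
  then show ?thesis by (simp add: m_elt_def scale_bimonom)
qed

lemma partial_x_bimonom: "(partial_x ^^ s) (bimonom c a b) = bimonom (falling (of_nat a) s * c) (a - s) b"
proof (induction s)
  case (Suc s)
  have "partial_x (bimonom c a b) = bimonom (of_nat a * c) (a - 1) b" for c a
    by (simp add: partial_x_def bimonom_def pderiv_monom of_nat_poly smult_monom)
  then have "(partial_x ^^ Suc s) (bimonom c a b) = bimonom (of_nat (a - s) * (falling (of_nat a) s * c)) (a - Suc s) b"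
    by (simp add: Suc)
  also have "of_nat (a - s) * (falling (of_nat a) s * c) = falling (of_nat a) (Suc s) * c"
  proof (cases "s \<le> a")
    case True
    then show ?thesis by (simp add: falling_Suc of_nat_diff)
  next
    case False
    then show ?thesis by (simp add: falling_of_nat)
  qed
  finally show ?case .
qed simp

lemma partial_y_bimonom: "(partial_y ^^ s) (bimonom c a b) = bimonom (falling (of_nat b) s * c) a (b - s)"
proof (induction s)
  case (Suc s)
  have "partial_y (bimonom c a b) = bimonom (of_nat b * c) a (b - 1)" for c b
    by (simp add: partial_y_def bimonom_def map_poly_monom pderiv_monom)
  then have "(partial_y ^^ Suc s) (bimonom c a b) = bimonom (of_nat (b - s) * (falling (of_nat b) s * c)) a (b - Suc s)"
    by (simp add: Suc)
  also have "of_nat (b - s) * (falling (of_nat b) s * c) = falling (of_nat b) (Suc s) * c"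
  proof (cases "s \<le> b")
    case True
    then show ?thesis by (simp add: falling_Suc of_nat_diff)
  next
    case False
    then show ?thesis by (simp add: falling_of_nat)
  qed
  finally show ?case .
qed simp

lemma transvectant_bimonom:
  "transvectant m (bimonom e a b) (bimonom e' c d) =
    bimonom (e * e' * omega_sum m (of_nat a) (of_nat b) (of_nat c) (of_nat d)) (a + c - m) (b + d - m)"
proof -
  have "transvectant m (bimonom e a b) (bimonom e' c d) =
      (\<Sum>s\<le>m. bimonom (e * e' * ((- 1) ^ s * of_nat (m choose s) * (falling (of_nat a) (m - s) *
        falling (of_nat b) s * falling (of_nat c) s * falling (of_nat d) (m - s)))) (a + c - m) (b + d - m))"
    unfolding transvectant_def
  proof (intro sum.cong refl)
    fix s assume "s \<in> {..m}"
    then have s: "s \<le> m" by simp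
    let ?t = "falling (of_nat a) (m - s) * falling (of_nat b) s * falling (of_nat c) s * falling (of_nat d) (m - s)"
    have "(- 1) ^ s * of_nat (m choose s) * (partial_x ^^ (m - s)) ((partial_y ^^ s) (bimonom e a b)) *
        (partial_x ^^ s) ((partial_y ^^ (m - s)) (bimonom e' c d)) =
      bimonom (e * e' * ((- 1) ^ s * of_nat (m choose s) * ?t)) (a - (m - s) + (c - s)) (b - s + (d - (m - s)))"
      unfolding partial_x_bimonom partial_y_bimonom
      by (simp only: mult.assoc bimonom_mult of_nat_mult_bimonom sign_mult_bimonom) (simp add: mult_ac)
    \<comment> \<open>The exponents are independent of s unless a subtraction truncates, and then
      one of the falling factorials is 0.\<close>
    also have "\<dots> = bimonom (e * e' * ((- 1) ^ s * of_nat (m choose s) * ?t)) (a + c - m) (b + d - m)"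
    proof (cases "m - s \<le> a \<and> s \<le> c \<and> s \<le> b \<and> m - s \<le> d")
      case True
      then have le: "m - s \<le> a" "s \<le> c" "s \<le> b" "m - s \<le> d" by auto
      have "a - (m - s) + (c - s) = a + c - m" using s le(1,2) by linarith
      moreover have "b - s + (d - (m - s)) = b + d - m" using s le(3,4) by linarith
      ultimately show ?thesis by (simp only:)
    next
      case False
      then have "?t = 0" by (auto simp: falling_of_nat)
      then show ?thesis by (simp only: mult_zero_right bimonom_0)
    qed
    finally show "(- 1) ^ s * of_nat (m choose s) * (partial_x ^^ (m - s)) ((partial_y ^^ s) (bimonom e a b)) *
        (partial_x ^^ s) ((partial_y ^^ (m - s)) (bimonom e' c d)) =
      bimonom (e * e' * ((- 1) ^ s * of_nat (m choose s) * ?t)) (a + c - m) (b + d - m)" .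
  qed
  then show ?thesis
    by (simp only: bimonom_sum omega_sum_def sum_distrib_left)
qed

section \<open>The isomorphisms with binary forms\<close>

lemma smult_smult_mat: "a \<cdot>\<^sub>m (b \<cdot>\<^sub>m A) = (a * b) \<cdot>\<^sub>m (A :: complex mat)"
  by (intro eq_matI) auto

lemma zero_smult_mat: "A \<in> carrier_mat n n \<Longrightarrow> (0 :: complex) \<cdot>\<^sub>m A = 0\<^sub>m n n"
  by (intro eq_matI) auto

context principal_triple
begin

text \<open>\<open>gh p z\<close> corresponds to the monomial \<open>x\<^sup>2\<^sup>p\<^sup>-\<^sup>z y\<^sup>z\<close> under \<open>\<Phi>\<^sub>p\<close>.\<close>

definition gh :: "nat \<Rightarrow> nat \<Rightarrow> complex mat" where
  "gh p z = fact (2 * p - z) \<cdot>\<^sub>m g p z"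

lemma gh_carrier [simp]: "gh p z \<in> carrier_mat n n"
  by (simp add: gh_def)

lemma gh_dim [simp]: "dim_row (gh p z) = n" "dim_col (gh p z) = n"
  by (simp_all add: gh_def)

lemma H_gh: "lie_bracket H (gh p z) = (2 * of_nat p - 2 * of_nat z) \<cdot>\<^sub>m gh p z"
  by (simp add: gh_def lie_bracket_smult_right[of _ n] H_g smult_smult_mat mult.commute)

text \<open>The factorials turn \<open>ad_F\<close> into the action of y d/dx on x^(2p-z) y^z. No
  bound on z is required: for z \<ge> 2p both sides are 0 by \<open>g_eq_0\<close> or by the
  factor.\<close>

lemma F_gh: "lie_bracket F (gh p z) = (2 * of_nat p - of_nat z) \<cdot>\<^sub>m gh p (Suc z)"
proof -
  have "lie_bracket F (gh p z) = fact (2 * p - z) \<cdot>\<^sub>m g p (Suc z)"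
    by (simp add: gh_def lie_bracket_smult_right[of _ n] g_Suc)
  also have "\<dots> = (2 * of_nat p - of_nat z) \<cdot>\<^sub>m gh p (Suc z)"
  proof (cases "Suc z \<le> 2 * p")
    case True
    then have "2 * p - z = Suc (2 * p - Suc z)" by simp
    then have "(fact (2 * p - z) :: complex) = of_nat (2 * p - z) * fact (2 * p - Suc z)" by (metis fact_Suc)
    also have "(of_nat (2 * p - z) :: complex) = 2 * of_nat p - of_nat z" using True by (simp add: of_nat_diff)
    finally show ?thesis by (simp only: gh_def smult_smult_mat)
  next
    case False
    then show ?thesis by (simp add: gh_def g_eq_0)
  qed
  finally show ?thesis .
qed

text \<open>The action of x d/dy. The bound matters: at z = 2p + 1 the left side is 0, whereas
  \<open>gh p (2 * p)\<close> need not be.\<close>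

lemma E_gh:
  assumes "z \<le> 2 * p"
  shows "lie_bracket E (gh p z) = of_nat z \<cdot>\<^sub>m gh p (z - 1)"
proof (cases z)
  case 0
  have "lie_bracket E (E ^\<^sub>m p) = 0\<^sub>m n n" by (rule lie_bracket_pow_commute) simp
  then show ?thesis using 0 by (simp add: gh_def lie_bracket_smult_right[of _ n] zero_smult_mat[of _ n])
next
  case (Suc y)
  have "2 * p - y = Suc (2 * p - Suc y)" using Suc assms by simp
  then have f: "(fact (2 * p - y) :: complex) = of_nat (2 * p - y) * fact (2 * p - Suc y)" by (metis fact_Suc)
  have o: "(of_nat (2 * p - y) :: complex) = 2 * of_nat p - of_nat y" using Suc assms by (simp add: of_nat_diff)
  have "lie_bracket E (gh p z) = (fact (2 * p - Suc y) * (of_nat (Suc y) * (2 * of_nat p - of_nat y))) \<cdot>\<^sub>m g p y"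
    unfolding Suc gh_def by (simp add: lie_bracket_smult_right[of _ n] E_g_Suc smult_smult_mat)
  also have "fact (2 * p - Suc y) * (of_nat (Suc y) * (2 * of_nat p - of_nat y)) = of_nat (Suc y) * (fact (2 * p - y) :: complex)"
    unfolding f o by (simp add: mult_ac)
  finally show ?thesis unfolding Suc gh_def by (simp only: smult_smult_mat diff_Suc_1)
qed

lemma trace_g_g_zero:
  assumes "z + y \<noteq> 2 * p"
  shows "mat_trace (g p z * g p y) = 0"
proof (rule mat_trace_weight_zero[OF carrier(2) g_carrier g_carrier H_g H_g])
  show "2 * of_nat p - 2 * of_nat z + (2 * of_nat p - 2 * of_nat y) \<noteq> (0 :: complex)"
  proof
    assume "2 * of_nat p - 2 * of_nat z + (2 * of_nat p - 2 * of_nat y) = (0 :: complex)"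
    then have "of_nat (2 * (z + y)) = (of_nat (2 * (2 * p)) :: complex)" by (simp add: algebra_simps)
    then show False using assms by (simp only: of_nat_eq_iff) simp
  qed
qed

text \<open>Moving ad_F^z across leaves, up to sign, tr(E^p ad_F^(2p)(E^p)), which is
  \<open>trace_word\<close> with F^0; its Racah sum has the single nonzero term r = p. Such pairings
  of opposite weights give the linear independence on which \<open>Phi\<close> depends.\<close>

lemma trace_g_g_nonzero:
  assumes "z + y = 2 * p" "p < n"
  shows "mat_trace (g p z * g p y) \<noteq> 0"
proof -
  have "mat_trace (g p z * g p y) = (- 1) ^ z * mat_trace (E ^\<^sub>m p * g p (2 * p))"
    using trace_lie_bracket_iter[OF carrier(3), of "E ^\<^sub>m p" "g p y" z] g_add[of p z y] assms
    by (simp add: g_def)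
  also have "g p (2 * p) = g p (2 * p) * F ^\<^sub>m 0"
    using right_mult_one_mat[OF g_carrier[of p "2 * p"]] carrier_matD[OF carrier(3)] by simp
  also have "mat_trace (E ^\<^sub>m p * (g p (2 * p) * F ^\<^sub>m 0)) = fact (2 * p) * (fact p * fact p * fact 0)\<^sup>2 /
      (fact (2 * p) * fact (2 * p - 2 * p) * fact (2 * p - 2 * p)) * racah_sum n p p (2 * p)"
    by (rule trace_word) auto
  also have "racah_sum n p p (2 * p) = (- 1) ^ p * of_nat ((2 * p choose p) * (n + p choose (2 * p + 1)))"
    unfolding racah_sum_def by (subst sum.mono_neutral_right[of _ "{p}"]) (auto simp: binomial_eq_0)
  finally show ?thesis using assms by (simp add: binomial_eq_0_iff)
qed

definition comb :: "nat \<Rightarrow> (int \<Rightarrow> complex) \<Rightarrow> complex mat" where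
  "comb p c = mat_sum n (\<lambda>j. c j \<cdot>\<^sub>m G_elt E F p j) {- int p..int p}"

definition comb_poly :: "nat \<Rightarrow> (int \<Rightarrow> complex) \<Rightarrow> bipoly" where
  "comb_poly p c = (\<Sum>j\<in>{- int p..int p}. scale_bipoly (c j) (m_elt p j))"

lemma G_elt_eq_g: "G_elt E F p j = g p (nat (int p - j))"
  by (simp add: G_elt_def g_def)

text \<open>Pairing with the vector of opposite weight isolates one coefficient.\<close>

lemma comb_eqD:
  assumes "comb p c = comb p d" "p < n" "j \<in> {- int p..int p}"
  shows "c j = d j"
proof -
  define y where "y = nat (int p + j)"
  define N where "N = mat_trace (g p (nat (int p - j)) * g p y)"
  have N: "N \<noteq> 0" unfolding N_def y_def by (rule trace_g_g_nonzero) (use assms in auto)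
  have "mat_trace (comb p c * g p y) = c j * N" for c
  proof -
    have "mat_trace (comb p c * g p y) = (\<Sum>i\<in>{- int p..int p}. mat_trace ((c i \<cdot>\<^sub>m G_elt E F p i) * g p y))"
      unfolding comb_def by (rule mat_trace_mat_sum_mult) (auto simp: G_elt_eq_g)
    also have "\<dots> = (\<Sum>i\<in>{- int p..int p}. c i * mat_trace (g p (nat (int p - i)) * g p y))"
      by (intro sum.cong refl)
        (simp add: G_elt_eq_g mult_smult_assoc_mat[OF g_carrier g_carrier] mat_trace_smult[OF mult_carrier_mat[OF g_carrier g_carrier]])
    also have "\<dots> = (\<Sum>i\<in>{j}. c i * mat_trace (g p (nat (int p - i)) * g p y))"
    proof (rule sum.mono_neutral_right)
      show "\<forall>i\<in>{- int p..int p} - {j}. c i * mat_trace (g p (nat (int p - i)) * g p y) = 0"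
      proof
        fix i assume "i \<in> {- int p..int p} - {j}"
        then have "nat (int p - i) + y \<noteq> 2 * p" using assms(3) unfolding y_def by auto
        then show "c i * mat_trace (g p (nat (int p - i)) * g p y) = 0" by (simp add: trace_g_g_zero)
      qed
    qed (use assms in auto)
    finally show ?thesis by (simp add: N_def)
  qed
  then have "c j * N = d j * N" using assms(1) by metis
  then show ?thesis using N by simp
qed

lemma comb_poly_eqD:
  assumes "comb_poly p c = comb_poly p d" "j \<in> {- int p..int p}"
  shows "c j = d j"
proof -
  have "poly.coeff (poly.coeff (comb_poly p c) (nat (int p + j))) (nat (int p - j)) = c j / fact (nat (int p + j))" for c
  proof -
    have "poly.coeff (poly.coeff (comb_poly p c) (nat (int p + j))) (nat (int p - j)) =
        (\<Sum>i\<in>{- int p..int p}. if nat (int p + j) = nat (int p + i) \<and> nat (int p - j) = nat (int p - i)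
          then c i * (1 / fact (nat (int p + i))) else 0)"
      by (simp only: comb_poly_def m_elt_bimonom scale_bimonom coeff_sum coeff_bimonom)
    also have "\<dots> = (\<Sum>i\<in>{j}. c i * (1 / fact (nat (int p + i))))"
      using assms(2) by (intro sum.mono_neutral_cong_right) auto
    finally show ?thesis by simp
  qed
  then have "c j / fact (nat (int p + j)) = d j / fact (nat (int p + j))" using assms(1) by metis
  then show ?thesis by simp
qed

lemma comb_cong: "(\<And>j. j \<in> {- int p..int p} \<Longrightarrow> c j = d j) \<Longrightarrow> comb p c = comb p d"
  unfolding comb_def by (intro mat_sum_cong) (auto simp: G_elt_eq_g)

lemma Phi_comb:
  assumes "p < n"
  shows "Phi n E F p (comb p c) = comb_poly p c"
  unfolding Phi_def comb_def[symmetric] comb_poly_def[symmetric]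
proof (rule the_equality)
  fix P assume "\<exists>d. comb p c = comb p d \<and> P = comb_poly p d"
  then obtain d where d: "comb p c = comb p d" "P = comb_poly p d" by blast
  then show "P = comb_poly p c"
    using comb_eqD[OF d(1) assms] by (simp add: comb_poly_def)
qed blast

lemma Phi_inv_comb_poly:
  assumes "p < n"
  shows "Phi_inv n E F p (comb_poly p c) = comb p c"
proof -
  have V: "V_space n E F p = range (comb p)"
    by (auto simp: V_space_def comb_def)
  have "inj_on (Phi n E F p) (V_space n E F p)"
    unfolding V by (rule inj_onI) (auto simp: Phi_comb[OF assms], meson comb_cong comb_poly_eqD)
  then have "Phi_inv n E F p (Phi n E F p (comb p c)) = comb p c"
    unfolding Phi_inv_def by (rule inv_into_f_f) (simp add: V)
  then show ?thesis by (simp add: Phi_comb[OF assms])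
qed

text \<open>The vector \<open>g p z\<close> is sent to the monomial divided by (2p - z)!, so the
  plain monomial pulls back to \<open>gh p z\<close>.\<close>

lemma Phi_inv_bimonom:
  assumes "p < n" "z \<le> 2 * p"
  shows "Phi_inv n E F p (bimonom e (2 * p - z) z) = e \<cdot>\<^sub>m gh p z"
proof -
  define j where "j = int p - int z"
  define c where "c = (\<lambda>i. if i = j then e * fact (2 * p - z) else (0 :: complex))"
  have j: "j \<in> {- int p..int p}" "nat (int p + j) = 2 * p - z" "nat (int p - j) = z"
    using assms by (auto simp: j_def)
  have "comb_poly p c = (\<Sum>i\<in>{j}. scale_bipoly (c i) (m_elt p i))"
    unfolding comb_poly_def using j(1)
    by (intro sum.mono_neutral_right) (auto simp: c_def m_elt_bimonom scale_bimonom)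
  also have "\<dots> = bimonom e (2 * p - z) z"
    by (simp add: c_def m_elt_bimonom scale_bimonom j)
  finally have poly: "comb_poly p c = bimonom e (2 * p - z) z" .
  have "comb p c = mat_sum n (\<lambda>i. c i \<cdot>\<^sub>m G_elt E F p i) (insert j ({- int p..int p} - {j}))"
    unfolding comb_def using j(1) by (simp add: insert_absorb)
  also have "\<dots> = c j \<cdot>\<^sub>m G_elt E F p j + mat_sum n (\<lambda>i. c i \<cdot>\<^sub>m G_elt E F p i) ({- int p..int p} - {j})"
    by (rule mat_sum_insert) (auto simp: G_elt_eq_g)
  \<comment> \<open>All other coefficients are 0; writing the summands as 0 times a zero matrix lets
    \<open>mat_sum_smult\<close> evaluate the sum.\<close>
  also have "mat_sum n (\<lambda>i. c i \<cdot>\<^sub>m G_elt E F p i) ({- int p..int p} - {j}) =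
      mat_sum n (\<lambda>i. 0 \<cdot>\<^sub>m (0\<^sub>m n n)) ({- int p..int p} - {j})"
    by (rule mat_sum_cong) (auto simp: c_def G_elt_eq_g zero_smult_mat[of _ n])
  also have "\<dots> = 0 \<cdot>\<^sub>m mat_sum n (\<lambda>i. 0\<^sub>m n n) ({- int p..int p} - {j})"
    by (rule mat_sum_smult) auto
  also have "\<dots> = 0\<^sub>m n n" by (rule zero_smult_mat) auto
  finally have "comb p c = e \<cdot>\<^sub>m gh p z"
    by (simp add: c_def G_elt_eq_g j gh_def smult_smult_mat)
  then show ?thesis using Phi_inv_comb_poly[OF assms(1), of c] poly by simp
qed

end

section \<open>Existence and uniqueness of the structure constants\<close>

lemma one_smult_mat: "1 \<cdot>\<^sub>m A = (A :: complex mat)"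
  by (intro eq_matI) auto

lemma smult_mat_cancel:
  fixes A B :: "complex mat"
  assumes "a \<cdot>\<^sub>m A = a \<cdot>\<^sub>m B" "a \<noteq> 0"
  shows "A = B"
proof -
  have "(1 / a) \<cdot>\<^sub>m (a \<cdot>\<^sub>m A) = (1 / a) \<cdot>\<^sub>m (a \<cdot>\<^sub>m B)" using assms(1) by simp
  then show ?thesis using assms(2) by (simp add: smult_smult_mat one_smult_mat)
qed

lemma minus_mat_eq_0:
  fixes A B :: "complex mat"
  assumes "A \<in> carrier_mat n n" "B \<in> carrier_mat n n" "A - B = 0\<^sub>m n n"
  shows "A = B"
proof (rule eq_matI)
  fix i j assume "i < dim_row B" "j < dim_col B"
  moreover have "(A - B) $$ (i, j) = 0\<^sub>m n n $$ (i, j)" unfolding assms(3) ..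
  ultimately show "A $$ (i, j) = B $$ (i, j)" using assms(1,2) by simp
qed (use assms in auto)

lemma add_mat_cancel_right:
  fixes A B C :: "complex mat"
  assumes "A \<in> carrier_mat n n" "B \<in> carrier_mat n n" "C \<in> carrier_mat n n" "A + C = B + C"
  shows "A = B"
proof (rule eq_matI)
  fix i j assume "i < dim_row B" "j < dim_col B"
  moreover have "(A + C) $$ (i, j) = (B + C) $$ (i, j)" unfolding assms(4) ..
  ultimately show "A $$ (i, j) = B $$ (i, j)" using assms(1-3) by simp
qed (use assms in auto)

lemma mat_sum_add:
  assumes "finite S" "\<And>s. s \<in> S \<Longrightarrow> f s \<in> carrier_mat n n" "\<And>s. s \<in> S \<Longrightarrow> h s \<in> carrier_mat n n"
  shows "mat_sum n (\<lambda>s. f s + h s) S = mat_sum n f S + mat_sum n h S"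
proof -
  interpret abelian_group "module_mat TYPE(complex) n n" by (rule abelian_group_mat)
  show ?thesis using finsum_addf[of f S h] assms by (auto simp: module_mat_simps)
qed

context principal_triple
begin

definition indices :: "nat \<Rightarrow> nat \<Rightarrow> nat set" where
  "indices k l = {m \<in> {1..2 * l - 1}. k + l - m < n}"

lemma finite_indices [simp]: "finite (indices k l)"
  by (simp add: indices_def)

definition omega_at :: "nat \<Rightarrow> nat \<Rightarrow> nat \<Rightarrow> nat \<Rightarrow> nat \<Rightarrow> complex" where
  "omega_at k l m b d = omega_sum m (2 * of_nat k - of_nat b) (of_nat b) (2 * of_nat l - of_nat d) (of_nat d)"

text \<open>The right side of the defining relation for x^(2k-b) y^b and x^(2l-d) y^d. If b + d < m
  the index of \<open>gh\<close> truncates, but \<open>omega_at\<close> is then 0.\<close>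

definition expansion :: "nat \<Rightarrow> nat \<Rightarrow> (nat \<Rightarrow> complex) \<Rightarrow> nat \<Rightarrow> nat \<Rightarrow> complex mat" where
  "expansion k l w b d = mat_sum n (\<lambda>m. (w m * omega_at k l m b d) \<cdot>\<^sub>m gh (k + l - m) (b + d - m)) (indices k l)"

lemma expansion_carrier [simp]: "expansion k l w b d \<in> carrier_mat n n"
  by (auto simp: expansion_def)

lemma omega_at_eq_0: "b + d < m \<Longrightarrow> omega_at k l m b d = 0"
  by (simp add: omega_at_def omega_sum_eq_0_y)

lemma H_expansion:
  assumes "l \<le> k"
  shows "lie_bracket H (expansion k l w b d) = (2 * of_nat (k + l) - 2 * of_nat (b + d)) \<cdot>\<^sub>m expansion k l w b d"
proof -
  have "lie_bracket H (expansion k l w b d) =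
      mat_sum n (\<lambda>m. lie_bracket H ((w m * omega_at k l m b d) \<cdot>\<^sub>m gh (k + l - m) (b + d - m))) (indices k l)"
    unfolding expansion_def by (rule lie_bracket_mat_sum_right) auto
  also have "\<dots> = mat_sum n (\<lambda>m. (2 * of_nat (k + l) - 2 * of_nat (b + d)) \<cdot>\<^sub>m
      ((w m * omega_at k l m b d) \<cdot>\<^sub>m gh (k + l - m) (b + d - m))) (indices k l)"
  proof (rule mat_sum_cong)
    fix m assume "m \<in> indices k l"
    then have m: "m \<le> k + l" using assms by (auto simp: indices_def)
    show "lie_bracket H ((w m * omega_at k l m b d) \<cdot>\<^sub>m gh (k + l - m) (b + d - m)) =
        (2 * of_nat (k + l) - 2 * of_nat (b + d)) \<cdot>\<^sub>m ((w m * omega_at k l m b d) \<cdot>\<^sub>m gh (k + l - m) (b + d - m))"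
    proof (cases "b + d < m")
      case True
      then show ?thesis by (simp add: omega_at_eq_0 zero_smult_mat[of _ n] smult_smult_mat)
    next
      case False
      then have "2 * of_nat (k + l - m) - 2 * of_nat (b + d - m) = (2 * of_nat (k + l) - 2 * of_nat (b + d) :: complex)"
        using m by (simp add: of_nat_diff)
      then show ?thesis
        by (simp add: lie_bracket_smult_right[of _ n] H_gh smult_smult_mat mult.commute)
    qed
  qed auto
  also have "\<dots> = (2 * of_nat (k + l) - 2 * of_nat (b + d)) \<cdot>\<^sub>m expansion k l w b d"
    unfolding expansion_def by (rule mat_sum_smult) auto
  finally show ?thesis .
qed

text \<open>Term by term this is \<open>omega_sum_lower\<close>: lowering the two arguments of the
  transvectant adds up to lowering its value.\<close>

lemma F_expansion:
  assumes "l \<le> k"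
  shows "lie_bracket F (expansion k l w b d) =
    (2 * of_nat k - of_nat b) \<cdot>\<^sub>m expansion k l w (Suc b) d + (2 * of_nat l - of_nat d) \<cdot>\<^sub>m expansion k l w b (Suc d)"
proof -
  let ?a = "2 * of_nat k - of_nat b :: complex" and ?c = "2 * of_nat l - of_nat d :: complex"
  have "lie_bracket F (expansion k l w b d) =
      mat_sum n (\<lambda>m. lie_bracket F ((w m * omega_at k l m b d) \<cdot>\<^sub>m gh (k + l - m) (b + d - m))) (indices k l)"
    unfolding expansion_def by (rule lie_bracket_mat_sum_right) auto
  also have "\<dots> = mat_sum n (\<lambda>m. ?a \<cdot>\<^sub>m ((w m * omega_at k l m (Suc b) d) \<cdot>\<^sub>m gh (k + l - m) (Suc b + d - m)) +
      ?c \<cdot>\<^sub>m ((w m * omega_at k l m b (Suc d)) \<cdot>\<^sub>m gh (k + l - m) (b + Suc d - m))) (indices k l)"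
  proof (rule mat_sum_cong)
    fix m assume "m \<in> indices k l"
    then have m: "m \<le> k + l" using assms by (auto simp: indices_def)
    have rel: "?a * omega_at k l m (Suc b) d + ?c * omega_at k l m b (Suc d) = (?a + ?c - of_nat m) * omega_at k l m b d"
      using omega_sum_lower[of ?a m "of_nat b" ?c "of_nat d"] by (simp add: omega_at_def algebra_simps)
    have "lie_bracket F ((w m * omega_at k l m b d) \<cdot>\<^sub>m gh (k + l - m) (b + d - m)) =
        (w m * ((?a + ?c - of_nat m) * omega_at k l m b d)) \<cdot>\<^sub>m gh (k + l - m) (Suc b + d - m)"
    proof (cases "b + d < m")
      case True
      then show ?thesis by (simp add: omega_at_eq_0 zero_smult_mat[of _ n])
    next
      case False
      then have e: "2 * of_nat (k + l - m) - of_nat (b + d - m) = ?a + ?c - of_nat m" "Suc (b + d - m) = Suc b + d - m"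
        using m by (simp_all add: of_nat_diff)
      show ?thesis
        by (simp only: lie_bracket_smult_right[OF carrier(3) gh_carrier] F_gh smult_smult_mat e)
          (simp only: mult_ac)
    qed
    also have "\<dots> = ?a \<cdot>\<^sub>m ((w m * omega_at k l m (Suc b) d) \<cdot>\<^sub>m gh (k + l - m) (Suc b + d - m)) +
        ?c \<cdot>\<^sub>m ((w m * omega_at k l m b (Suc d)) \<cdot>\<^sub>m gh (k + l - m) (b + Suc d - m))"
      unfolding rel[symmetric] by (simp add: smult_smult_mat add_smult_distrib_right_mat[of _ n n, symmetric] algebra_simps)
    finally show "lie_bracket F ((w m * omega_at k l m b d) \<cdot>\<^sub>m gh (k + l - m) (b + d - m)) =
        ?a \<cdot>\<^sub>m ((w m * omega_at k l m (Suc b) d) \<cdot>\<^sub>m gh (k + l - m) (Suc b + d - m)) +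
        ?c \<cdot>\<^sub>m ((w m * omega_at k l m b (Suc d)) \<cdot>\<^sub>m gh (k + l - m) (b + Suc d - m))" .
  qed auto
  also have "\<dots> = ?a \<cdot>\<^sub>m expansion k l w (Suc b) d + ?c \<cdot>\<^sub>m expansion k l w b (Suc d)"
    unfolding expansion_def by (subst mat_sum_add) (auto simp: mat_sum_smult)
  finally show ?thesis .
qed

lemma omega_at_highest: "omega_at k l m 0 d = falling (of_nat (2 * k)) m * falling (of_nat d) m"
  by (simp add: omega_at_def omega_sum_highest)

text \<open>For b = 0 the first argument is killed by E and the transvectant coefficient is a
  product of two falling factorials, so the absorption of d - m suffices.\<close>

lemma E_expansion:
  assumes "l \<le> k" "d \<le> 2 * l"
  shows "lie_bracket E (expansion k l w 0 d) = of_nat d \<cdot>\<^sub>m expansion k l w 0 (d - 1)"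
proof -
  have "lie_bracket E (expansion k l w 0 d) =
      mat_sum n (\<lambda>m. lie_bracket E ((w m * omega_at k l m 0 d) \<cdot>\<^sub>m gh (k + l - m) (0 + d - m))) (indices k l)"
    unfolding expansion_def by (rule lie_bracket_mat_sum_right) auto
  also have "\<dots> = mat_sum n (\<lambda>m. of_nat d \<cdot>\<^sub>m
      ((w m * omega_at k l m 0 (d - 1)) \<cdot>\<^sub>m gh (k + l - m) (0 + (d - 1) - m))) (indices k l)"
  proof (rule mat_sum_cong)
    fix m assume "m \<in> indices k l"
    then have "d - m \<le> 2 * (k + l - m)" using assms by (auto simp: indices_def)
    note E = E_gh[OF this]
    have "falling (of_nat d) m * of_nat (d - m) = of_nat d * falling (of_nat (d - 1)) m"
    proof (cases "d = 0")
      case False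
      have "falling (of_nat d) m * of_nat (d - m) = falling (of_nat d) (Suc m)"
        by (cases "m \<le> d") (auto simp: falling_Suc of_nat_diff falling_of_nat)
      also have "\<dots> = of_nat d * falling (of_nat (d - 1)) m"
        using False by (simp add: falling_Suc_shift of_nat_diff)
      finally show ?thesis .
    qed simp
    then have s: "w m * omega_at k l m 0 d * of_nat (d - m) = of_nat d * (w m * omega_at k l m 0 (d - 1))"
      by (simp add: omega_at_highest mult_ac)
    have i: "0 + (d - 1) - m = d - m - 1" by simp
    show "lie_bracket E ((w m * omega_at k l m 0 d) \<cdot>\<^sub>m gh (k + l - m) (0 + d - m)) =
        of_nat d \<cdot>\<^sub>m ((w m * omega_at k l m 0 (d - 1)) \<cdot>\<^sub>m gh (k + l - m) (0 + (d - 1) - m))"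
      unfolding i by (simp only: add_0 lie_bracket_smult_right[OF carrier(1) gh_carrier] E smult_smult_mat s)
  qed auto
  also have "\<dots> = of_nat d \<cdot>\<^sub>m expansion k l w 0 (d - 1)"
    unfolding expansion_def by (rule mat_sum_smult) auto
  finally show ?thesis .
qed

text \<open>Skewness moves ad_F^z to \<open>F ^\<^sub>m q\<close>, with which F commutes.\<close>

lemma trace_g_F_pow_zero:
  assumes "0 < z"
  shows "mat_trace (g p z * F ^\<^sub>m q) = 0"
proof -
  obtain y where z: "z = Suc y" using assms by (cases z) auto
  have "(lie_bracket F ^^ z) (F ^\<^sub>m q) = (lie_bracket F ^^ y) (0\<^sub>m n n)"
    unfolding z using lie_bracket_pow_commute[OF carrier(3), of q] by (simp add: funpow_swap1)
  moreover have "(lie_bracket F ^^ y) (0\<^sub>m n n) = 0\<^sub>m n n"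
    by (induction y) auto
  ultimately show ?thesis
    using trace_lie_bracket_iter[OF carrier(3), of "E ^\<^sub>m p" "F ^\<^sub>m q" z] right_mult_zero_mat[of "E ^\<^sub>m p" n n n]
    by (simp add: g_def)
qed

text \<open>Only m = d survives: for m < d the vector is an image of \<open>ad_F\<close>, and for m
  > d the transvectant coefficient is 0.\<close>

lemma trace_expansion:
  assumes "l \<le> k" "d \<le> k + l"
  shows "mat_trace (expansion k l w 0 d * F ^\<^sub>m (k + l - d)) =
    (if d \<in> indices k l then w d * omega_at k l d 0 d * (fact (2 * (k + l - d)) * mat_trace (E ^\<^sub>m (k + l - d) * F ^\<^sub>m (k + l - d))) else 0)"
proof -
  let ?q = "k + l - d"
  have gF: "mat_trace ((c \<cdot>\<^sub>m gh p z) * F ^\<^sub>m ?q) = c * (fact (2 * p - z) * mat_trace (g p z * F ^\<^sub>m ?q))" for c p z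
  proof -
    have FF: "F ^\<^sub>m ?q \<in> carrier_mat n n" by simp
    show ?thesis
      by (simp add: gh_def smult_smult_mat mult_smult_assoc_mat[OF g_carrier FF] mat_trace_smult[OF mult_carrier_mat[OF g_carrier FF]])
  qed
  have "mat_trace (expansion k l w 0 d * F ^\<^sub>m ?q) =
      (\<Sum>m\<in>indices k l. mat_trace (((w m * omega_at k l m 0 d) \<cdot>\<^sub>m gh (k + l - m) (0 + d - m)) * F ^\<^sub>m ?q))"
    unfolding expansion_def by (rule mat_trace_mat_sum_mult) auto
  also have "\<dots> = (\<Sum>m\<in>indices k l. if m = d then w d * omega_at k l d 0 d * (fact (2 * ?q) * mat_trace (E ^\<^sub>m ?q * F ^\<^sub>m ?q)) else 0)"
  proof (intro sum.cong refl)
    fix m assume "m \<in> indices k l"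
    show "mat_trace (((w m * omega_at k l m 0 d) \<cdot>\<^sub>m gh (k + l - m) (0 + d - m)) * F ^\<^sub>m ?q) =
        (if m = d then w d * omega_at k l d 0 d * (fact (2 * ?q) * mat_trace (E ^\<^sub>m ?q * F ^\<^sub>m ?q)) else 0)"
    proof (cases m d rule: linorder_cases)
      case less
      then show ?thesis unfolding gF by (simp add: trace_g_F_pow_zero)
    next
      case equal
      then show ?thesis unfolding gF by simp
    next
      case greater
      then show ?thesis unfolding gF by (simp add: omega_at_eq_0)
    qed
  qed
  finally show ?thesis by simp
qed

lemma trace_bracket_highest:
  "mat_trace (lie_bracket (gh k 0) (gh l d) * F ^\<^sub>m q) =
    fact (2 * k) * fact (2 * l - d) * mat_trace (lie_bracket (E ^\<^sub>m k) (g l d) * F ^\<^sub>m q)"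
proof -
  have c: "lie_bracket (E ^\<^sub>m k) (g l d) \<in> carrier_mat n n" "F ^\<^sub>m q \<in> carrier_mat n n" by simp_all
  show ?thesis
    by (simp add: gh_def lie_bracket_smult_left[of _ n] lie_bracket_smult_right[of _ n] smult_smult_mat
        mult_smult_assoc_mat[OF c] mat_trace_smult[OF mult_carrier_mat[OF c]])
qed

text \<open>The solution for \<open>w m\<close> of the equation that \<open>trace_expansion\<close>
  yields at d = m; the factor (2k)! cancels between \<open>trace_bracket_highest\<close> and
  \<open>omega_at_diagonal\<close>.\<close>

definition structure_formula :: "nat \<Rightarrow> nat \<Rightarrow> nat \<Rightarrow> complex" where
  "structure_formula k l m = (if m \<in> indices k l then
     fact (2 * k - m) * fact (2 * l - m) * mat_trace (lie_bracket (E ^\<^sub>m k) (g l m) * F ^\<^sub>m (k + l - m))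
       / (fact m * fact (2 * (k + l - m)) * mat_trace (E ^\<^sub>m (k + l - m) * F ^\<^sub>m (k + l - m))) else 0)"

lemma omega_at_diagonal:
  assumes "m \<le> 2 * k"
  shows "omega_at k l m 0 m = fact (2 * k) / fact (2 * k - m) * fact m"
  using assms by (simp only: omega_at_highest falling_of_nat) simp

lemma bracket_expansion_highest:
  assumes lk: "l \<le> k" and d: "d \<le> 2 * l"
  shows "lie_bracket (gh k 0) (gh l d) = expansion k l (structure_formula k l) 0 d"
proof -
  have main: "lie_bracket (gh k 0) (gh l d) = expansion k l (structure_formula k l) 0 d"
    if d: "d \<le> 2 * l" and IH: "d = 0 \<or> lie_bracket (gh k 0) (gh l (d - 1)) = expansion k l (structure_formula k l) 0 (d - 1)" for d
  proof -
    let ?L = "\<lambda>d. lie_bracket (gh k 0) (gh l d)" and ?R = "expansion k l (structure_formula k l) 0"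
    have c: "?L d \<in> carrier_mat n n" "?R d \<in> carrier_mat n n" "?L d - ?R d \<in> carrier_mat n n"
      by (auto intro!: minus_carrier_mat)
    \<comment> \<open>\<open>gh k 0\<close> is killed by ad E, so only the second factor moves, to d
      - 1, where the induction hypothesis applies.\<close>
    have EL: "lie_bracket E (?L d) = of_nat d \<cdot>\<^sub>m ?L (d - 1)"
    proof -
      have "lie_bracket E (?L d) = lie_bracket (lie_bracket E (gh k 0)) (gh l d) + lie_bracket (gh k 0) (lie_bracket E (gh l d))"
        by (rule lie_bracket_jacobi[of _ n]) auto
      also have "lie_bracket E (gh k 0) = 0\<^sub>m n n"
        by (simp add: E_gh zero_smult_mat[of _ n])
      finally show ?thesis using d
        by (simp add: E_gh lie_bracket_smult_right[of _ n])
    qed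
    have "?L d - ?R d = 0\<^sub>m n n"
    proof (rule highest_weight_zero[OF c(3)])
      have "lie_bracket E (?L d - ?R d) = of_nat d \<cdot>\<^sub>m ?L (d - 1) - of_nat d \<cdot>\<^sub>m ?R (d - 1)"
        using lie_bracket_minus_right[OF carrier(1) c(1,2)] EL E_expansion[OF lk d] by simp
      also have "\<dots> = 0\<^sub>m n n"
      proof (cases "d = 0")
        case True
        then show ?thesis by (intro eq_matI) (auto simp: carrier_matD[OF expansion_carrier])
      next
        case False
        then have "?L (d - 1) = ?R (d - 1)" using IH by blast
        then show ?thesis by (intro eq_matI) (auto simp: carrier_matD[OF expansion_carrier])
      qed
      finally show "lie_bracket E (?L d - ?R d) = 0\<^sub>m n n" .
      let ?c = "2 * of_nat (k + l) - 2 * of_nat d :: complex"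
      have "lie_bracket H (?L d) = (2 * of_nat k - 2 * of_nat 0 + (2 * of_nat l - 2 * of_nat d)) \<cdot>\<^sub>m ?L d"
        by (rule lie_bracket_weight[OF carrier(2) gh_carrier gh_carrier H_gh H_gh])
      also have "2 * of_nat k - 2 * of_nat 0 + (2 * of_nat l - 2 * of_nat d) = ?c" by simp
      finally have HL: "lie_bracket H (?L d) = ?c \<cdot>\<^sub>m ?L d" .
      have HR: "lie_bracket H (?R d) = ?c \<cdot>\<^sub>m ?R d"
        using H_expansion[OF lk, of "structure_formula k l" 0 d] by simp
      show "lie_bracket H (?L d - ?R d) = ?c \<cdot>\<^sub>m (?L d - ?R d)"
        unfolding lie_bracket_minus_right[OF carrier(2) c(1,2)] HL HR
        using c by (intro eq_matI) (auto simp: algebra_simps carrier_matD[OF expansion_carrier])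
      fix q assume q: "q < n" "?c = 2 * of_nat q"
      have "of_nat (2 * (k + l)) = (of_nat (2 * (q + d)) :: complex)" using q(2) by (simp add: algebra_simps)
      then have "2 * (k + l) = 2 * (q + d)" by (simp only: of_nat_eq_iff)
      then have qd: "q = k + l - d" "d \<le> k + l" "d + q = k + l" by auto
      have cF: "F ^\<^sub>m q \<in> carrier_mat n n" by simp
      have "mat_trace ((?L d - ?R d) * F ^\<^sub>m q) = mat_trace (?L d * F ^\<^sub>m q) - mat_trace (?R d * F ^\<^sub>m q)"
        unfolding minus_mult_distrib_mat[OF c(1,2) cF]
        by (rule mat_trace_minus[OF mult_carrier_mat[OF c(1) cF] mult_carrier_mat[OF c(2) cF]])
      also have "\<dots> = 0"
      proof (cases "d \<in> indices k l")
        case True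
        have "d \<le> 2 * k" using d lk by simp
        then show ?thesis
          using True qd(1) q(1) trace_E_pow_F_pow_nonzero[OF q(1)]
          unfolding trace_bracket_highest qd(1) trace_expansion[OF lk qd(2)] omega_at_diagonal[OF \<open>d \<le> 2 * k\<close>]
          by (simp add: structure_formula_def)
      next
        case False
        \<comment> \<open>Since q < n, the index d can be missing only as an end value 0 or 2l. Both
          are even, so the commutator trace is 0 as well.\<close>
        then have "d = 0 \<or> d = 2 * l" using d q(1) qd(1) by (auto simp: indices_def)
        then have "even d" by auto
        then have "mat_trace (?L d * F ^\<^sub>m q) = 0"
          unfolding trace_bracket_highest using trace_commutator_word[OF qd(3)] d lk by simp
        moreover have "mat_trace (?R d * F ^\<^sub>m q) = 0"
          unfolding qd(1) trace_expansion[OF lk qd(2)] using False by simp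
        ultimately show ?thesis by simp
      qed
      finally show "mat_trace ((?L d - ?R d) * F ^\<^sub>m q) = 0" .
    qed
    then show ?thesis by (rule minus_mat_eq_0[OF c(1,2)])
  qed
  show ?thesis using d
  proof (induction d)
    case 0
    show ?case by (rule main) auto
  next
    case (Suc d)
    then show ?case by (intro main) auto
  qed
qed

text \<open>Applying \<open>ad_F\<close> to the relation at (b, d) produces those at (b + 1, d) and
  (b, d + 1) with coefficients 2k - b and 2l - d; the second is known, and 2k - b is nonzero because
  b < 2k.\<close>

lemma bracket_expansion:
  assumes lk: "l \<le> k" and "b \<le> 2 * k" "d \<le> 2 * l"
  shows "lie_bracket (gh k b) (gh l d) = expansion k l (structure_formula k l) b d"
  using assms(2,3)
proof (induction b arbitrary: d)
  case 0
  then show ?case using bracket_expansion_highest[OF lk] by simp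
next
  case (Suc b)
  let ?L = "\<lambda>b d. lie_bracket (gh k b) (gh l d)" and ?R = "expansion k l (structure_formula k l)"
  let ?a = "2 * of_nat k - of_nat b :: complex" and ?c = "2 * of_nat l - of_nat d :: complex"
  have "lie_bracket F (?L b d) = lie_bracket (lie_bracket F (gh k b)) (gh l d) + lie_bracket (gh k b) (lie_bracket F (gh l d))"
    by (rule lie_bracket_jacobi[of _ n]) auto
  also have "\<dots> = ?a \<cdot>\<^sub>m ?L (Suc b) d + ?c \<cdot>\<^sub>m ?L b (Suc d)"
    by (simp add: F_gh lie_bracket_smult_left[of _ n] lie_bracket_smult_right[of _ n])
  finally have FL: "lie_bracket F (?L b d) = ?a \<cdot>\<^sub>m ?L (Suc b) d + ?c \<cdot>\<^sub>m ?L b (Suc d)" .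
  have LR: "?L b d = ?R b d" by (rule Suc.IH) (use Suc.prems in auto)
  have sum: "?a \<cdot>\<^sub>m ?L (Suc b) d + ?c \<cdot>\<^sub>m ?L b (Suc d) = ?a \<cdot>\<^sub>m ?R (Suc b) d + ?c \<cdot>\<^sub>m ?R b (Suc d)"
    using FL unfolding LR F_expansion[OF lk] by (rule sym)
  \<comment> \<open>At d = 2l the induction hypothesis is out of range, but the coefficient 2l - d
    is 0.\<close>
  have last: "?c \<cdot>\<^sub>m ?L b (Suc d) = ?c \<cdot>\<^sub>m ?R b (Suc d)"
  proof (cases "d = 2 * l")
    case True
    then have "?c = 0" by simp
    then show ?thesis by (simp only: zero_smult_mat[OF lie_bracket_carrier[OF gh_carrier gh_carrier]] zero_smult_mat[OF expansion_carrier])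
  next
    case False
    then have "?L b (Suc d) = ?R b (Suc d)" by (intro Suc.IH) (use Suc.prems in auto)
    then show ?thesis by (simp only:)
  qed
  have "?a \<cdot>\<^sub>m ?L (Suc b) d = ?a \<cdot>\<^sub>m ?R (Suc b) d"
    by (rule add_mat_cancel_right[where n = n, OF _ _ _ sum[unfolded last]]) simp_all
  moreover have "?a \<noteq> 0"
  proof
    assume "?a = 0"
    then have "of_nat (2 * k) = (of_nat b :: complex)" by simp
    then have "2 * k = b" by (simp only: of_nat_eq_iff)
    then show False using Suc.prems by simp
  qed
  ultimately show ?case by (rule smult_mat_cancel)
qed

text \<open>A nonzero coefficient guarantees that no exponent truncates, so the monomial has degree
  2(k + l - m). With coefficient 0 the polynomial is 0 whatever its exponents.\<close>

lemma Phi_inv_transvectant: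
  assumes "b \<le> 2 * k" "d \<le> 2 * l" "m \<le> k + l" "k + l - m < n"
  shows "Phi_inv n E F (k + l - m) (bimonom (e * omega_at k l m b d) (2 * k - b + (2 * l - d) - m) (b + d - m)) =
    (e * omega_at k l m b d) \<cdot>\<^sub>m gh (k + l - m) (b + d - m)"
proof (cases "omega_at k l m b d = 0")
  case True
  have "Phi_inv n E F (k + l - m) (bimonom 0 (2 * (k + l - m) - 0) 0) = 0 \<cdot>\<^sub>m gh (k + l - m) 0"
    by (rule Phi_inv_bimonom) (use assms in auto)
  then show ?thesis using True by (simp add: zero_smult_mat[of _ n])
next
  case False
  have o: "2 * of_nat k - of_nat b = (of_nat (2 * k - b) :: complex)" "2 * of_nat l - of_nat d = (of_nat (2 * l - d) :: complex)"
    using assms by (simp_all add: of_nat_diff)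
  have y: "m \<le> b + d" using False omega_at_eq_0 by (metis not_less)
  have x: "m \<le> 2 * k - b + (2 * l - d)"
    using False omega_sum_eq_0_x unfolding omega_at_def o by (metis not_less)
  have "2 * k - b + (2 * l - d) - m = 2 * (k + l - m) - (b + d - m)"
    using assms x y by linarith
  moreover have "b + d - m \<le> 2 * (k + l - m)" using assms x y by linarith
  ultimately show ?thesis using Phi_inv_bimonom[OF assms(4)] by simp
qed

text \<open>Passing to \<open>gh\<close> and plain monomials multiplies both sides of each relation
  by the same nonzero factor, the \<open>e\<close> of the proof.\<close>

lemma is_structure_constants_iff:
  assumes lk: "l \<le> k" and l: "1 \<le> l"
  shows "is_structure_constants n E F k l w \<longleftrightarrow>
    (\<forall>m. m \<notin> indices k l \<longrightarrow> w m = 0) \<and>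
    (\<forall>b\<le>2 * k. \<forall>d\<le>2 * l. lie_bracket (gh k b) (gh l d) = expansion k l w b d)"
proof -
  have ind: "m \<notin> {1..2 * l - 1} \<or> n \<le> k + l - m \<longleftrightarrow> m \<notin> indices k l" for m
    by (auto simp: indices_def)
  have eq: "lie_bracket (G_elt E F k i) (G_elt E F l j) =
      mat_sum n (\<lambda>m. w m \<cdot>\<^sub>m Phi_inv n E F (k + l - m) (transvectant m (m_elt k i) (m_elt l j))) (indices k l) \<longleftrightarrow>
      lie_bracket (gh k (nat (int k - i))) (gh l (nat (int l - j))) = expansion k l w (nat (int k - i)) (nat (int l - j))"
    if i: "i \<in> {- int k..int k}" and j: "j \<in> {- int l..int l}" for i j
  proof -
    define b where "b = nat (int k - i)"
    define d where "d = nat (int l - j)"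
    have b: "b \<le> 2 * k" "nat (int k + i) = 2 * k - b" and d: "d \<le> 2 * l" "nat (int l + j) = 2 * l - d"
      using i j by (auto simp: b_def d_def)
    have o: "of_nat (2 * k - b) = (2 * of_nat k - of_nat b :: complex)" "of_nat (2 * l - d) = (2 * of_nat l - of_nat d :: complex)"
      using b(1) d(1) by (simp_all add: of_nat_diff)
    define e where "e = (1 / fact (2 * k - b) * (1 / fact (2 * l - d)) :: complex)"
    have e: "e \<noteq> 0" by (simp add: e_def)
    have tr: "transvectant m (m_elt k i) (m_elt l j) =
        bimonom (e * omega_at k l m b d) (2 * k - b + (2 * l - d) - m) (b + d - m)" for m
      unfolding m_elt_bimonom transvectant_bimonom b(2) d(2) b_def[symmetric] d_def[symmetric] o omega_at_def e_def ..
    have "mat_sum n (\<lambda>m. w m \<cdot>\<^sub>m Phi_inv n E F (k + l - m) (transvectant m (m_elt k i) (m_elt l j))) (indices k l) =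
        mat_sum n (\<lambda>m. e \<cdot>\<^sub>m ((w m * omega_at k l m b d) \<cdot>\<^sub>m gh (k + l - m) (b + d - m))) (indices k l)"
    proof (rule mat_sum_cong)
      fix m assume "m \<in> indices k l"
      then have m: "m \<le> k + l" "k + l - m < n" using lk by (auto simp: indices_def)
      show "w m \<cdot>\<^sub>m Phi_inv n E F (k + l - m) (transvectant m (m_elt k i) (m_elt l j)) =
          e \<cdot>\<^sub>m ((w m * omega_at k l m b d) \<cdot>\<^sub>m gh (k + l - m) (b + d - m))"
        unfolding tr Phi_inv_transvectant[OF b(1) d(1) m] by (simp add: smult_smult_mat mult_ac)
    qed auto
    also have "\<dots> = e \<cdot>\<^sub>m expansion k l w b d"
      unfolding expansion_def by (rule mat_sum_smult) auto
    finally have R: "mat_sum n (\<lambda>m. w m \<cdot>\<^sub>m Phi_inv n E F (k + l - m) (transvectant m (m_elt k i) (m_elt l j))) (indices k l) =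
        e \<cdot>\<^sub>m expansion k l w b d" .
    have "e * (fact (2 * l - d) * fact (2 * k - b)) = 1" by (simp add: e_def)
    then have L: "lie_bracket (G_elt E F k i) (G_elt E F l j) = e \<cdot>\<^sub>m lie_bracket (gh k b) (gh l d)"
      unfolding G_elt_eq_g b_def[symmetric] d_def[symmetric] gh_def
      by (simp add: lie_bracket_smult_left[of _ n] lie_bracket_smult_right[of _ n] smult_smult_mat one_smult_mat)
    show ?thesis unfolding L R b_def[symmetric] d_def[symmetric]
      using smult_mat_cancel[OF _ e] by metis
  qed
  have "(\<forall>i\<in>{- int k..int k}. \<forall>j\<in>{- int l..int l}.
      lie_bracket (gh k (nat (int k - i))) (gh l (nat (int l - j))) = expansion k l w (nat (int k - i)) (nat (int l - j))) \<longleftrightarrow>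
    (\<forall>b\<le>2 * k. \<forall>d\<le>2 * l. lie_bracket (gh k b) (gh l d) = expansion k l w b d)" (is "?A \<longleftrightarrow> ?B")
  proof
    assume A: ?A
    show ?B
    proof (intro allI impI)
      fix b d assume "b \<le> 2 * k" "d \<le> 2 * l"
      then show "lie_bracket (gh k b) (gh l d) = expansion k l w b d"
        using A[rule_format, of "int k - int b" "int l - int d"] by simp
    qed
  next
    assume ?B
    then show ?A by (auto simp: nat_le_iff)
  qed
  then show ?thesis
    unfolding is_structure_constants_def ind indices_def[symmetric] using eq by simp
qed

theorem structure_constant_eq:
  assumes lk: "l \<le> k" and l: "1 \<le> l"
  shows "structure_constant n E F k l = structure_formula k l"
proof -
  have "(THE w. is_structure_constants n E F k l w) = structure_formula k l"
  proof (rule the_equality)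
    show "is_structure_constants n E F k l (structure_formula k l)"
      unfolding is_structure_constants_iff[OF assms] using bracket_expansion[OF lk]
      by (simp add: structure_formula_def)
  next
    \<comment> \<open>The relations with b = 0 suffice for uniqueness: at d = m the trace against
      F^(k+l-m) contains \<open>w m\<close> with a nonzero coefficient.\<close>
    fix w assume "is_structure_constants n E F k l w"
    then have w0: "\<And>m. m \<notin> indices k l \<Longrightarrow> w m = 0"
      and w: "\<And>d. d \<le> 2 * l \<Longrightarrow> lie_bracket (gh k 0) (gh l d) = expansion k l w 0 d"
      unfolding is_structure_constants_iff[OF assms] by simp_all
    show "w = structure_formula k l"
    proof
      fix m
      show "w m = structure_formula k l m"
      proof (cases "m \<in> indices k l")
        case True
        let ?q = "k + l - m"
        have m: "m \<le> 2 * l" "m \<le> 2 * k" "m \<le> k + l" and q: "?q < n" using True lk by (auto simp: indices_def)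
        have "mat_trace (lie_bracket (gh k 0) (gh l m) * F ^\<^sub>m ?q) = mat_trace (expansion k l w 0 m * F ^\<^sub>m ?q)"
          unfolding w[OF m(1)] ..
        then have "fact (2 * k) * fact (2 * l - m) * mat_trace (lie_bracket (E ^\<^sub>m k) (g l m) * F ^\<^sub>m ?q) =
            w m * (fact (2 * k) / fact (2 * k - m) * fact m) * (fact (2 * ?q) * mat_trace (E ^\<^sub>m ?q * F ^\<^sub>m ?q))"
          unfolding trace_bracket_highest trace_expansion[OF lk m(3)] omega_at_diagonal[OF m(2)] using True by simp
        moreover have "c * b * t = v * (x * d * s)" if "a * b * t = v * (a / c * x) * (d * s)" "a \<noteq> 0" "c \<noteq> 0"
          for a b c d s t v x :: complex
          using that by (simp add: field_simps)
        ultimately have "fact (2 * k - m) * fact (2 * l - m) * mat_trace (lie_bracket (E ^\<^sub>m k) (g l m) * F ^\<^sub>m ?q) =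
            w m * (fact m * fact (2 * ?q) * mat_trace (E ^\<^sub>m ?q * F ^\<^sub>m ?q))"
          by (metis fact_nonzero)
        then show ?thesis
          using True trace_E_pow_F_pow_nonzero[OF q] unfolding structure_formula_def
          by (simp only: if_True nonzero_mult_div_cancel_right mult_eq_0_iff fact_nonzero simp_thms)
      next
        case False
        then show ?thesis using w0 by (simp add: structure_formula_def)
      qed
    qed
  qed
  then show ?thesis by (simp add: structure_constant_def fun_eq_iff)
qed

end

section \<open>The explicit formula\<close>

lemma R_coeff_eq_racah_sum:
  fixes n k l m :: nat
  assumes "0 < n" "m \<le> 2 * k" "m \<le> 2 * l"
  shows "R_coeff n k l m = (- 1) ^ (k + l + n - 1) * racah_sum n k l m"
proof -
  define h where "h = (\<lambda>q :: int. (- 1) powi q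
     * zbinom (q + 1) (2 * int k + 2 * int l - int m + 1)
     * zbinom (int m) (q - int k - int l + int m - int n + 1)
     * zbinom (2 * int k - int m) (q - int l - int n + 1)
     * zbinom (2 * int l - int m) (q - int k - int n + 1))"
  define \<phi> where "\<phi> = (\<lambda>r :: nat. int (k + l + n - 1) - int r)"
  let ?S = "{..min m (min k l)}"
  have N: "int (k + l + n - 1) = int k + int l + int n - 1" using assms(1) by (simp add: of_nat_diff)
  \<comment> \<open>The second binomial confines r = k + l + n - 1 - q to 0..m, the third forces r
    \<le> k and the fourth r \<le> l.\<close>
  have "{q. h q \<noteq> 0} \<subseteq> \<phi> ` ?S"
  proof
    fix q assume "q \<in> {q. h q \<noteq> 0}"
    then have z: "zbinom (int m) (q - int k - int l + int m - int n + 1) \<noteq> 0"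
      "zbinom (2 * int k - int m) (q - int l - int n + 1) \<noteq> 0"
      "zbinom (2 * int l - int m) (q - int k - int n + 1) \<noteq> 0" by (auto simp: h_def)
    then have q: "0 \<le> q - int k - int l + int m - int n + 1" "q - int k - int l + int m - int n + 1 \<le> int m"
      "0 \<le> q - int l - int n + 1" "0 \<le> q - int k - int n + 1"
      unfolding zbinom_def by presburger+
    define r where "r = nat (int (k + l + n - 1) - q)"
    have "q = \<phi> r" "r \<in> ?S" using q N unfolding \<phi>_def r_def by auto
    then show "q \<in> \<phi> ` ?S" by blast
  qed
  then have "R_coeff n k l m = sum h (\<phi> ` ?S)"
    unfolding R_coeff_def h_def[symmetric] by (intro Sum_any.expand_superset) auto
  also have "\<dots> = (\<Sum>r\<in>?S. h (\<phi> r))"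
    by (subst sum.reindex) (auto simp: inj_on_def \<phi>_def)
  also have "\<dots> = (\<Sum>r\<in>?S. (- 1) ^ (k + l + n - 1) * ((- 1) ^ r * of_nat ((m choose r) *
     (2 * k - m choose (k - r)) * (2 * l - m choose (l - r)) * (n + k + l - r choose (2 * k + 2 * l - m + 1)))))"
  proof (intro sum.cong refl)
    fix r assume "r \<in> ?S"
    then have r: "r \<le> m" "r \<le> k" "r \<le> l" by auto
    have zb: "zbinom (int a) (int b) = of_nat (a choose b)" for a b
      by (auto simp: zbinom_def binomial_eq_0)
    have "(- 1 :: complex) powi \<phi> r = (- 1) powi int (k + l + n - 1) * (- 1) powi (- int r)"
      unfolding \<phi>_def by (subst power_int_add[symmetric]) auto
    also have "\<dots> = (- 1) ^ (k + l + n - 1) * (- 1) ^ r"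
      by (simp add: power_int_minus flip: power_inverse)
    finally have sign: "(- 1 :: complex) powi \<phi> r = (- 1) ^ (k + l + n - 1) * (- 1) ^ r" .
    have i: "\<phi> r + 1 = int (n + k + l - r)"
      "2 * int k + 2 * int l - int m + 1 = int (2 * k + 2 * l - m + 1)"
      "\<phi> r - int k - int l + int m - int n + 1 = int (m - r)"
      "2 * int k - int m = int (2 * k - m)" "\<phi> r - int l - int n + 1 = int (k - r)"
      "2 * int l - int m = int (2 * l - m)" "\<phi> r - int k - int n + 1 = int (l - r)"
      using r assms unfolding \<phi>_def N by (simp_all add: of_nat_diff)
    have "(m choose (m - r)) = (m choose r)" using r(1) by (rule binomial_symmetric[symmetric])
    then show "h (\<phi> r) = (- 1) ^ (k + l + n - 1) * ((- 1) ^ r * of_nat ((m choose r) *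
     (2 * k - m choose (k - r)) * (2 * l - m choose (l - r)) * (n + k + l - r choose (2 * k + 2 * l - m + 1))))"
      unfolding h_def sign i zb by (simp add: mult_ac)
  qed
  also have "\<dots> = (- 1) ^ (k + l + n - 1) * racah_sum n k l m"
    unfolding racah_sum_def sum_distrib_left ..
  finally show ?thesis .
qed

text \<open>With q = k + l - m: the factor 2 of \<open>Q_coeff\<close> is 1 - (-1)^m, the factor 2q
  + 1 is the quotient of (2q + 1)! from tr(E^q F^q) by the (2q)! of \<open>gh\<close>, and the signs
  of \<open>Q_coeff\<close> and \<open>R_coeff\<close> cancel.\<close>

lemma structure_constant_odd:
  assumes triple: "principal_sl2_triple n E H F" and n: "0 < n"
    and lk: "1 \<le> l" "l \<le> k" and m: "1 \<le> m" "m \<le> 2 * l - 1" "odd m" and p: "k + l - m < n"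
  shows "structure_constant n E F k l m = Q_coeff n k l m * R_coeff n k l m"
proof -
  interpret principal_triple n E H F by unfold_locales (fact n triple)+
  define q where "q = k + l - m"
  have qm: "m + q = k + l" "m \<le> 2 * k" "m \<le> 2 * l" and qn: "q < n" using lk m p by (auto simp: q_def)
  have "m \<in> indices k l" using m p by (auto simp: indices_def)
  then have "structure_constant n E F k l m = fact (2 * k - m) * fact (2 * l - m) *
      (2 * ((fact k * fact l * fact q)\<^sup>2 / (fact (2 * k - m) * fact (2 * l - m)) * racah_sum n k l m)) /
      (fact m * fact (2 * q) * ((fact q)\<^sup>2 * of_nat (n + q choose (2 * q + 1))))"
    unfolding structure_constant_eq[OF lk(2,1)] structure_formula_def q_def[symmetric]
      trace_commutator_word[OF qm] trace_E_pow_F_pow using m(3) by simp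
  also have "of_nat (n + q choose (2 * q + 1)) = (fact (n + q) / (fact (2 * q + 1) * fact (n - q - 1)) :: complex)"
  proof -
    have "n + q - (2 * q + 1) = n - q - 1" by simp
    then show ?thesis using qn by (subst binomial_fact) simp_all
  qed
  also have "(fact (2 * q + 1) :: complex) = of_nat (2 * q + 1) * fact (2 * q)" by simp
  also have "fact (2 * k - m) * fact (2 * l - m) *
      (2 * ((fact k * fact l * fact q)\<^sup>2 / (fact (2 * k - m) * fact (2 * l - m)) * racah_sum n k l m)) /
      (fact m * fact (2 * q) * ((fact q)\<^sup>2 * (fact (n + q) / (of_nat (2 * q + 1) * fact (2 * q) * fact (n - q - 1))))) =
      2 * of_nat (2 * q + 1) * ((fact k)\<^sup>2 * (fact l)\<^sup>2 * fact (n - q - 1)) / (fact m * fact (n + q)) * racah_sum n k l m"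
    (is "?lhs = ?rhs")
  proof -
    have alg: "a * b * (2 * ((x * y * z)\<^sup>2 / (a * b) * r)) / (c * d * (z\<^sup>2 * (e / (f * d * g)))) =
        2 * f * (x\<^sup>2 * y\<^sup>2 * g) / (c * e) * r"
      if "a \<noteq> 0" "b \<noteq> 0" "d \<noteq> 0" "z \<noteq> 0" for a b c d e f g r x y z :: complex
      using that by (simp add: field_simps power_mult_distrib)
    show ?thesis by (rule alg) simp_all
  qed
  also have "\<dots> = Q_coeff n k l m * R_coeff n k l m"
  proof -
    have idx: "2 * k + 2 * l - 2 * m + 1 = 2 * q + 1" "n + m - (k + l + 1) = n - q - 1" "n + k + l - m = n + q"
      using qm(1) qn by auto
    have sq: "(- 1 :: complex) ^ (k + l + n - 1) * (- 1) ^ (k + l + n - 1) = 1"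
      by (simp flip: power_mult_distrib)
    have "Q_coeff n k l m * R_coeff n k l m = ((- 1) ^ (k + l + n - 1) * (- 1) ^ (k + l + n - 1)) * ?rhs"
      unfolding Q_coeff_def R_coeff_eq_racah_sum[OF n qm(2,3)] idx by (simp add: mult_ac)
    then show ?thesis unfolding sq by (simp only: mult_1)
  qed
  finally show ?thesis .
qed

theorem theorem1p3:
  fixes n k l m :: nat and E H F :: "complex mat"
  assumes "n \<ge> 2"
    and "principal_sl2_triple n E H F"
    and "1 \<le> l" and "l \<le> k" and "k \<le> n - 1"
    and "1 \<le> m" and "m \<le> 2 * l - 1"
  shows "(even m \<longrightarrow> structure_constant n E F k l m = 0) \<and>
         (odd m \<longrightarrow> structure_constant n E F k l m =
            (if k + l - m \<ge> n then 0 else Q_coeff n k l m * R_coeff n k l m))"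
proof (intro conjI impI)
  have n: "0 < n" using assms(1) by simp
  interpret principal_triple n E H F by unfold_locales (fact n assms(2))+
  note eq = structure_constant_eq[OF assms(4,3)]
  have m: "m + (k + l - m) = k + l" "m \<le> 2 * k" "m \<le> 2 * l" using assms by linarith+
  show "structure_constant n E F k l m = 0" if "even m"
    using that unfolding eq structure_formula_def trace_commutator_word[OF m] by simp
  show "structure_constant n E F k l m = (if k + l - m \<ge> n then 0 else Q_coeff n k l m * R_coeff n k l m)" if "odd m"
  proof (cases "k + l - m \<ge> n")
    case True
    then show ?thesis unfolding eq structure_formula_def by (simp add: indices_def)
  next
    case False
    then show ?thesis using structure_constant_odd[OF assms(2) n assms(3,4,6,7) that] by simp
  qed
qed

end
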